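(* Let $J=(a,b)\subset\mathbb{R}$, let $\Omega\subset\mathbb{R}^n$ be open and $\mathbf{v}\in C^1(J\times\Omega;\mathbb{R}^n)$. Let $t_0\in J$ and let $G_0\subset\Omega$ be a compact Lipschitz domain. Let $r>0$ be such that the co-moving volumes $G(t)=\Phi_{t_0}^t(G_0)$ exist for all $t\in J_0:=(t_0-r,t_0+r)\cap J$. Let $\psi\in W^{1,1}(J_0\times\Omega)$, identified with its Bochner–Sobolev representative $\psi\in W^{1,1}(J_0;L^1(\Omega))\hookrightarrow C(J_0;L^1(\Omega))$. Then $$\int_{G(\tau)}\psi(\tau,\mathbf{x})\,d\mathbf{x}=\int_{G(\sigma)}\psi(\sigma,\mathbf{x})\,d\mathbf{x}+\int_\sigma^\tau\int_{G(t)}\bigl(\partial_t\psi+\operatorname{div}(\psi\mathbf{v})\bigr)(t,\mathbf{x})\,d\mathbf{x}\,dt$$ for all $[\sigma,\tau]\subset J_0$. Consequently, the identity $$\frac{d}{dt}\int_{G(t)}\psi(t,\mathbf{x})\,d\mathbf{x}=\int_{G(t)}\bigl(\partial_t\psi(t,\mathbf{x})+\operatorname{div}(\psi(t,\mathbf{x})\mathbf{v}(t,\mathbf{x}))\bigr)\,d\mathbf{x}$$ holds for a.e. $t\in J_0$, and it holds for all $t\in J_0$ in case $\psi\in C^1(J_0\times\Omega)$.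
   Context: A bounded Lipschitz domain is a bounded open set $U\subset\mathbb{R}^m$ (connectedness is not required) such that near every boundary point, after a rigid motion, $U$ coincides with the set of points lying strictly above the graph of a Lipschitz function. A compact Lipschitz domain is a compact set $K\subset\mathbb{R}^m$ with $K=\overline{\operatorname{int}K}$ such that $\operatorname{int}K$ is a bounded Lipschitz domain. $\Phi_{t_0}^t(\mathbf{x}_0):=\mathbf{x}(t;t_0,\mathbf{x}_0)$ denotes the flow map, where $\mathbf{x}(\cdot;t_0,\mathbf{x}_0)$ is the unique solution of $\dot{\mathbf{x}}(t)=\mathbf{v}(t,\mathbf{x}(t))$, $\mathbf{x}(t_0)=\mathbf{x}_0$. "The co-moving volumes exist for all $t\in J_0$" means that for every $\mathbf{x}_0\in G_0$ this solution exists (in $\Omega$) on $J_0$. The operator $\operatorname{div}$ is the divergence in the space variable $\mathbf{x}$. *)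

theory Defs
  imports "HOL-Analysis.Analysis"
begin

section \<open>Functions of class $C^k$\<close>

text \<open>
  \<open>S\<close> is meant to be open. \<open>frechet_derivative f (at x) h\<close> is the derivative of \<open>f\<close> at \<open>x\<close>
  in direction \<open>h\<close>; in finite dimensions, continuity of all directional derivatives is
  continuity of the derivative.
\<close>

primrec Ck_on :: "nat \<Rightarrow> 'a::euclidean_space set \<Rightarrow> ('a \<Rightarrow> 'b::euclidean_space) \<Rightarrow> bool" where
  "Ck_on 0 S f \<longleftrightarrow> continuous_on S f"
| "Ck_on (Suc k) S f \<longleftrightarrow>
     (\<forall>x\<in>S. f differentiable (at x)) \<and>
     (\<forall>h. Ck_on k S (\<lambda>x. frechet_derivative f (at x) h))"

section \<open>Weak derivatives and $W^{1,1}$\<close>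

definition test_function :: "'a::euclidean_space set \<Rightarrow> ('a \<Rightarrow> real) \<Rightarrow> bool" where
  "test_function S \<phi> \<longleftrightarrow>
     (\<forall>k. Ck_on k UNIV \<phi>) \<and> compact (closure {x. \<phi> x \<noteq> 0}) \<and> closure {x. \<phi> x \<noteq> 0} \<subseteq> S"

definition locally_integrable_on :: "'a::euclidean_space set \<Rightarrow> ('a \<Rightarrow> real) \<Rightarrow> bool" where
  "locally_integrable_on S f \<longleftrightarrow> (\<forall>K. compact K \<and> K \<subseteq> S \<longrightarrow> set_integrable lebesgue K f)"

definition has_weak_partial ::
  "'a::euclidean_space set \<Rightarrow> 'a \<Rightarrow> ('a \<Rightarrow> real) \<Rightarrow> ('a \<Rightarrow> real) \<Rightarrow> bool" where
  "has_weak_partial S e f g \<longleftrightarrow>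
     locally_integrable_on S f \<and> locally_integrable_on S g \<and>
     (\<forall>\<phi>. test_function S \<phi> \<longrightarrow>
        (LINT x:S|lebesgue. f x * frechet_derivative \<phi> (at x) e) =
        - (LINT x:S|lebesgue. g x * \<phi> x))"

text \<open>The weak derivative is unique up to null sets; an arbitrary representative is chosen.\<close>

definition weak_partial :: "'a::euclidean_space set \<Rightarrow> 'a \<Rightarrow> ('a \<Rightarrow> real) \<Rightarrow> 'a \<Rightarrow> real" where
  "weak_partial S e f = (SOME g. has_weak_partial S e f g)"

definition W11 :: "'a::euclidean_space set \<Rightarrow> ('a \<Rightarrow> real) \<Rightarrow> bool" where
  "W11 S f \<longleftrightarrow> set_integrable lebesgue S f \<and>
     (\<forall>e\<in>Basis. \<exists>g. has_weak_partial S e f g \<and> set_integrable lebesgue S g)"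

text \<open>
  The space-time domain \<open>S\<close> consists of pairs \<open>(t, x)\<close>. The divergence acts on \<open>x\<close> only.
\<close>

definition weak_dt :: "(real \<times> (real^'n)) set \<Rightarrow> (real \<Rightarrow> real^'n \<Rightarrow> real) \<Rightarrow> real \<Rightarrow> real^'n \<Rightarrow> real" where
  "weak_dt S f t x = weak_partial S (1, 0) (\<lambda>(s, y). f s y) (t, x)"

definition weak_div ::
  "(real \<times> (real^'n)) set \<Rightarrow> (real \<Rightarrow> real^'n \<Rightarrow> real^'n) \<Rightarrow> real \<Rightarrow> real^'n \<Rightarrow> real" where
  "weak_div S F t x =
     (\<Sum>i\<in>UNIV. weak_partial S (0, axis i 1) (\<lambda>(s, y). F s y $ i) (t, x))"

definition divergence :: "(real^'n \<Rightarrow> real^'n) \<Rightarrow> real^'n \<Rightarrow> real" where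
  "divergence F x = (\<Sum>i\<in>UNIV. frechet_derivative (\<lambda>y. F y $ i) (at x) (axis i 1))"

text \<open>
  \<open>\<psi> \<in> C(I; L\<^sup>1(\<Omega>))\<close>. In an almost-everywhere class in $W^{1,1}(I\times\Omega)$, the functions
  with this property are the pointwise versions of its Bochner--Sobolev representative: every
  single slice \<open>\<psi> t\<close> is then determined up to a null set of \<open>\<Omega>\<close>.
\<close>

definition continuous_into_L1 ::
  "real set \<Rightarrow> (real^'n) set \<Rightarrow> (real \<Rightarrow> real^'n \<Rightarrow> real) \<Rightarrow> bool" where
  "continuous_into_L1 I \<Omega> \<psi> \<longleftrightarrow>
     (\<forall>t\<in>I. set_integrable lebesgue \<Omega> (\<psi> t)) \<and>
     (\<forall>s\<in>I. ((\<lambda>t. LINT x:\<Omega>|lebesgue. \<bar>\<psi> t x - \<psi> s x\<bar>) \<longlongrightarrow> 0) (at s within I))"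

section \<open>Lipschitz domains\<close>

text \<open>
  \<open>\<lambda>x. c + Q x\<close> is the rigid motion (reflections are allowed), \<open>k\<close> is the vertical coordinate
  and the hyperplane \<open>{y. y $ k = 0}\<close> plays the role of the space of horizontal variables on
  which \<open>\<gamma>\<close> is defined.
\<close>

definition lipschitz_graph_near :: "(real^'n) set \<Rightarrow> real^'n \<Rightarrow> bool" where
  "lipschitz_graph_near U p \<longleftrightarrow>
     (\<exists>(Q :: real^'n \<Rightarrow> real^'n) c k \<gamma> L \<epsilon>.
        orthogonal_transformation Q \<and> L-lipschitz_on {y. y $ k = 0} \<gamma> \<and> \<epsilon> > 0 \<and>
        (\<forall>x\<in>ball p \<epsilon>. x \<in> U \<longleftrightarrow>
           (let y = c + Q x in y $ k > (\<gamma> (y - (y $ k) *\<^sub>R axis k 1) :: real))))"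

definition bounded_lipschitz_domain :: "(real^'n) set \<Rightarrow> bool" where
  "bounded_lipschitz_domain U \<longleftrightarrow>
     open U \<and> bounded U \<and> (\<forall>p\<in>frontier U. lipschitz_graph_near U p)"

definition compact_lipschitz_domain :: "(real^'n) set \<Rightarrow> bool" where
  "compact_lipschitz_domain K \<longleftrightarrow>
     compact K \<and> K = closure (interior K) \<and> bounded_lipschitz_domain (interior K)"

section \<open>Flow map and co-moving volumes\<close>

definition ode_solution ::
  "(real \<Rightarrow> real^'n \<Rightarrow> real^'n) \<Rightarrow> (real^'n) set \<Rightarrow> real set \<Rightarrow> real \<Rightarrow> real^'n \<Rightarrow>
   (real \<Rightarrow> real^'n) \<Rightarrow> bool" where
  "ode_solution v \<Omega> I t\<^sub>0 x\<^sub>0 x \<longleftrightarrow>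
     t\<^sub>0 \<in> I \<and> x t\<^sub>0 = x\<^sub>0 \<and>
     (\<forall>t\<in>I. x t \<in> \<Omega> \<and> (x has_vector_derivative v t (x t)) (at t within I))"

text \<open>
  The value at time \<open>t\<close> of the solution through \<open>(t\<^sub>0, x\<^sub>0)\<close>, which may live on any open
  subinterval of \<open>J\<close> containing \<open>t\<^sub>0\<close> and \<open>t\<close>.
\<close>

definition flow_map ::
  "(real \<Rightarrow> real^'n \<Rightarrow> real^'n) \<Rightarrow> real set \<Rightarrow> (real^'n) set \<Rightarrow> real \<Rightarrow> real \<Rightarrow> real^'n \<Rightarrow> real^'n" where
  "flow_map v J \<Omega> t\<^sub>0 t x\<^sub>0 =
     (THE y. \<exists>I x. open I \<and> is_interval I \<and> I \<subseteq> J \<and> t \<in> I \<and> ode_solution v \<Omega> I t\<^sub>0 x\<^sub>0 x \<and> y = x t)"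

definition comoving_volume ::
  "(real \<Rightarrow> real^'n \<Rightarrow> real^'n) \<Rightarrow> real set \<Rightarrow> (real^'n) set \<Rightarrow> real \<Rightarrow> (real^'n) set \<Rightarrow> real \<Rightarrow>
   (real^'n) set" where
  "comoving_volume v J \<Omega> t\<^sub>0 G\<^sub>0 t = flow_map v J \<Omega> t\<^sub>0 t ` G\<^sub>0"

definition comoving_volumes_exist ::
  "(real \<Rightarrow> real^'n \<Rightarrow> real^'n) \<Rightarrow> (real^'n) set \<Rightarrow> real \<Rightarrow> (real^'n) set \<Rightarrow> real set \<Rightarrow> bool" where
  "comoving_volumes_exist v \<Omega> t\<^sub>0 G\<^sub>0 I \<longleftrightarrow> (\<forall>x\<^sub>0\<in>G\<^sub>0. \<exists>x. ode_solution v \<Omega> I t\<^sub>0 x\<^sub>0 x)"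

end

(*
  The weak equation for psi is tested with (mollified) functions chi(t) * max(0, 1 - m d(t,x)), where
  d(t,x) is the distance from x to G(t) and chi is a cutoff in time. As G is carried by the flow of v,
  the derivative of d along the space-time field (1, v) is bounded by a multiple of d, so that the
  derivative of the spatial cutoff along the field is bounded uniformly in m and tends to 0 pointwise.
  In the limit the spatial cutoff becomes the indicator of G(t), and letting chi tend to the indicator
  of [sigma, tau] at the same time gives the integral formula, without any change of variables. The
  formula makes the integral over G(t) a primitive, which is differentiable almost everywhere by
  Lebesgue's theorem; for psi of class C^1 the integrand is continuous in t because the volume of G(t)
  is, by the formula for the constant function 1.
*)
theory Submission
  imports Defs
begin

section \<open>Smooth functions\<close>

text \<open>The weak equation admits smooth test functions only, while the distance to
  \<open>G t\<close> is merely Lipschitz and the cutoff built from it need not be differentiable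
  along the field. So only bounds for difference quotients along (1, v) are proved for it, and
  mollification turns them into bounds for a derivative: the commutator with the field is harmless,
  because a Lipschitz function feels only the oscillation of a continuous field on a small ball.
  Where the cutoff is positive the distance is below 1/m, which compensates its slope m; hence the
  rate stays bounded, and being zero on \<open>G t\<close> and eventually zero off it, it tends to 0
  pointwise. Two limits compete at the end times: the ramp of the time cutoff must be so short that
  the spatial cutoff hardly moves during it, which the scale 1/m^2 ensures. Uniform constants come
  from the compactness of the tube swept out by the flow, so everything is done on compact windows
  \<open>[c, d]\<close> inside \<open>J\<^sub>0\<close> that contain
  \<open>t\<^sub>0\<close>.\<close>

lemma Ck_on_Suc_D: "Ck_on (Suc k) S f \<Longrightarrow> Ck_on k S f"
proof (induction k arbitrary: f)
  case 0
  then show ?case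
    by (auto intro!: continuous_at_imp_continuous_on differentiable_imp_continuous_within)
next
  case (Suc k)
  then show ?case by (metis Ck_on.simps(2))
qed

lemma Ck_on_subset: "Ck_on k S f \<Longrightarrow> T \<subseteq> S \<Longrightarrow> Ck_on k T f"
  by (induction k arbitrary: f) (auto intro: continuous_on_subset)

text \<open>Uniqueness of the derivative lets an explicit formula replace
  \<open>frechet_derivative\<close>, so the closure properties below become inductions on the order
  over such formulas.\<close>

lemma Ck_on_UNIV_SucI:
  assumes "\<And>x. (f has_derivative f' x) (at x)" "\<And>h. Ck_on k UNIV (\<lambda>x. f' x h)"
  shows "Ck_on (Suc k) UNIV f"
proof -
  have "frechet_derivative f (at x) = f' x" for x
    using assms(1) frechet_derivative_at by metis
  then show ?thesis
    using assms by (auto simp: differentiable_def)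
qed

lemma Ck_on_const: "Ck_on k UNIV (\<lambda>x. c)"
proof (induction k arbitrary: c)
  case (Suc k)
  then show ?case by (intro Ck_on_UNIV_SucI[where f'="\<lambda>x h. 0"]) auto
qed auto

lemma Ck_on_bounded_linear:
  assumes "bounded_linear f" shows "Ck_on k UNIV f"
proof (cases k)
  case 0
  then show ?thesis by (simp add: assms linear_continuous_on)
next
  case (Suc n)
  show ?thesis unfolding Suc
    by (rule Ck_on_UNIV_SucI[where f'="\<lambda>x. f"])
      (use assms Ck_on_const in \<open>auto intro!: bounded_linear_imp_has_derivative\<close>)
qed

lemma Ck_on_add:
  "Ck_on k UNIV f \<Longrightarrow> Ck_on k UNIV g \<Longrightarrow> Ck_on k UNIV (\<lambda>x. f x + g x)"
proof (induction k arbitrary: f g)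
  case 0
  then show ?case by (auto intro: continuous_intros)
next
  case (Suc k)
  show ?case
    by (rule Ck_on_UNIV_SucI[where f'="\<lambda>x h. frechet_derivative f (at x) h + frechet_derivative g (at x) h"])
      (use Suc in \<open>auto intro!: has_derivative_add simp: frechet_derivative_works[symmetric]\<close>)
qed

lemma Ck_on_mult:
  fixes f g :: "'a::euclidean_space \<Rightarrow> real"
  shows "Ck_on k UNIV f \<Longrightarrow> Ck_on k UNIV g \<Longrightarrow> Ck_on k UNIV (\<lambda>x. f x * g x)"
proof (induction k arbitrary: f g)
  case 0
  then show ?case by (auto intro: continuous_intros)
next
  case (Suc k)
  have fg: "Ck_on k UNIV f" "Ck_on k UNIV g"
    using Suc.prems Ck_on_Suc_D by blast+
  show ?case
  proof (rule Ck_on_UNIV_SucI)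
    show "((\<lambda>x. f x * g x) has_derivative
        (\<lambda>h. f x * frechet_derivative g (at x) h + frechet_derivative f (at x) h * g x)) (at x)" for x
      using Suc.prems by (auto intro!: has_derivative_mult simp: frechet_derivative_works[symmetric])
    show "Ck_on k UNIV (\<lambda>x. f x * frechet_derivative g (at x) h + frechet_derivative f (at x) h * g x)" for h
      using Suc fg by (intro Ck_on_add) auto
  qed
qed

section \<open>A smooth bump function and mollifiers\<close>

definition exp_bump :: "nat \<Rightarrow> real \<Rightarrow> real" where
  "exp_bump n s = (if s \<le> 0 then 0 else exp (- (1 / s)) / s ^ n)"

lemma exp_bump_tendsto_0: "(exp_bump n \<longlongrightarrow> 0) (at 0)"
proof -
  have "((\<lambda>s::real. inverse s ^ n / exp (inverse s)) \<longlongrightarrow> 0) (at_right 0)"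
    using tendsto_power_div_exp_0 filterlim_inverse_at_top_right by (rule filterlim_compose)
  then have "(exp_bump n \<longlongrightarrow> 0) (at_right 0)"
    by (rule Lim_transform_eventually)
      (auto simp: eventually_at_filter exp_bump_def exp_minus field_simps power_inverse)
  moreover have "(exp_bump n \<longlongrightarrow> 0) (at_left 0)"
    by (rule Lim_transform_eventually[OF tendsto_const])
      (auto simp: eventually_at_filter exp_bump_def)
  ultimately show ?thesis by (simp add: filterlim_at_split)
qed

text \<open>The functions exp(-1/s) / s^n, extended by zero, form a family whose span is closed
  under differentiation. Starting from n = 0, the classical flat function, this yields derivatives
  of all orders by induction.\<close>

lemma exp_bump_derivative:
  "(exp_bump n has_real_derivative (exp_bump (n + 2) s - real n * exp_bump (n + 1) s)) (at s)"
proof -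
  consider "s < 0" | "s = 0" | "s > 0" by linarith
  then show ?thesis
  proof cases
    case 1
    have "((\<lambda>s. 0) has_real_derivative 0) (at s)" by auto
    then have "(exp_bump n has_real_derivative 0) (at s)"
      by (rule has_field_derivative_transform_within_open[where S="{..<0}"])
        (use 1 in \<open>auto simp: exp_bump_def\<close>)
    then show ?thesis using 1 by (simp add: exp_bump_def)
  next
    case 2
    \<comment> \<open>For nonzero h the difference quotient at 0 equals
      \<open>exp_bump (n + 1) h\<close>, which tends to 0.\<close>
    have "((\<lambda>h. (exp_bump n (0 + h) - exp_bump n 0) / h) \<longlongrightarrow> 0) (at 0)"
      by (rule Lim_transform_eventually[OF exp_bump_tendsto_0[of "n+1"]])
        (auto simp: eventually_at_filter exp_bump_def field_simps)
    then show ?thesis using 2 by (simp add: DERIV_def exp_bump_def)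
  next
    case 3
    have "((\<lambda>s. exp (- (1 / s)) / s ^ n) has_real_derivative
        (exp (- (1 / s)) / s ^ (n + 2) - real n * (exp (- (1 / s)) / s ^ (n + 1)))) (at s)"
    proof (cases n)
      case 0
      then show ?thesis using 3
        by (auto intro!: derivative_eq_intros simp: field_simps power2_eq_square)
    next
      case (Suc k)
      have "((\<lambda>s. exp (- (1 / s))) has_real_derivative exp (- (1 / s)) / s\<^sup>2) (at s)"
        using 3 by (auto intro!: derivative_eq_intros simp: field_simps power2_eq_square)
      from DERIV_divide[OF this DERIV_pow[of "Suc k"]] 3 show ?thesis unfolding Suc
        by (rule_tac DERIV_cong) (auto simp: field_simps power_add power2_eq_square simp del: of_nat_Suc)
    qed
    then have "(exp_bump n has_real_derivative
        (exp (- (1 / s)) / s ^ (n + 2) - real n * (exp (- (1 / s)) / s ^ (n + 1)))) (at s)"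
      by (rule has_field_derivative_transform_within_open[where S="{0<..}"])
        (use 3 in \<open>auto simp: exp_bump_def\<close>)
    then show ?thesis using 3 by (simp add: exp_bump_def)
  qed
qed

text \<open>The induction runs over all n at once, since one application of the chain rule brings in
  the indices n + 1 and n + 2.\<close>

lemma Ck_on_exp_bump_compose:
  fixes u :: "'a::euclidean_space \<Rightarrow> real"
  assumes "\<And>k. Ck_on k UNIV u"
  shows "Ck_on k UNIV (\<lambda>x. exp_bump n (u x))"
proof (induction k arbitrary: n)
  case 0
  have "continuous_on UNIV (exp_bump n)"
    using exp_bump_derivative by (meson DERIV_isCont continuous_at_imp_continuous_on)
  moreover have "continuous_on UNIV u" using assms[of 0] by simp
  ultimately show ?case
    using continuous_on_compose2[of UNIV "exp_bump n" UNIV u] by simp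
next
  case (Suc k)
  have du: "(u has_derivative frechet_derivative u (at x)) (at x)" for x
    using assms[of 1] by (auto simp: frechet_derivative_works[symmetric])
  show ?case
  proof (rule Ck_on_UNIV_SucI)
    show "((\<lambda>x. exp_bump n (u x)) has_derivative
       (\<lambda>h. (exp_bump (n + 2) (u x) + (- real n) * exp_bump (n + 1) (u x)) * frechet_derivative u (at x) h)) (at x)" for x
      using has_derivative_compose[OF du exp_bump_derivative[unfolded has_field_derivative_def]]
      by simp
    have "Ck_on k UNIV (\<lambda>x. frechet_derivative u (at x) h)" for h
      using assms[of "Suc k"] by simp
    then show "Ck_on k UNIV (\<lambda>x. (exp_bump (n + 2) (u x) + (- real n) * exp_bump (n + 1) (u x)) *
        frechet_derivative u (at x) h)" for h
      by (intro Ck_on_mult Ck_on_add Ck_on_const Suc)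
  qed
qed

lemma ex_mollifier:
  assumes "\<delta> > 0"
  obtains \<eta> :: "'a::euclidean_space \<Rightarrow> real" where
    "\<And>k. Ck_on k UNIV \<eta>" "\<And>x. \<eta> x \<ge> 0" "\<And>x. norm x \<ge> \<delta> \<Longrightarrow> \<eta> x = 0"
    "integrable lborel \<eta>" "(LINT x|lborel. \<eta> x) = 1"
proof -
  \<comment> \<open>The squared norm is used because it is smooth at the origin too;
    \<open>u\<close> is positive exactly on the open ball of radius \<delta>.\<close>
  define u :: "'a \<Rightarrow> real" where "u x = \<delta>\<^sup>2 - x \<bullet> x" for x
  define f where "f x = exp_bump 0 (u x)" for x
  have u: "Ck_on k UNIV u" for k
  proof (cases k)
    case 0
    then show ?thesis by (auto simp: u_def intro!: continuous_intros)
  next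
    case (Suc n)
    have "Ck_on (Suc n) UNIV u"
    proof (rule Ck_on_UNIV_SucI)
      show "(u has_derivative (\<lambda>h. (-2) * (x \<bullet> h))) (at x)" for x
        unfolding u_def by (auto intro!: derivative_eq_intros simp: inner_commute)
      show "Ck_on n UNIV (\<lambda>x. (-2) * (x \<bullet> h))" for h
        by (intro Ck_on_mult Ck_on_const Ck_on_bounded_linear bounded_linear_inner_left)
    qed
    then show ?thesis using Suc by simp
  qed
  have f: "Ck_on k UNIV f" for k
    unfolding f_def using Ck_on_exp_bump_compose[OF u] by simp
  have f0: "f x = 0" if "norm x \<ge> \<delta>" for x
    using power_mono[OF that, of 2] assms by (simp add: f_def u_def exp_bump_def power2_norm_eq_inner)
  have fpos: "f x > 0" if "norm x < \<delta>" for x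
    using power_strict_mono[OF that, of 2] by (simp add: f_def u_def exp_bump_def power2_norm_eq_inner)
  have cf: "continuous_on UNIV f" using f[of 0] by simp
  have int: "integrable lborel f"
  proof -
    have "set_integrable lborel (cball 0 \<delta>) f"
      unfolding set_integrable_def
      by (rule borel_integrable_compact) (auto intro: continuous_on_subset[OF cf])
    moreover have "(\<lambda>x. indicator (cball 0 \<delta>) x *\<^sub>R f x) = f"
      using f0 by (fastforce simp: indicator_def)
    ultimately show ?thesis unfolding set_integrable_def by simp
  qed
  have nn: "f x \<ge> 0" for x using f0 fpos by (cases "norm x < \<delta>") (auto simp: less_imp_le)
  \<comment> \<open>Were the integral zero, the open ball on which \<open>f\<close> is positive
    would be a null set.\<close>
  have "(LINT x|lborel. f x) \<noteq> 0"
  proof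
    assume "(LINT x|lborel. f x) = 0"
    then have "AE x in lborel. f x = 0"
      using integral_nonneg_eq_0_iff_AE[OF int] nn by simp
    then have "AE x in lborel. x \<notin> ball (0::'a) \<delta>"
      by eventually_elim (use fpos in force)
    then have "ball (0::'a) \<delta> \<in> null_sets lborel"
      by (simp add: AE_iff_null_sets)
    then have "negligible (ball (0::'a) \<delta>)"
      by (simp add: negligible_iff_null_sets null_sets_completionI)
    then show False
      using open_not_negligible[of "ball (0::'a) \<delta>"] assms by simp
  qed
  with nn have c: "(LINT x|lborel. f x) > 0"
    by (metis (mono_tags) Bochner_Integration.integral_nonneg less_eq_real_def)
  define c where "c = (LINT x|lborel. f x)"
  show ?thesis
  proof
    show "Ck_on k UNIV (\<lambda>x. (1/c) * f x)" for k by (intro Ck_on_mult Ck_on_const f)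
    show "(LINT x|lborel. (1/c) * f x) = 1" using c by (simp add: c_def)
  qed (use c nn f0 int in \<open>auto simp: c_def\<close>)
qed

section \<open>The full derivative of a C^1 function, and smoothing by convolution\<close>

lemma Ck_on_1D:
  assumes "Ck_on 1 S f"
  shows "\<And>x. x \<in> S \<Longrightarrow> (f has_derivative frechet_derivative f (at x)) (at x)"
    and "\<And>h. continuous_on S (\<lambda>x. frechet_derivative f (at x) h)"
    and "continuous_on S f"
  using assms Ck_on_Suc_D[of 0 S f] by (auto simp: frechet_derivative_works[symmetric])

text \<open>In finite dimensions, continuity in each fixed direction gives continuity in operator
  norm. Compactness bounds, mean value estimates and the Leibniz rule work with the operator-valued
  form.\<close>

lemma Ck_on_1_derivative_blinfun:
  assumes "Ck_on 1 S f"
  obtains f' where "\<And>x. x \<in> S \<Longrightarrow> (f has_derivative blinfun_apply (f' x)) (at x)"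
    "\<And>x. x \<in> S \<Longrightarrow> blinfun_apply (f' x) = frechet_derivative f (at x)"
    "continuous_on S f'"
proof -
  define f' where "f' x = Blinfun (frechet_derivative f (at x))" for x
  have eq: "blinfun_apply (f' x) = frechet_derivative f (at x)" if "x \<in> S" for x
    unfolding f'_def using Ck_on_1D(1)[OF assms that]
    by (simp add: bounded_linear_Blinfun_apply has_derivative_bounded_linear)
  have "continuous_on S f'"
    by (rule continuous_on_blinfun_componentwise)
      (use Ck_on_1D(2)[OF assms] eq in \<open>metis (mono_tags, lifting) continuous_on_cong\<close>)
  then show ?thesis using that eq Ck_on_1D(1)[OF assms] by metis
qed

text \<open>All derivatives fall on the smooth factor \<eta>, so continuity of \<theta> suffices.
  The box makes the domain of integration compact, as differentiation under the integral sign
  requires.\<close>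

lemma Ck_on_convolution:
  fixes \<eta> \<theta> :: "'a::euclidean_space \<Rightarrow> real"
  assumes "\<And>k. Ck_on k UNIV \<eta>" "continuous_on (cbox a b) \<theta>"
  shows "Ck_on k UNIV (\<lambda>x. integral (cbox a b) (\<lambda>z. \<theta> z * \<eta> (x - z)))"
  using assms(1)
proof (induction k arbitrary: \<eta>)
  case 0
  have "continuous_on UNIV \<eta>" using 0[of 0] by simp
  then have "continuous_on (UNIV \<times> cbox a b) (\<lambda>(x,z). \<theta> z * \<eta> (x - z))"
    using assms(2) unfolding split_beta
    by (auto intro!: continuous_intros intro: continuous_on_compose2[of UNIV \<eta>] continuous_on_compose2[OF assms(2)])
  then have "continuous_on UNIV (\<lambda>x. integral (cbox a b) (\<lambda>z. \<theta> z * \<eta> (x - z)))"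
    by (rule integral_continuous_on_param)
  then show ?case by simp
next
  case (Suc k)
  have S1: "Ck_on 1 UNIV \<eta>" using Suc.prems by blast
  obtain \<eta>' where \<eta>': "\<And>x. (\<eta> has_derivative blinfun_apply (\<eta>' x)) (at x)"
     "\<And>x. blinfun_apply (\<eta>' x) = frechet_derivative \<eta> (at x)" "continuous_on UNIV \<eta>'"
    using Ck_on_1_derivative_blinfun[OF S1] by (metis UNIV_I)
  have c: "continuous_on UNIV \<eta>" using Ck_on_1D(3)[OF S1] .
  have c2: "continuous_on (UNIV \<times> cbox a b) (\<lambda>(x,z). \<theta> z *\<^sub>R \<eta>' (x - z))"
    unfolding split_beta
    by (auto intro!: continuous_intros intro: continuous_on_compose2[OF \<eta>'(3)] continuous_on_compose2[OF assms(2)])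
  have "continuous_on (cbox a b) (\<lambda>z. \<theta> z *\<^sub>R \<eta>' (x - z))" for x
    by (auto intro!: continuous_intros assms(2) intro: continuous_on_compose2[OF \<eta>'(3)])
  then have ig: "(\<lambda>z. \<theta> z *\<^sub>R \<eta>' (x - z)) integrable_on cbox a b" for x
    by (rule integrable_continuous)
  have ig1: "(\<lambda>z. \<theta> z * \<eta> (x - z)) integrable_on cbox a b" for x
    by (intro integrable_continuous)
      (auto intro!: continuous_intros assms(2) intro: continuous_on_compose2[OF c])
  show ?case
  proof (rule Ck_on_UNIV_SucI)
    have "((\<lambda>x. integral (cbox a b) (\<lambda>z. \<theta> z * \<eta> (x - z))) has_derivative
         blinfun_apply (integral (cbox a b) (\<lambda>z. \<theta> z *\<^sub>R \<eta>' (x - z)))) (at x)" for x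
    proof (rule leibniz_rule[where U=UNIV and f="\<lambda>x z. \<theta> z * \<eta> (x - z)" and fx="\<lambda>x z. \<theta> z *\<^sub>R \<eta>' (x - z)"])
      fix x t :: 'a
      have "((\<lambda>x. x - t) has_derivative (\<lambda>h. h)) (at x)"
        using has_derivative_diff[OF has_derivative_ident has_derivative_const[of t], of "at x"] by simp
      from has_derivative_compose[OF this \<eta>'(1)]
      have "((\<lambda>x. \<eta> (x - t)) has_derivative (\<lambda>h. \<eta>' (x - t) h)) (at x)" .
      then show "((\<lambda>x. \<theta> t * \<eta> (x - t)) has_derivative blinfun_apply (\<theta> t *\<^sub>R \<eta>' (x - t))) (at x)"
        by (auto simp: blinfun.bilinear_simps intro!: derivative_eq_intros)
    qed (use ig1 c2 in auto)
    moreover have "blinfun_apply (integral (cbox a b) (\<lambda>z. \<theta> z *\<^sub>R \<eta>' (x - z))) h =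
        integral (cbox a b) (\<lambda>z. \<theta> z * frechet_derivative \<eta> (at (x - z)) h)" for x h
      by (subst blinfun_apply_integral[OF ig]) (simp add: blinfun.bilinear_simps \<eta>'(2))
    ultimately show "((\<lambda>x. integral (cbox a b) (\<lambda>z. \<theta> z * \<eta> (x - z))) has_derivative
       (\<lambda>h. integral (cbox a b) (\<lambda>z. \<theta> z * frechet_derivative \<eta> (at (x - z)) h))) (at x)" for x
      by (metis (no_types, lifting) ext)
    show "Ck_on k UNIV (\<lambda>x. integral (cbox a b) (\<lambda>z. \<theta> z * frechet_derivative \<eta> (at (x - z)) h))" for h
    proof (rule Suc.IH)
      show "Ck_on j UNIV (\<lambda>x. frechet_derivative \<eta> (at x) h)" for j
        using Suc.prems[of "Suc j"] by simp
    qed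
  qed
qed

lemma lborel_integral_reflect:
  fixes f :: "'a::euclidean_space \<Rightarrow> real"
  assumes [measurable]: "f \<in> borel_measurable borel"
  shows "(LINT y|lborel. f (x - y)) = (LINT y|lborel. f y)"
proof -
  have "lborel = distr lborel borel (\<lambda>y::'a. x + (-1) *\<^sub>R y)"
    by (subst lborel_affine[of "-1" x]) (auto simp: density_1)
  then have "(LINT y|lborel. f y) = (LINT y|distr lborel borel (\<lambda>y::'a. x - y). f y)"
    by simp
  also have "\<dots> = (LINT y|lborel. f (x - y))"
    by (rule integral_distr) auto
  finally show ?thesis by simp
qed

lemma lborel_integral_translate:
  fixes f :: "'a::euclidean_space \<Rightarrow> real"
  assumes [measurable]: "f \<in> borel_measurable borel"
  shows "(LINT y|lborel. f (x + y)) = (LINT y|lborel. f y)"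
proof -
  have "(LINT y|lborel. f y) = (LINT y|distr lborel borel ((+) x). f y)"
    by (simp add: lborel_distr_plus)
  also have "\<dots> = (LINT y|lborel. f (x + y))"
    by (rule integral_distr) auto
  finally show ?thesis by simp
qed

text \<open>With the shift on \<theta>, as here, the convolution is an average of translates of
  \<theta>, which suits difference quotients. The reflection z -> x - z moves the shift to \<eta>,
  where it can be differentiated.\<close>

lemma Ck_on_mollified:
  fixes \<eta> \<theta> :: "'a::euclidean_space \<Rightarrow> real"
  assumes "\<And>k. Ck_on k UNIV \<eta>" "continuous_on UNIV \<theta>" "bounded {x. \<theta> x \<noteq> 0}"
  shows "Ck_on k UNIV (\<lambda>x. LINT z|lborel. \<eta> z * \<theta> (x - z))"
proof -
  obtain a b where ab: "{x. \<theta> x \<noteq> 0} \<subseteq> cbox a b"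
    using assms(3) bounded_subset_cbox_symmetric by metis
  have ce: "continuous_on UNIV \<eta>" using assms(1)[of 0] by simp
  have "(LINT z|lborel. \<eta> z * \<theta> (x - z)) = integral (cbox a b) (\<lambda>z. \<theta> z * \<eta> (x - z))" for x
  proof -
    have ct: "continuous_on UNIV (\<lambda>z. \<theta> z * \<eta> (x - z))"
      by (auto intro!: continuous_intros assms(2) intro: continuous_on_compose2[OF ce])
    have si: "set_integrable lborel (cbox a b) (\<lambda>z. \<theta> z * \<eta> (x - z))"
      unfolding set_integrable_def
      by (rule borel_integrable_compact) (auto intro: continuous_on_subset[OF ct])
    have "(LINT z|lborel. \<eta> z * \<theta> (x - z)) = (LINT z|lborel. \<theta> z * \<eta> (x - z))"
    proof -
      have "(\<lambda>z. \<theta> z * \<eta> (x - z)) \<in> borel_measurable borel"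
        by (rule borel_measurable_continuous_onI[OF ct])
      from lborel_integral_reflect[OF this, of x] show ?thesis by (simp add: mult.commute)
    qed
    also have "\<dots> = (LINT z:cbox a b|lborel. \<theta> z * \<eta> (x - z))"
      unfolding set_lebesgue_integral_def
      by (rule Bochner_Integration.integral_cong) (use ab in \<open>auto simp: indicator_def\<close>)
    also have "\<dots> = integral (cbox a b) (\<lambda>z. \<theta> z * \<eta> (x - z))"
      using set_borel_integral_eq_integral(2)[OF si] .
    finally show ?thesis .
  qed
  then show ?thesis
    using Ck_on_convolution[OF assms(1) continuous_on_subset[OF assms(2)], of a b k] by simp
qed

section \<open>Mollification along a vector field\<close>

lemma directional_derivative_tendsto:
  fixes f :: "'a::real_normed_vector \<Rightarrow> real"
  assumes "(f has_derivative f') (at x)"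
  shows "((\<lambda>h. (f (x + h *\<^sub>R v) - f x) / h) \<longlongrightarrow> f' v) (at 0)"
proof -
  have "((\<lambda>h. x + h *\<^sub>R v) has_derivative (\<lambda>h. h *\<^sub>R v)) (at 0)"
    by (auto intro!: derivative_eq_intros)
  moreover have "(f has_derivative f') (at (x + 0 *\<^sub>R v))" using assms by simp
  ultimately have "((\<lambda>h. f (x + h *\<^sub>R v)) has_derivative (\<lambda>h. f' (h *\<^sub>R v))) (at 0)"
    by (rule has_derivative_compose)
  moreover have "(\<lambda>h. f' (h *\<^sub>R v)) = (*) (f' v)"
    using assms[THEN has_derivative_bounded_linear]
    by (auto simp: linear_simps bounded_linear.linear linear_cmul)
  ultimately have "((\<lambda>h. f (x + h *\<^sub>R v)) has_real_derivative f' v) (at 0)"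
    by (simp add: has_field_derivative_def)
  then show ?thesis by (simp add: DERIV_def)
qed

text \<open>A probability density supported in the \<delta>-ball sees only the values of
  \<open>f\<close> there. Both the distance of the mollified function from \<theta> and the error of
  its difference quotients are averages of this kind.\<close>

lemma mollifier_average_bound:
  fixes \<eta> f :: "'a::euclidean_space \<Rightarrow> real"
  assumes \<eta>: "continuous_on UNIV \<eta>" "\<And>x. \<eta> x \<ge> 0" "\<And>x. norm x \<ge> \<delta> \<Longrightarrow> \<eta> x = 0"
      "integrable lborel \<eta>" "(LINT x|lborel. \<eta> x) = 1"
    and f: "continuous_on UNIV f"
  shows "integrable lborel (\<lambda>z. \<eta> z * f z)"
    and "(\<And>z. norm z < \<delta> \<Longrightarrow> \<bar>f z\<bar> \<le> B) \<Longrightarrow> \<bar>LINT z|lborel. \<eta> z * f z\<bar> \<le> B"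
proof -
  have "integrable lborel (\<lambda>z. indicator (cball 0 \<delta>) z *\<^sub>R (\<eta> z * f z))"
    by (rule borel_integrable_compact) (auto intro!: continuous_intros continuous_on_subset[OF f] continuous_on_subset[OF \<eta>(1)])
  moreover have "(\<lambda>z. indicator (cball 0 \<delta>) z *\<^sub>R (\<eta> z * f z)) = (\<lambda>z. \<eta> z * f z)"
    using \<eta>(3) by (fastforce simp: indicator_def)
  ultimately show int: "integrable lborel (\<lambda>z. \<eta> z * f z)" by simp
  assume B: "\<And>z. norm z < \<delta> \<Longrightarrow> \<bar>f z\<bar> \<le> B"
  have le: "\<bar>\<eta> z * f z\<bar> \<le> \<eta> z * B" for z
    using B[of z] \<eta>(2)[of z] \<eta>(3)[of z]
    by (cases "norm z < \<delta>") (auto simp: abs_mult intro: mult_left_mono)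
  have "\<bar>LINT z|lborel. \<eta> z * f z\<bar> \<le> (LINT z|lborel. \<bar>\<eta> z * f z\<bar>)" by simp
  also have "\<dots> \<le> (LINT z|lborel. \<eta> z * B)"
    using int \<eta>(4) le by (intro integral_mono) auto
  also have "\<dots> = B" using \<eta>(5) by simp
  finally show "\<bar>LINT z|lborel. \<eta> z * f z\<bar> \<le> B" .
qed

lemma compact_uniform_continuity:
  fixes f :: "'a::metric_space \<Rightarrow> 'b::metric_space"
  assumes "compact N" "continuous_on N f" "e > 0"
  obtains d where "d > 0" "\<And>x y. x \<in> N \<Longrightarrow> y \<in> N \<Longrightarrow> dist x y \<le> d \<Longrightarrow> dist (f x) (f y) \<le> e"
proof -
  have "uniformly_continuous_on N f" using assms compact_uniformly_continuous by blast
  then obtain d where "d > 0" "\<And>x y. x \<in> N \<Longrightarrow> y \<in> N \<Longrightarrow> dist y x < d \<Longrightarrow> dist (f y) (f x) < e"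
    using assms(3) unfolding uniformly_continuous_on_def by metis
  then show ?thesis
    by (intro that[of "d/2"]) (auto simp: dist_commute intro!: less_imp_le)
qed

text \<open>
  \<open>\<theta>\<close> need not be differentiable along \<open>V\<close>: it only has difference quotients within \<open>\<beta>\<close> of \<open>\<alpha>\<close>.
  As \<open>\<theta>\<close> is Lipschitz, freezing the continuous field \<open>V\<close> on the support of the mollifier costs little.
\<close>

lemma smooth_approximation_along_field:
  fixes \<theta> \<alpha> \<beta> :: "'a::euclidean_space \<Rightarrow> real" and V :: "'a \<Rightarrow> 'a"
  assumes lip: "C-lipschitz_on UNIV \<theta>"
    and K: "compact K" "\<And>x. x \<notin> K \<Longrightarrow> \<theta> x = 0"
    and N: "compact N" "\<epsilon> > 0" "\<And>x y. y \<in> K \<Longrightarrow> dist x y \<le> \<epsilon> \<Longrightarrow> x \<in> N"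
    and cont: "continuous_on N V" "continuous_on N \<alpha>" "continuous_on N \<beta>"
    and est: "\<And>e. e > 0 \<Longrightarrow> \<exists>h0>0. \<forall>y\<in>N. \<forall>h. 0 < \<bar>h\<bar> \<and> \<bar>h\<bar> < h0 \<longrightarrow>
       \<bar>\<theta> (y + h *\<^sub>R V y) - \<theta> y - h * \<alpha> y\<bar> \<le> \<bar>h\<bar> * (\<beta> y + e)"
    and e: "e > 0"
  obtains \<phi> where "\<And>k. Ck_on k UNIV \<phi>" "\<And>x. \<bar>\<phi> x - \<theta> x\<bar> \<le> e"
    "\<And>x. \<phi> x \<noteq> 0 \<Longrightarrow> \<exists>y\<in>K. dist x y \<le> e"
    "\<And>x y. y \<in> K \<Longrightarrow> dist x y \<le> \<epsilon> / 2 \<Longrightarrow> \<bar>frechet_derivative \<phi> (at x) (V x) - \<alpha> x\<bar> \<le> \<beta> x + e"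
proof -
  have C: "C \<ge> 0" using lip by (rule lipschitz_on_nonneg)
  have lipD: "\<bar>\<theta> x - \<theta> y\<bar> \<le> C * dist x y" for x y
    using lipschitz_onD[OF lip, of x y] by (simp add: dist_real_def)
  have c\<theta>: "continuous_on UNIV \<theta>" using lip by (rule lipschitz_on_continuous_on)
  \<comment> \<open>The error \<open>e\<close> is split into quarters: one for freezing
    \<open>V\<close>, one for the difference quotients of \<theta>, and one each for the oscillation
    of \<alpha> and of \<beta>. The \<open>+ 1\<close> keeps the denominator positive when
    \<open>C\<close> is 0.\<close>
  have e4: "e / 4 > 0" and e4C: "e / (4 * (C + 1)) > 0" using e C by auto
  obtain d1 where d1: "d1 > 0" "\<And>x y. x \<in> N \<Longrightarrow> y \<in> N \<Longrightarrow> dist x y \<le> d1 \<Longrightarrow> dist (V x) (V y) \<le> e / (4 * (C + 1))"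
    by (rule compact_uniform_continuity[OF N(1) cont(1) e4C]) (rule that)
  obtain d2 where d2: "d2 > 0" "\<And>x y. x \<in> N \<Longrightarrow> y \<in> N \<Longrightarrow> dist x y \<le> d2 \<Longrightarrow> dist (\<alpha> x) (\<alpha> y) \<le> e / 4"
    by (rule compact_uniform_continuity[OF N(1) cont(2) e4]) (rule that)
  obtain d3 where d3: "d3 > 0" "\<And>x y. x \<in> N \<Longrightarrow> y \<in> N \<Longrightarrow> dist x y \<le> d3 \<Longrightarrow> dist (\<beta> x) (\<beta> y) \<le> e / 4"
    by (rule compact_uniform_continuity[OF N(1) cont(3) e4]) (rule that)
  \<comment> \<open>The first three bounds make \<open>V\<close>, \<alpha> and \<beta> nearly
    constant on \<delta>-balls; \<open>e\<close> controls the support, \<open>e / (C + 1)\<close>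
    the distance to \<theta>, and \<open>\<epsilon> / 2\<close> keeps the balls inside
    \<open>N\<close>.\<close>
  define D where "D = {d1, d2, d3, e, e / (C + 1), \<epsilon> / 2}"
  define \<delta> where "\<delta> = Min D"
  have D: "finite D" "D \<noteq> {}" "\<forall>x\<in>D. x > 0"
    using d1(1) d2(1) d3(1) e divide_pos_pos[OF e, of "C + 1"] C N(2) by (auto simp: D_def)
  have "\<delta> > 0" using D unfolding \<delta>_def by (metis Min_in)
  moreover have "\<delta> \<le> x" if "x \<in> D" for x using that D unfolding \<delta>_def by (metis Min_le)
  ultimately have \<delta>: "\<delta> > 0" "\<delta> \<le> d1" "\<delta> \<le> d2" "\<delta> \<le> d3" "\<delta> \<le> e" "\<delta> \<le> e / (C + 1)" "\<delta> \<le> \<epsilon> / 2"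
    unfolding D_def by blast+
  have "C * \<delta> \<le> C * (e / (C + 1))" using \<delta> C by (intro mult_left_mono) auto
  also have "\<dots> \<le> e" using C e by (simp add: field_simps)
  finally have C\<delta>: "C * \<delta> \<le> e" .
  obtain \<eta> :: "'a \<Rightarrow> real" where \<eta>: "\<And>k. Ck_on k UNIV \<eta>" "\<And>x. \<eta> x \<ge> 0"
    "\<And>x. norm x \<ge> \<delta> \<Longrightarrow> \<eta> x = 0" "integrable lborel \<eta>" "(LINT x|lborel. \<eta> x) = 1"
    using ex_mollifier[OF \<delta>(1)] by metis
  have c\<eta>: "continuous_on UNIV \<eta>" using \<eta>(1)[of 0] by simp
  have avg: "integrable lborel (\<lambda>z. \<eta> z * f z)"
    "(\<And>z. norm z < \<delta> \<Longrightarrow> \<bar>f z\<bar> \<le> B) \<Longrightarrow> \<bar>LINT z|lborel. \<eta> z * f z\<bar> \<le> B"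
    if "continuous_on UNIV f" for f B
    using mollifier_average_bound(1)[of \<eta> \<delta> f] mollifier_average_bound(2)[of \<eta> \<delta> f B] c\<eta> \<eta> that by blast+
  define \<phi> where "\<phi> x = (LINT z|lborel. \<eta> z * \<theta> (x - z))" for x
  have cs: "continuous_on UNIV (\<lambda>z. \<theta> (x - z))" for x
    by (auto intro!: continuous_intros intro: continuous_on_compose2[OF c\<theta>])
  have int: "integrable lborel (\<lambda>z. \<eta> z * \<theta> (x - z))" for x
    by (rule avg(1)[OF cs])
  have bdd: "bounded {x. \<theta> x \<noteq> 0}"
    by (rule bounded_subset[OF compact_imp_bounded[OF K(1)]]) (use K(2) in blast)
  have smooth: "Ck_on k UNIV \<phi>" for k
    unfolding \<phi>_def by (rule Ck_on_mollified[OF \<eta>(1) c\<theta> bdd])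
  show ?thesis
  proof
    show "Ck_on k UNIV \<phi>" for k by (rule smooth)
    show "\<bar>\<phi> x - \<theta> x\<bar> \<le> e" for x
    proof -
      have "\<phi> x - \<theta> x = (LINT z|lborel. \<eta> z * \<theta> (x - z)) - (LINT z|lborel. \<eta> z * \<theta> x)"
        using \<eta>(5) by (simp add: \<phi>_def)
      also have "\<dots> = (LINT z|lborel. \<eta> z * (\<theta> (x - z) - \<theta> x))"
        using int \<eta>(4) by (subst Bochner_Integration.integral_diff[symmetric]) (auto simp: algebra_simps)
      also have "\<bar>\<dots>\<bar> \<le> C * \<delta>"
      proof (rule avg(2))
        show "continuous_on UNIV (\<lambda>z. \<theta> (x - z) - \<theta> x)" by (intro continuous_intros cs)
        show "\<bar>\<theta> (x - z) - \<theta> x\<bar> \<le> C * \<delta>" if "norm z < \<delta>" for z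
          using lipD[of "x - z" x] that C
          by (smt (verit) dist_norm diff_diff_eq2 add_diff_cancel_left' norm_minus_commute mult_left_mono diff_add_cancel)
      qed
      finally show ?thesis using C\<delta> by simp
    qed
    show "\<exists>y\<in>K. dist x y \<le> e" if "\<phi> x \<noteq> 0" for x
    proof (rule ccontr)
      assume *: "\<not> (\<exists>y\<in>K. dist x y \<le> e)"
      have "\<eta> z * \<theta> (x - z) = 0" for z
      proof (cases "norm z \<ge> \<delta>")
        case False
        then have "dist x (x - z) \<le> e" using \<delta>(5) by (simp add: dist_norm)
        with * have "x - z \<notin> K" by blast
        then show ?thesis using K(2) by simp
      qed (use \<eta>(3) in simp)
      then have "(\<lambda>z. \<eta> z * \<theta> (x - z)) = (\<lambda>z. 0)" by blast
      then show False using that by (simp add: \<phi>_def)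
    qed
    fix x y0 assume y0: "y0 \<in> K" "dist x y0 \<le> \<epsilon> / 2"
    have xN: "x \<in> N" using y0 N(2,3) by force
    have zN: "x - z \<in> N" if "norm z < \<delta>" for z
    proof (rule N(3)[OF y0(1)])
      have "dist (x - z) y0 \<le> dist (x - z) x + dist x y0" by (rule dist_triangle)
      then show "dist (x - z) y0 \<le> \<epsilon>" using y0 that \<delta>(7) by (simp add: dist_norm)
    qed
    obtain h0 where h0: "h0 > 0" "\<And>y h. y \<in> N \<Longrightarrow> 0 < \<bar>h\<bar> \<Longrightarrow> \<bar>h\<bar> < h0 \<Longrightarrow>
       \<bar>\<theta> (y + h *\<^sub>R V y) - \<theta> y - h * \<alpha> y\<bar> \<le> \<bar>h\<bar> * (\<beta> y + e / 4)"
      using est[OF e4] by metis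
    have key: "\<bar>(\<phi> (x + h *\<^sub>R V x) - \<phi> x) / h - \<alpha> x\<bar> \<le> \<beta> x + e" if h: "0 < \<bar>h\<bar>" "\<bar>h\<bar> < h0" for h
    proof -
      let ?f = "\<lambda>z. \<theta> (x + h *\<^sub>R V x - z) - \<theta> (x - z) - h * \<alpha> x"
      have "\<phi> (x + h *\<^sub>R V x) - \<phi> x - h * \<alpha> x =
          (LINT z|lborel. \<eta> z * \<theta> (x + h *\<^sub>R V x - z)) - (LINT z|lborel. \<eta> z * \<theta> (x - z)) -
          (LINT z|lborel. \<eta> z * (h * \<alpha> x))"
        using \<eta>(5) by (simp add: \<phi>_def)
      also have "\<dots> = (LINT z|lborel. \<eta> z * ?f z)"
        using int \<eta>(4)
        by (subst Bochner_Integration.integral_diff[symmetric], simp, simp)+ (auto simp: algebra_simps)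
      also have "\<bar>\<dots>\<bar> \<le> \<bar>h\<bar> * (\<beta> x + e)"
      proof (rule avg(2))
        show "continuous_on UNIV ?f" by (intro continuous_intros cs)
      next
        fix z :: 'a assume z: "norm z < \<delta>"
        let ?y = "x - z"
        have dz: "dist x ?y \<le> \<delta>" "dist ?y x \<le> \<delta>" using z by (auto simp: dist_norm)
        have "\<bar>\<theta> (x + h *\<^sub>R V x - z) - \<theta> (?y + h *\<^sub>R V ?y)\<bar> \<le> C * dist (x + h *\<^sub>R V x - z) (?y + h *\<^sub>R V ?y)"
          by (rule lipD)
        also have "dist (x + h *\<^sub>R V x - z) (?y + h *\<^sub>R V ?y) = \<bar>h\<bar> * dist (V x) (V ?y)"
          unfolding dist_norm norm_scaleR[symmetric] by (simp add: algebra_simps)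
        also have "C * (\<bar>h\<bar> * dist (V x) (V ?y)) \<le> C * (\<bar>h\<bar> * (e / (4 * (C + 1))))"
          using d1(2)[OF xN zN[OF z]] dz \<delta> C by (intro mult_left_mono) auto
        also have "\<dots> \<le> \<bar>h\<bar> * (e / 4)"
          using C e mult_nonneg_nonneg[of "\<bar>h\<bar>" e] by (simp add: field_simps)
        finally have 1: "\<bar>\<theta> (x + h *\<^sub>R V x - z) - \<theta> (?y + h *\<^sub>R V ?y)\<bar> \<le> \<bar>h\<bar> * (e / 4)" .
        have 2: "\<bar>\<theta> (?y + h *\<^sub>R V ?y) - \<theta> ?y - h * \<alpha> ?y\<bar> \<le> \<bar>h\<bar> * (\<beta> ?y + e / 4)"
          by (rule h0(2)[OF zN[OF z] h])
        have "\<bar>h * \<alpha> ?y - h * \<alpha> x\<bar> = \<bar>h\<bar> * dist (\<alpha> ?y) (\<alpha> x)"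
          by (simp add: dist_real_def abs_mult[symmetric] algebra_simps)
        also have "\<dots> \<le> \<bar>h\<bar> * (e / 4)"
          using d2(2)[OF zN[OF z] xN] dz \<delta> by (intro mult_left_mono) auto
        finally have 3: "\<bar>h * \<alpha> ?y - h * \<alpha> x\<bar> \<le> \<bar>h\<bar> * (e / 4)" .
        have "\<beta> ?y \<le> \<beta> x + e / 4"
          using d3(2)[OF zN[OF z] xN order_trans[OF dz(2) \<delta>(4)]] unfolding dist_real_def by linarith
        then have "\<bar>h\<bar> * (\<beta> ?y + e / 4) \<le> \<bar>h\<bar> * (\<beta> x + e / 4 + e / 4)"
          by (intro mult_left_mono) auto
        then have 4: "\<bar>h\<bar> * (\<beta> ?y + e / 4) \<le> \<bar>h\<bar> * \<beta> x + 2 * (\<bar>h\<bar> * (e / 4))"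
          by (simp add: algebra_simps)
        \<comment> \<open>\<open>E\<close> is the share \<open>\<bar>h\<bar> * (e / 4)\<close>:
          freezing the field and moving \<alpha> cost one share each, and \<open>b\<close> contains
          two more.\<close>
        have "\<bar>p - r - t\<bar> \<le> b' + 4 * E"
          if "\<bar>p - q\<bar> \<le> E" "\<bar>q - r - s\<bar> \<le> b" "\<bar>s - t\<bar> \<le> E" "b \<le> b' + 2 * E" for p q r s t b b' E :: real
          using that by linarith
        from this[OF 1 2 3 4] show "\<bar>?f z\<bar> \<le> \<bar>h\<bar> * (\<beta> x + e)"
          by (simp add: algebra_simps)
      qed
      finally have "\<bar>\<phi> (x + h *\<^sub>R V x) - \<phi> x - h * \<alpha> x\<bar> \<le> \<bar>h\<bar> * (\<beta> x + e)" .
      moreover have "(\<phi> (x + h *\<^sub>R V x) - \<phi> x) / h - \<alpha> x = (\<phi> (x + h *\<^sub>R V x) - \<phi> x - h * \<alpha> x) / h"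
        using h by (simp add: field_simps)
      ultimately show ?thesis using h by (simp add: field_simps)
    qed
    \<comment> \<open>As \<phi> is smooth, its difference quotients along \<open>V x\<close> do
      converge, and the bound \<open>key\<close> passes to the limit.\<close>
    have "(\<phi> has_derivative frechet_derivative \<phi> (at x)) (at x)"
      using Ck_on_1D(1)[OF smooth] by simp
    from directional_derivative_tendsto[OF this, of "V x"]
    have "((\<lambda>h. \<bar>(\<phi> (x + h *\<^sub>R V x) - \<phi> x) / h - \<alpha> x\<bar>) \<longlongrightarrow> \<bar>frechet_derivative \<phi> (at x) (V x) - \<alpha> x\<bar>) (at 0)"
      by (intro tendsto_intros)
    moreover have "\<forall>\<^sub>F h in at 0. \<bar>(\<phi> (x + h *\<^sub>R V x) - \<phi> x) / h - \<alpha> x\<bar> \<le> \<beta> x + e"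
      unfolding eventually_at using key h0(1) by (intro exI[of _ h0]) (auto simp: dist_real_def)
    ultimately show "\<bar>frechet_derivative \<phi> (at x) (V x) - \<alpha> x\<bar> \<le> \<beta> x + e"
      by (rule tendsto_upperbound) simp
  qed
qed

section \<open>Compact neighbourhoods and approximation of C^1 functions by test functions\<close>

lemma compact_UN_cball:
  fixes K :: "'a::euclidean_space set"
  assumes "compact K"
  shows "compact (\<Union>x\<in>K. cball x \<epsilon>)"
proof -
  \<comment> \<open>The neighbourhood is the Minkowski sum of \<open>K\<close> and a closed
    ball.\<close>
  have "compact {x + y |x y. x \<in> K \<and> y \<in> cball 0 \<epsilon>}"
    by (rule compact_sums) (use assms in auto)
  moreover have "{x + y |x y. x \<in> K \<and> y \<in> cball 0 \<epsilon>} = (\<Union>x\<in>K. cball x \<epsilon>)"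
  proof (intro set_eqI iffI)
    fix z assume "z \<in> (\<Union>x\<in>K. cball x \<epsilon>)"
    then obtain x where "x \<in> K" "dist x z \<le> \<epsilon>" by auto
    then have "z = x + (z - x)" "z - x \<in> cball 0 \<epsilon>" by (auto simp: dist_norm norm_minus_commute)
    with \<open>x \<in> K\<close> show "z \<in> {x + y |x y. x \<in> K \<and> y \<in> cball 0 \<epsilon>}" by blast
  next
    fix z assume "z \<in> {x + y |x y. x \<in> K \<and> y \<in> cball 0 \<epsilon>}"
    then obtain x y where "z = x + y" "x \<in> K" "y \<in> cball 0 \<epsilon>" by blast
    then show "z \<in> (\<Union>x\<in>K. cball x \<epsilon>)"
      by (intro UN_I[of x]) (auto simp: dist_norm)
  qed
  ultimately show ?thesis by simp
qed

lemma compact_neighbourhood: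
  fixes K S :: "'a::euclidean_space set"
  assumes "compact K" "open S" "K \<subseteq> S"
  obtains N \<epsilon> where "compact N" "N \<subseteq> S" "\<epsilon> > 0" "\<And>x y. y \<in> K \<Longrightarrow> dist x y \<le> \<epsilon> \<Longrightarrow> x \<in> N"
proof -
  obtain \<epsilon> where \<epsilon>: "\<epsilon> > 0" "(\<Union>x\<in>K. cball x \<epsilon>) \<subseteq> S"
    using compact_subset_open_imp_cball_epsilon_subset[OF assms] by metis
  with compact_UN_cball[OF assms(1)] show ?thesis
    by (intro that[of "\<Union>x\<in>K. cball x \<epsilon>" \<epsilon>]) (auto simp: dist_commute)
qed

lemma test_functionI:
  assumes "\<And>k. Ck_on k UNIV \<phi>" "compact N" "N \<subseteq> S" "\<And>x. \<phi> x \<noteq> 0 \<Longrightarrow> x \<in> N"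
  shows "test_function S \<phi>"
proof -
  have "closure {x. \<phi> x \<noteq> 0} \<subseteq> N"
    using assms by (intro closure_minimal) (auto simp: compact_imp_closed)
  then show ?thesis
    unfolding test_function_def
    using assms by (metis compact_closure bounded_subset compact_imp_bounded closure_subset order_trans)
qed

lemma frechet_derivative_eq_0_outside:
  fixes f :: "'a::real_normed_vector \<Rightarrow> 'b::real_normed_vector"
  assumes "closed K" "\<And>x. x \<notin> K \<Longrightarrow> f x = 0" "x \<notin> K"
  shows "frechet_derivative f (at x) h = 0"
proof -
  have "((\<lambda>x. 0) has_derivative (\<lambda>h. 0)) (at x)" by simp
  then have "(f has_derivative (\<lambda>h. 0)) (at x)"
    by (rule has_derivative_transform_within_open[where s="- K"]) (use assms in auto)
  then show ?thesis by (metis frechet_derivative_at)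
qed

text \<open>The derivative is continuous and vanishes off \<open>K\<close>, hence is bounded, and
  the mean value inequality on the whole space turns the bound into a Lipschitz constant.\<close>

lemma C1_compact_support_lipschitz:
  fixes \<theta> :: "'a::euclidean_space \<Rightarrow> real"
  assumes \<theta>: "Ck_on 1 UNIV \<theta>" and K: "compact K" "\<And>x. x \<notin> K \<Longrightarrow> \<theta> x = 0"
  obtains C where "C-lipschitz_on UNIV \<theta>"
proof -
  obtain \<theta>' where \<theta>': "\<And>x. (\<theta> has_derivative blinfun_apply (\<theta>' x)) (at x)"
     "\<And>x. blinfun_apply (\<theta>' x) = frechet_derivative \<theta> (at x)" "continuous_on UNIV \<theta>'"
    using Ck_on_1_derivative_blinfun[OF \<theta>] by (metis UNIV_I)
  have "bounded (\<theta>' ` K)"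
    using K \<theta>'(3) by (intro compact_imp_bounded compact_continuous_image) (auto intro: continuous_on_subset)
  then obtain C where C: "C > 0" "\<And>x. x \<in> K \<Longrightarrow> norm (\<theta>' x) \<le> C"
    unfolding bounded_pos by auto
  have "\<theta>' x = 0" if "x \<notin> K" for x
    using frechet_derivative_eq_0_outside[OF compact_imp_closed[OF K(1)] K(2) that] \<theta>'(2)
    by (intro blinfun_eqI) simp
  then have C': "norm (\<theta>' x) \<le> C" for x using C by (cases "x \<in> K") auto
  have "C-lipschitz_on UNIV \<theta>"
  proof (rule lipschitz_onI)
    fix x y show "dist (\<theta> x) (\<theta> y) \<le> C * dist x y"
      unfolding dist_norm
      by (rule differentiable_bound[OF convex_UNIV, where f'="\<lambda>x. blinfun_apply (\<theta>' x)"])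
        (use \<theta>'(1) C' in \<open>auto simp: norm_blinfun.rep_eq[symmetric]\<close>)
  qed (use C in auto)
  then show ?thesis by (rule that)
qed

text \<open>The case of the constant field \<open>v\<close> and \<beta> = 0 in
  \<open>smooth_approximation_along_field\<close>. The compact set \<open>N\<close> is fixed before
  the accuracy \<open>e\<close>, so that functions that are only locally integrable can be tested
  against the whole approximating family.\<close>

lemma C1_approximation_by_test_functions:
  fixes \<theta> :: "'a::euclidean_space \<Rightarrow> real"
  assumes \<theta>: "Ck_on 1 UNIV \<theta>" and K: "compact K" "\<And>x. x \<notin> K \<Longrightarrow> \<theta> x = 0" and S: "open S" "K \<subseteq> S"
  obtains N where "compact N" "K \<subseteq> N" "N \<subseteq> S"
    "\<And>e. e > 0 \<Longrightarrow> \<exists>\<phi>. test_function S \<phi> \<and> (\<forall>x. \<bar>\<phi> x - \<theta> x\<bar> \<le> e) \<and> (\<forall>x. x \<notin> N \<longrightarrow> \<phi> x = 0) \<and>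
      (\<forall>x. \<bar>frechet_derivative \<phi> (at x) v - frechet_derivative \<theta> (at x) v\<bar> \<le> e)"
proof -
  obtain N \<epsilon> where N: "compact N" "N \<subseteq> S" "\<epsilon> > 0" "\<And>x y. y \<in> K \<Longrightarrow> dist x y \<le> \<epsilon> \<Longrightarrow> x \<in> N"
    using compact_neighbourhood[OF K(1) S] by metis
  have KN: "K \<subseteq> N" using N(3,4) by fastforce
  have d\<theta>: "(\<theta> has_derivative frechet_derivative \<theta> (at x)) (at x)" for x
    using Ck_on_1D(1)[OF \<theta>] by simp
  have D0: "frechet_derivative \<theta> (at x) h = 0" if "x \<notin> K" for x h
    using K that by (intro frechet_derivative_eq_0_outside[of K]) (auto simp: compact_imp_closed)
  obtain C where lip: "C-lipschitz_on UNIV \<theta>" using C1_compact_support_lipschitz[OF \<theta> K] .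
  let ?\<alpha> = "\<lambda>x. frechet_derivative \<theta> (at x) v"
  have c\<alpha>: "continuous_on A ?\<alpha>" for A using Ck_on_1D(2)[OF \<theta>] continuous_on_subset by blast
  have est: "\<exists>h0>0. \<forall>y\<in>N. \<forall>h. 0 < \<bar>h\<bar> \<and> \<bar>h\<bar> < h0 \<longrightarrow>
       \<bar>\<theta> (y + h *\<^sub>R v) - \<theta> y - h * ?\<alpha> y\<bar> \<le> \<bar>h\<bar> * (0 + e)" if "e > 0" for e
  proof -
    \<comment> \<open>Short segments starting in \<open>N\<close> stay in the ball of radius
      \<open>R + 1\<close>, on which the directional derivative is uniformly continuous.\<close>
    obtain R where R: "R > 0" "\<And>x. x \<in> N \<Longrightarrow> norm x \<le> R"
      using compact_imp_bounded[OF N(1)] unfolding bounded_pos by auto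
    obtain d where d: "d > 0" "\<And>x y. x \<in> cball 0 (R + 1) \<Longrightarrow> y \<in> cball 0 (R + 1) \<Longrightarrow> dist x y \<le> d \<Longrightarrow> dist (?\<alpha> x) (?\<alpha> y) \<le> e"
      by (rule compact_uniform_continuity[OF compact_cball c\<alpha> \<open>e > 0\<close>]) (rule that)
    \<comment> \<open>For |h| below this value \<open>norm (h *\<^sub>R v)\<close> is at most 1 and
      at most \<open>d\<close>; the \<open>+ 1\<close> covers the case \<open>v = 0\<close>.\<close>
    define h0 where "h0 = min 1 d / (norm v + 1)"
    have h0: "h0 > 0" using d by (simp add: h0_def add_nonneg_pos)
    have "\<bar>\<theta> (y + h *\<^sub>R v) - \<theta> y - h * ?\<alpha> y\<bar> \<le> \<bar>h\<bar> * e" if y: "y \<in> N" and h: "\<bar>h\<bar> < h0" for y h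
    proof -
      have small: "norm (s *\<^sub>R v) \<le> min 1 d" if "\<bar>s\<bar> \<le> \<bar>h\<bar>" for s
      proof -
        have "norm (s *\<^sub>R v) \<le> h0 * (norm v + 1)" unfolding norm_scaleR
          using that h h0 by (intro mult_mono) auto
        also have "\<dots> = min 1 d" by (simp add: h0_def add_nonneg_pos add_nonneg_eq_0_iff)
        finally show ?thesis .
      qed
      \<comment> \<open>Subtracting the linear part lets the mean value inequality measure how far
        the derivative along the segment is from its value at \<open>y\<close>.\<close>
      let ?g = "\<lambda>s. \<theta> (y + s *\<^sub>R v) - s * ?\<alpha> y"
      have dg: "(?g has_real_derivative (?\<alpha> (y + s *\<^sub>R v) - ?\<alpha> y)) (at s within A)" for s A
      proof -
        have "((\<lambda>s. y + s *\<^sub>R v) has_derivative (\<lambda>h. h *\<^sub>R v)) (at s within A)"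
          by (auto intro!: derivative_eq_intros)
        from has_derivative_compose[OF this d\<theta>]
        have "((\<lambda>s. \<theta> (y + s *\<^sub>R v)) has_derivative (\<lambda>h. frechet_derivative \<theta> (at (y + s *\<^sub>R v)) (h *\<^sub>R v))) (at s within A)" .
        moreover have "(\<lambda>h. frechet_derivative \<theta> (at z) (h *\<^sub>R v)) = (*) (?\<alpha> z)" for z
          using linear_cmul[OF has_derivative_linear[OF d\<theta>]] by (auto simp: mult.commute)
        ultimately have "((\<lambda>s. \<theta> (y + s *\<^sub>R v)) has_real_derivative ?\<alpha> (y + s *\<^sub>R v)) (at s within A)"
          unfolding has_field_derivative_def by simp
        from DERIV_diff[OF this DERIV_cmult_right[OF DERIV_ident, of "?\<alpha> y"]] show ?thesis by simp
      qed
      have "norm (?g h - ?g 0) \<le> e * norm (h - 0)"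
      proof (rule field_differentiable_bound[where S="{s. \<bar>s\<bar> \<le> \<bar>h\<bar>}"])
        have "{s. \<bar>s\<bar> \<le> \<bar>h\<bar>} = cball 0 \<bar>h\<bar>" by (auto simp: dist_real_def)
        then show "convex {s. \<bar>s\<bar> \<le> \<bar>h\<bar>}" by simp
        fix s assume "s \<in> {s. \<bar>s\<bar> \<le> \<bar>h\<bar>}"
        then have s: "norm (s *\<^sub>R v) \<le> min 1 d" using small by simp
        have "y + s *\<^sub>R v \<in> cball 0 (R + 1)" "y \<in> cball 0 (R + 1)"
          using R(2)[OF y] s norm_triangle_ineq[of y "s *\<^sub>R v"] unfolding mem_cball_0 by simp_all
        then have "dist (?\<alpha> (y + s *\<^sub>R v)) (?\<alpha> y) \<le> e"
          by (rule d(2)) (use s in \<open>simp add: dist_norm\<close>)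
        then show "norm (?\<alpha> (y + s *\<^sub>R v) - ?\<alpha> y) \<le> e" by (simp add: dist_norm)
      qed (use dg in auto)
      then show ?thesis by (simp add: mult.commute algebra_simps)
    qed
    then show ?thesis using h0 by auto
  qed
  show ?thesis
  proof (rule that[OF N(1) KN N(2)])
    fix e :: real assume "e > 0"
    then have e': "min e (\<epsilon> / 2) > 0" using N(3) by simp
    obtain \<phi> where \<phi>: "\<And>k. Ck_on k UNIV \<phi>" "\<And>x. \<bar>\<phi> x - \<theta> x\<bar> \<le> min e (\<epsilon> / 2)"
      "\<And>x. \<phi> x \<noteq> 0 \<Longrightarrow> \<exists>y\<in>K. dist x y \<le> min e (\<epsilon> / 2)"
      "\<And>x y. y \<in> K \<Longrightarrow> dist x y \<le> \<epsilon> / 2 \<Longrightarrow> \<bar>frechet_derivative \<phi> (at x) v - ?\<alpha> x\<bar> \<le> 0 + min e (\<epsilon> / 2)"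
      by (rule smooth_approximation_along_field[where C=C and \<theta>=\<theta> and K=K and N=N and \<epsilon>=\<epsilon>
            and V="\<lambda>_. v" and \<alpha>="?\<alpha>" and \<beta>="\<lambda>_. 0" and e="min e (\<epsilon> / 2)"];
          (rule lip K N c\<alpha> continuous_on_const e' est that; assumption))
    have \<phi>N: "x \<in> N" if "\<phi> x \<noteq> 0" for x using \<phi>(3)[OF that] N(3,4) by force
    have "\<bar>frechet_derivative \<phi> (at x) v - ?\<alpha> x\<bar> \<le> e" for x
    proof (cases "\<exists>y\<in>K. dist x y \<le> \<epsilon> / 2")
      case True
      then show ?thesis using \<phi>(4) by fastforce
    next
      case False
      \<comment> \<open>The bound on the derivative is available only near \<open>K\<close>; further
        away \<phi> and \<theta> both vanish, and so do their derivatives.\<close>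
      let ?K = "\<Union>x\<in>K. cball x (\<epsilon> / 2)"
      have "compact ?K" by (rule compact_UN_cball[OF K(1)])
      moreover have mem: "z \<in> ?K \<longleftrightarrow> (\<exists>y\<in>K. dist z y \<le> \<epsilon> / 2)" for z
        by (auto simp: dist_commute)
      moreover have "\<phi> z = 0" if "z \<notin> ?K" for z
        using \<phi>(3)[of z] that unfolding mem by force
      ultimately have "frechet_derivative \<phi> (at x) v = 0"
        using False by (intro frechet_derivative_eq_0_outside[of ?K]) (auto simp: compact_imp_closed)
      moreover have "x \<notin> K" using False N(3) by force
      ultimately show ?thesis using D0 \<open>e > 0\<close> by simp
    qed
    then show "\<exists>\<phi>. test_function S \<phi> \<and> (\<forall>x. \<bar>\<phi> x - \<theta> x\<bar> \<le> e) \<and> (\<forall>x. x \<notin> N \<longrightarrow> \<phi> x = 0) \<and>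
      (\<forall>x. \<bar>frechet_derivative \<phi> (at x) v - ?\<alpha> x\<bar> \<le> e)"
      using \<phi>(2) \<phi>N test_functionI[OF \<phi>(1) N(1,2) \<phi>N] by (intro exI[of _ \<phi>]) force
  qed
qed

section \<open>Fubini and differentiation of integrals\<close>

text \<open>The Lebesgue measure on the product is the completion of the product measure, so slices
  of \<open>f\<close> are measurable only for almost every \<open>t\<close>. Fubini's theorem is
  therefore applied to a Borel function \<open>g\<close> that agrees with \<open>f\<close> almost
  everywhere, and the result is carried over slice by slice.\<close>

lemma
  fixes f :: "'a::euclidean_space \<times> 'b::euclidean_space \<Rightarrow> real"
  assumes "integrable lebesgue f"
  shows AE_integrable_lebesgue_slice: "AE t in lebesgue. integrable lebesgue (\<lambda>x. f (t, x))"
    and integrable_lebesgue_fst: "integrable lebesgue (\<lambda>t. LINT x|lebesgue. f (t, x))"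
    and integral_lebesgue_fst: "(LINT t|lebesgue. LINT x|lebesgue. f (t, x)) = (LINT z|lebesgue. f z)"
proof -
  have mf: "f \<in> borel_measurable lebesgue" using assms by auto
  then obtain g where g [measurable]: "g \<in> borel_measurable lborel" and fg: "AE z in lborel. f z = g z"
    using completion_ex_borel_measurable_real by blast
  have gi: "integrable lebesgue g"
    using assms measurable_completion[OF g]
    by (rule Bochner_Integration.integrable_cong_AE_imp) (use fg in \<open>auto intro: AE_completion elim: eventually_mono\<close>)
  then have gl: "integrable lborel g" using integrable_completion[OF g] by simp
  then have gp: "integrable (lborel \<Otimes>\<^sub>M lborel) g" by (simp add: lborel_prod)
  have "AE z in (lborel \<Otimes>\<^sub>M lborel). f z = g z" by (subst lborel_prod) (rule fg)
  then have "AE t in lborel. AE x in lborel. f (t, x) = g (t, x)" by (rule lborel_pair.AE_pair)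
  moreover have "AE t in lborel. integrable lborel (\<lambda>x. g (t, x))"
    using lborel_pair.AE_integrable_fst'[OF gp] .
  ultimately have slice: "AE t in lborel. integrable lebesgue (\<lambda>x. f (t, x)) \<and>
      (LINT x|lebesgue. f (t, x)) = (LINT x|lborel. g (t, x))"
  proof eventually_elim
    case (elim t)
    have gm: "(\<lambda>x. g (t, x)) \<in> borel_measurable lborel" using elim by auto
    then have gm': "(\<lambda>x. g (t, x)) \<in> borel_measurable lebesgue" by (rule measurable_completion)
    have ae: "AE x in lebesgue. g (t, x) = f (t, x)"
      using elim by (auto intro: AE_completion elim: eventually_mono)
    have fm: "(\<lambda>x. f (t, x)) \<in> borel_measurable lebesgue"
      by (rule borel_measurable_AE[OF gm' ae])
    have gi: "integrable lebesgue (\<lambda>x. g (t, x))" using elim integrable_completion[OF gm] by simp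
    have "integrable lebesgue (\<lambda>x. f (t, x))"
      by (rule Bochner_Integration.integrable_cong_AE_imp[OF gi fm]) (use ae in \<open>auto elim: eventually_mono\<close>)
    moreover have "(LINT x|lebesgue. f (t, x)) = (LINT x|lebesgue. g (t, x))"
      by (rule integral_cong_AE[OF fm gm']) (use ae in \<open>auto elim: eventually_mono\<close>)
    ultimately show ?case using integral_completion[OF gm] by simp
  qed
  then have slice': "AE t in lebesgue. integrable lebesgue (\<lambda>x. f (t, x)) \<and>
      (LINT x|lebesgue. f (t, x)) = (LINT x|lborel. g (t, x))" by (rule AE_completion)
  then show "AE t in lebesgue. integrable lebesgue (\<lambda>x. f (t, x))" by eventually_elim simp
  have Gl: "integrable lborel (\<lambda>t. LINT x|lborel. g (t, x))"
    using lborel_pair.integrable_fst'[OF gp] .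
  then have Gm: "(\<lambda>t. LINT x|lborel. g (t, x)) \<in> borel_measurable lborel" by auto
  then have Gm': "(\<lambda>t. LINT x|lborel. g (t, x)) \<in> borel_measurable lebesgue" by (rule measurable_completion)
  have G: "integrable lebesgue (\<lambda>t. LINT x|lborel. g (t, x))"
    using Gl integrable_completion[OF Gm] by simp
  have Fm: "(\<lambda>t. LINT x|lebesgue. f (t, x)) \<in> borel_measurable lebesgue"
    by (rule borel_measurable_AE[OF Gm']) (use slice' in \<open>auto elim: eventually_mono\<close>)
  show "integrable lebesgue (\<lambda>t. LINT x|lebesgue. f (t, x))"
    by (rule Bochner_Integration.integrable_cong_AE_imp[OF G Fm]) (use slice' in \<open>auto elim: eventually_mono\<close>)
  have "(LINT t|lebesgue. LINT x|lebesgue. f (t, x)) = (LINT t|lebesgue. LINT x|lborel. g (t, x))"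
    by (rule integral_cong_AE[OF Fm Gm']) (use slice' in \<open>auto elim: eventually_mono\<close>)
  also have "\<dots> = (LINT t|lborel. LINT x|lborel. g (t, x))" by (rule integral_completion[OF Gm])
  also have "\<dots> = (LINT z|(lborel \<Otimes>\<^sub>M lborel). g z)" by (rule lborel_pair.integral_fst'[OF gp])
  also have "\<dots> = (LINT z|lborel. g z)" by (simp add: lborel_prod)
  also have "\<dots> = (LINT z|lebesgue. g z)" by (rule integral_completion[OF g, symmetric])
  also have "\<dots> = (LINT z|lebesgue. f z)"
    by (rule integral_cong_AE) (use mf measurable_completion[OF g] fg in \<open>auto intro: AE_completion elim: eventually_mono\<close>)
  finally show "(LINT t|lebesgue. LINT x|lebesgue. f (t, x)) = (LINT z|lebesgue. f z)" .
qed

lemma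
  fixes f :: "'a::euclidean_space \<times> 'b::euclidean_space \<Rightarrow> real"
  assumes "set_integrable lebesgue T f"
  shows AE_set_integrable_slice: "AE t in lebesgue. set_integrable lebesgue {x. (t, x) \<in> T} (\<lambda>x. f (t, x))"
    and integrable_set_integral_slice: "integrable lebesgue (\<lambda>t. (LINT x:{x. (t, x) \<in> T}|lebesgue. f (t, x)))"
    and set_integral_slices: "(LINT t|lebesgue. (LINT x:{x. (t, x) \<in> T}|lebesgue. f (t, x))) = (LINT z:T|lebesgue. f z)"
proof -
  have i: "indicator T (t, x) = indicator {x. (t, x) \<in> T} x" for t x by (simp add: indicator_def)
  note a = assms[unfolded set_integrable_def]
  show "AE t in lebesgue. set_integrable lebesgue {x. (t, x) \<in> T} (\<lambda>x. f (t, x))"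
    using AE_integrable_lebesgue_slice[OF a] unfolding i set_integrable_def .
  show "integrable lebesgue (\<lambda>t. (LINT x:{x. (t, x) \<in> T}|lebesgue. f (t, x)))"
    using integrable_lebesgue_fst[OF a] unfolding i set_lebesgue_integral_def .
  show "(LINT t|lebesgue. (LINT x:{x. (t, x) \<in> T}|lebesgue. f (t, x))) = (LINT z:T|lebesgue. f z)"
    using integral_lebesgue_fst[OF a] unfolding i set_lebesgue_integral_def .
qed

section \<open>Lebesgue's differentiation theorem on the line\<close>

text \<open>
  Points where the difference quotient stays \<open>e\<close> away from \<open>f\<close> are Vitali covered by intervals on
  which Henstock's lemma bounds the total error, hence the total length.
\<close>

lemma negligible_bad_difference_quotients:
  fixes f :: "real \<Rightarrow> real"
  assumes f: "f integrable_on {a..b}" and e: "e > 0"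
  shows "negligible {t \<in> {a<..<b}. \<forall>\<delta>>0. \<exists>s\<in>{a..b}. s \<noteq> t \<and> \<bar>s - t\<bar> < \<delta> \<and>
     \<bar>integral {min s t..max s t} f - \<bar>s - t\<bar> * f t\<bar> > e * \<bar>s - t\<bar>}" (is "negligible ?E")
  unfolding negligible_outer_le
proof (intro allI impI)
  fix \<epsilon> :: real assume \<epsilon>: "\<epsilon> > 0"
  \<comment> \<open>The accuracy is \<open>e * \<epsilon>\<close> because each bad interval has
    error above \<open>e\<close> times its length; dividing by \<open>e\<close> bounds the total
    length by \<epsilon>.\<close>
  obtain \<gamma> where \<gamma>: "gauge \<gamma>" and hen: "\<And>p. \<lbrakk>p tagged_partial_division_of (cbox a b); \<gamma> fine p\<rbrakk> \<Longrightarrow>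
             sum (\<lambda>(x,k). norm(measure lborel k *\<^sub>R f x - integral k f)) p < e * \<epsilon>"
    using Henstock_lemma[of f a b "e * \<epsilon>"] f e \<epsilon> by auto
  \<comment> \<open>A bad interval is indexed by its tag \<open>t\<close> and its other endpoint
    \<open>s\<close>, on either side of \<open>t\<close>; lying inside \<open>\<gamma> t\<close>
    makes it admissible for Henstock's lemma. The centre and radius below present it as a ball for
    Vitali's theorem.\<close>
  define I where "I = {(t, s). t \<in> ?E \<and> s \<in> {a..b} \<and> s \<noteq> t \<and> {min s t..max s t} \<subseteq> \<gamma> t \<and>
     \<bar>integral {min s t..max s t} f - \<bar>s - t\<bar> * f t\<bar> > e * \<bar>s - t\<bar>}"
  define c where "c = (\<lambda>(t::real, s). (t + s) / 2)"
  define r where "r = (\<lambda>(t::real, s). \<bar>s - t\<bar> / 2)"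
  have cb: "cball (c (t, s)) (r (t, s)) = {min s t..max s t}" for t s
    by (auto simp: c_def r_def dist_real_def min_def max_def abs_if field_simps split: if_splits)
  have cover: "\<exists>i. i \<in> I \<and> x \<in> cball (c i) (r i) \<and> r i < d" if x: "x \<in> ?E" and d: "0 < d" for x d
  proof -
    have "open (\<gamma> x)" "x \<in> \<gamma> x" using \<gamma> by (auto simp: gauge_def)
    then obtain \<rho> where \<rho>: "\<rho> > 0" "ball x \<rho> \<subseteq> \<gamma> x" by (meson openE)
    have "min \<rho> d > 0" using \<rho> d by simp
    then obtain s where s: "s \<in> {a..b}" "s \<noteq> x" "\<bar>s - x\<bar> < min \<rho> d"
       "\<bar>integral {min s x..max s x} f - \<bar>s - x\<bar> * f x\<bar> > e * \<bar>s - x\<bar>"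
      using x by blast
    have "{min s x..max s x} \<subseteq> ball x \<rho>"
      using s(3) by (auto simp: dist_real_def min_def max_def abs_if split: if_splits)
    then have "(x, s) \<in> I" using \<rho> s x unfolding I_def by blast
    moreover have "x \<in> cball (c (x, s)) (r (x, s))" unfolding cb by auto
    moreover have "r (x, s) < d" using s(3) by (auto simp: r_def)
    ultimately show ?thesis by blast
  qed
  have rpos: "0 < r i" if "i \<in> I" for i using that by (auto simp: I_def r_def)
  obtain C where C: "countable C" "C \<subseteq> I"
     "pairwise (\<lambda>i j. disjnt (cball (c i) (r i)) (cball (c j) (r j))) C"
     "negligible (?E - (\<Union>i\<in>C. cball (c i) (r i)))"
    by (rule Vitali_covering_theorem_cballs[of I r ?E c, OF rpos cover]) (assumption | rule that)+
  have bound: "measure lebesgue (\<Union>i\<in>C'. cball (c i) (r i)) \<le> \<epsilon>" if C': "C' \<subseteq> C" "finite C'" for C'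
  proof -
    define p where "p = (\<lambda>i. (fst i, cball (c i) (r i))) ` C'"
    have disj: "cball (c i) (r i) \<inter> cball (c j) (r j) = {}" if "i \<in> C'" "j \<in> C'" "i \<noteq> j" for i j
      using C(3) that C' unfolding pairwise_def disjnt_def by blast
    have ne: "cball (c i) (r i) \<noteq> {}" if "i \<in> C'" for i
    proof -
      have "0 < r i" using rpos C(2) C'(1) that by blast
      then show ?thesis by simp
    qed
    \<comment> \<open>Disjoint nonempty balls are distinct, so a sum over indices becomes a sum over
      tagged intervals.\<close>
    have inj: "inj_on (\<lambda>i. (fst i, cball (c i) (r i))) C'"
      by (rule inj_onI) (use disj ne in fastforce)
    have p: "p tagged_partial_division_of (cbox a b)"
      unfolding tagged_partial_division_of_def
    proof (intro conjI allI impI)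
      show "finite p" using C' by (simp add: p_def)
      fix x k assume "(x, k) \<in> p"
      then obtain t s where ts: "(t, s) \<in> C'" "x = t" "k = {min s t..max s t}"
        by (auto simp: p_def cb)
      then have "(t, s) \<in> I" using C C' by blast
      then have ab: "t \<in> {a..b}" "s \<in> {a..b}" by (auto simp: I_def)
      show "x \<in> k" using ts by auto
      show "k \<subseteq> cbox a b" using ab ts by (auto simp: min_def max_def split: if_splits)
      show "\<exists>a b. k = cbox a b" using ts by auto
    next
      fix x k x' k' assume *: "(x, k) \<in> p \<and> (x', k') \<in> p \<and> (x, k) \<noteq> (x', k')"
      then have xp: "(x, k) \<in> p" and xp': "(x', k') \<in> p" and neq: "(x, k) \<noteq> (x', k')" by blast+
      obtain i where i: "i \<in> C'" "(x, k) = (fst i, cball (c i) (r i))"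
        using xp[unfolded p_def] by (elim imageE) (rule that)
      obtain j where j: "j \<in> C'" "(x', k') = (fst j, cball (c j) (r j))"
        using xp'[unfolded p_def] by (elim imageE) (rule that)
      have "i \<noteq> j" using i(2) j(2) neq by metis
      then have "k \<inter> k' = {}" using disj[OF i(1) j(1)] i(2) j(2) by simp
      then show "interior k \<inter> interior k' = {}" using interior_subset by blast
    qed
    have fine: "\<gamma> fine p"
      unfolding fine_def
    proof clarify
      fix x k y assume "(x, k) \<in> p" "y \<in> k"
      then obtain t s where ts: "(t, s) \<in> C'" "x = t" "k = {min s t..max s t}"
        by (auto simp: p_def cb)
      then have "(t, s) \<in> I" using C C' by blast
      then have "{min s t..max s t} \<subseteq> \<gamma> t" by (simp add: I_def)
      then show "y \<in> \<gamma> x" using ts \<open>y \<in> k\<close> by blast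
    qed
    have len: "e * measure lebesgue (cball (c i) (r i)) \<le>
        norm (measure lborel (cball (c i) (r i)) *\<^sub>R f (fst i) - integral (cball (c i) (r i)) f)" if "i \<in> C'" for i
    proof -
      obtain t s where i: "i = (t, s)" by (cases i)
      have "(t, s) \<in> I" using that i C C' by blast
      then have "\<bar>integral {min s t..max s t} f - \<bar>s - t\<bar> * f t\<bar> > e * \<bar>s - t\<bar>" by (auto simp: I_def)
      moreover have "measure lborel {min s t..max s t} = \<bar>s - t\<bar>" by (auto simp: min_def max_def)
      moreover have "measure lebesgue {min s t..max s t} = \<bar>s - t\<bar>" by (auto simp: min_def max_def)
      ultimately show ?thesis unfolding i cb by (simp add: abs_minus_commute)
    qed
    have "e * measure lebesgue (\<Union>i\<in>C'. cball (c i) (r i)) \<le> e * (\<Sum>i\<in>C'. measure lebesgue (cball (c i) (r i)))"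
      using e C' by (intro mult_left_mono measure_UNION_le) auto
    also have "\<dots> \<le> (\<Sum>i\<in>C'. norm (measure lborel (cball (c i) (r i)) *\<^sub>R f (fst i) - integral (cball (c i) (r i)) f))"
      unfolding sum_distrib_left by (rule sum_mono) (rule len)
    also have "\<dots> = sum (\<lambda>(x,k). norm(measure lborel k *\<^sub>R f x - integral k f)) p"
      unfolding p_def by (subst sum.reindex[OF inj]) (auto intro: sum.cong)
    also have "\<dots> < e * \<epsilon>" using hen[OF p fine] .
    finally show ?thesis using e by simp
  qed
  \<comment> \<open>The bound for finite subfamilies carries over to the countable Vitali family,
    which covers all of the bad set but a negligible part.\<close>
  let ?U = "\<Union>i\<in>C. cball (c i) (r i)"
  have U: "?U \<in> lmeasurable" "measure lebesgue ?U \<le> \<epsilon>"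
    by (rule fmeasurable_UN_bound[OF C(1)] measure_UN_bound[OF C(1)]; use bound in auto)+
  define N where "N = ?E - ?U"
  have N: "N \<in> lmeasurable" "measure lebesgue N = 0"
    using C(4) unfolding N_def by (rule negligible_imp_measurable, rule negligible_imp_measure0)
  have "measure lebesgue (N \<union> ?U) \<le> measure lebesgue N + measure lebesgue ?U"
    by (rule measure_Un_le) (use N(1) U(1) in \<open>auto simp only: fmeasurableD\<close>)
  then have "measure lebesgue (N \<union> ?U) \<le> \<epsilon>"
    using N(2) U(2) by simp
  moreover have "?E \<subseteq> N \<union> ?U" unfolding N_def by blast
  moreover have "N \<union> ?U \<in> lmeasurable" using N(1) U(1) by (rule fmeasurable.Un)
  ultimately show "\<exists>T. ?E \<subseteq> T \<and> T \<in> lmeasurable \<and> measure lebesgue T \<le> \<epsilon>" by blast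
qed

text \<open>Outside the bad sets for all the thresholds \<open>1 / Suc k\<close> the difference
  quotients converge, and a countable union of negligible sets is negligible.\<close>

lemma indefinite_integral_has_derivative_AE:
  fixes f F :: "real \<Rightarrow> real"
  assumes f: "set_integrable lebesgue {a..b} f"
    and F: "\<And>s t. a \<le> s \<Longrightarrow> s \<le> t \<Longrightarrow> t \<le> b \<Longrightarrow> F t - F s = (LINT x:{s..t}|lebesgue. f x)"
  shows "AE t in lebesgue. t \<in> {a<..<b} \<longrightarrow> (F has_real_derivative f t) (at t)"
proof -
  have fi: "f integrable_on {a..b}" using set_lebesgue_integral_eq_integral(1)[OF f] .
  define E where "E k = {t \<in> {a<..<b}. \<forall>\<delta>>0. \<exists>s\<in>{a..b}. s \<noteq> t \<and> \<bar>s - t\<bar> < \<delta> \<and>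
     \<bar>integral {min s t..max s t} f - \<bar>s - t\<bar> * f t\<bar> > (1 / Suc k) * \<bar>s - t\<bar>}" for k
  have "negligible (\<Union>k. E k)"
    unfolding E_def by (intro negligible_Union_nat negligible_bad_difference_quotients[OF fi]) simp
  then have "AE t in lebesgue. t \<notin> (\<Union>k. E k)"
    unfolding negligible_iff_null_sets by (rule AE_not_in)
  then show ?thesis
  proof (rule eventually_mono, intro impI)
    fix t assume nt: "t \<notin> (\<Union>k. E k)" and t: "t \<in> {a<..<b}"
    have FI: "F (max s t) - F (min s t) = integral {min s t..max s t} f" if "s \<in> {a..b}" for s
    proof -
      have "set_integrable lebesgue {min s t..max s t} f"
        by (rule set_integrable_subset[OF f]) (use that t in auto)
      from set_lebesgue_integral_eq_integral(2)[OF this] show ?thesis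
        using F[of "min s t" "max s t"] that t by auto
    qed
    have "\<exists>d>0. \<forall>s. s \<noteq> t \<and> dist s t < d \<longrightarrow> dist ((F s - F t) / (s - t)) (f t) < e" if e: "e > 0" for e
    proof -
      obtain k where k: "1 / Suc k < e" using nat_approx_posE[OF e] by (metis of_nat_Suc)
      have "t \<notin> E k" using nt by blast
      then have "\<not> (\<forall>\<delta>>0. \<exists>s\<in>{a..b}. s \<noteq> t \<and> \<bar>s - t\<bar> < \<delta> \<and>
          \<bar>integral {min s t..max s t} f - \<bar>s - t\<bar> * f t\<bar> > (1 / Suc k) * \<bar>s - t\<bar>)"
        using t unfolding E_def by blast
      then obtain \<delta> where \<delta>: "\<delta> > 0" "\<And>s. s \<in> {a..b} \<Longrightarrow> s \<noteq> t \<Longrightarrow> \<bar>s - t\<bar> < \<delta> \<Longrightarrow>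
          \<bar>integral {min s t..max s t} f - \<bar>s - t\<bar> * f t\<bar> \<le> (1 / Suc k) * \<bar>s - t\<bar>"
        by (metis not_less)
      define d where "d = min \<delta> (min (t - a) (b - t))"
      have "d > 0" using \<delta> t by (auto simp: d_def)
      moreover have "dist ((F s - F t) / (s - t)) (f t) < e" if s: "s \<noteq> t" "dist s t < d" for s
      proof -
        have sab: "s \<in> {a..b}" and sd: "\<bar>s - t\<bar> < \<delta>"
          using s by (auto simp: d_def dist_real_def abs_if split: if_splits)
        have "(F s - F t) / (s - t) = (F (max s t) - F (min s t)) / \<bar>s - t\<bar>"
          using s by (auto simp: max_def min_def abs_if field_simps)
        then have "(F s - F t) / (s - t) - f t = (integral {min s t..max s t} f - \<bar>s - t\<bar> * f t) / \<bar>s - t\<bar>"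
          using s FI[OF sab] by (simp add: field_simps)
        then have "dist ((F s - F t) / (s - t)) (f t) = \<bar>integral {min s t..max s t} f - \<bar>s - t\<bar> * f t\<bar> / \<bar>s - t\<bar>"
          by (simp add: dist_real_def)
        also have "\<dots> \<le> 1 / Suc k" using \<delta>(2)[OF sab s(1) sd] s by (simp add: divide_le_eq)
        finally show ?thesis using k by simp
      qed
      ultimately show ?thesis by blast
    qed
    then show "(F has_real_derivative f t) (at t)"
      unfolding has_field_derivative_iff tendsto_iff eventually_at by blast
  qed
qed

section \<open>Flows of continuously differentiable vector fields\<close>

text \<open>The growth bound is available only while \<open>u\<close> is in the \<epsilon>-ball,
  because it will come from a Lipschitz bound near a compact set. Up to the first time at which the
  norm reaches \<epsilon> the usual estimate holds, and by \<open>small\<close> it keeps the norm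
  strictly below \<epsilon> at that time too, so the exit never happens.\<close>

lemma gronwall_from_0:
  fixes u u' :: "real \<Rightarrow> 'a::euclidean_space"
  assumes u: "\<And>s. s \<in> {0..T} \<Longrightarrow> (u has_vector_derivative u' s) (at s within {0..T})"
    and u': "\<And>s. s \<in> {0..T} \<Longrightarrow> norm (u s) \<le> \<epsilon> \<Longrightarrow> norm (u' s) \<le> L * norm (u s)"
    and L: "L \<ge> 0" and small: "norm (u 0) * exp (L * T) < \<epsilon>" and s: "s \<in> {0..T}"
  shows "norm (u s) \<le> norm (u 0) * exp (L * s)"
proof -
  have cu: "continuous_on {0..T} u"
    using u has_vector_derivative_continuous by (fastforce simp: continuous_on_eq_continuous_within)
  have A: "norm (u s1) \<le> norm (u 0) * exp (L * s1)"
    if s1: "s1 \<in> {0..T}" and le: "\<And>s. 0 < s \<Longrightarrow> s < s1 \<Longrightarrow> norm (u s) \<le> \<epsilon>" for s1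
  proof (cases "s1 = 0")
    case False
    then have s1pos: "0 < s1" using s1 by simp
    \<comment> \<open>The squared norm is differentiable also where \<open>u\<close> vanishes, and
      with this exponential weight its derivative is nonpositive.\<close>
    define w where "w s = (u s \<bullet> u s) * exp (- 2 * L * s)" for s
    have "continuous_on {0..s1} w"
      unfolding w_def using continuous_on_subset[OF cu, of "{0..s1}"] s1
      by (auto intro!: continuous_intros)
    moreover have "(w has_derivative (\<lambda>h. h * ((2 * (u s \<bullet> u' s) - 2 * L * (u s \<bullet> u s)) * exp (- 2 * L * s)))) (at s)"
      if "0 < s" "s < s1" for s
    proof -
      have "(u has_vector_derivative u' s) (at s)"
        using u[of s] that s1 by (simp add: at_within_Icc_at)
      then have du: "(u has_derivative (\<lambda>h. h *\<^sub>R u' s)) (at s)" by (simp add: has_vector_derivative_def)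
      have "(\<lambda>h. u s \<bullet> h *\<^sub>R u' s + h *\<^sub>R u' s \<bullet> u s) = (*) (2 * (u s \<bullet> u' s))"
        by (auto simp: inner_commute)
      with has_derivative_inner[OF du du]
      have "((\<lambda>s. u s \<bullet> u s) has_real_derivative 2 * (u s \<bullet> u' s)) (at s)"
        by (simp add: has_field_derivative_def)
      moreover have "((\<lambda>s. exp (- 2 * L * s)) has_real_derivative exp (- 2 * L * s) * (- 2 * L)) (at s)"
        by (auto intro!: derivative_eq_intros)
      ultimately have "(w has_real_derivative
          (2 * (u s \<bullet> u' s)) * exp (- 2 * L * s) + (exp (- 2 * L * s) * (- 2 * L)) * (u s \<bullet> u s)) (at s)"
        unfolding w_def by (rule DERIV_mult)
      then have "(w has_real_derivative (2 * (u s \<bullet> u' s) - 2 * L * (u s \<bullet> u s)) * exp (- 2 * L * s)) (at s)"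
        by (rule DERIV_cong) (simp add: algebra_simps)
      then show ?thesis by (simp add: has_field_derivative_def mult_commute_abs)
    qed
    ultimately obtain \<xi> where \<xi>': "0 < \<xi>" "\<xi> < s1" and \<xi>2:
      "w s1 - w 0 = (s1 - 0) * ((2 * (u \<xi> \<bullet> u' \<xi>) - 2 * L * (u \<xi> \<bullet> u \<xi>)) * exp (- 2 * L * \<xi>))"
      by (rule mvt[OF s1pos]) (assumption | rule that)+
    then have \<xi>: "\<xi> \<in> {0<..<s1}" by simp
    have "u \<xi> \<bullet> u' \<xi> \<le> norm (u \<xi>) * norm (u' \<xi>)" by (rule norm_cauchy_schwarz)
    also have "\<dots> \<le> norm (u \<xi>) * (L * norm (u \<xi>))"
      using u'[of \<xi>] le[of \<xi>] \<xi> s1 by (intro mult_left_mono) auto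
    also have "\<dots> = L * (u \<xi> \<bullet> u \<xi>)" by (simp add: power2_norm_eq_inner[symmetric] power2_eq_square)
    finally have "2 * (u \<xi> \<bullet> u' \<xi>) - 2 * L * (u \<xi> \<bullet> u \<xi>) \<le> 0" by simp
    then have "w s1 - w 0 \<le> 0"
      unfolding \<xi>2 using s1pos by (intro mult_nonneg_nonpos mult_nonpos_nonneg) auto
    then have "(norm (u s1))\<^sup>2 * exp (- 2 * L * s1) \<le> (norm (u 0))\<^sup>2"
      by (simp add: w_def power2_norm_eq_inner)
    then have "(norm (u s1))\<^sup>2 \<le> (norm (u 0))\<^sup>2 * exp (2 * L * s1)"
      by (simp add: exp_minus field_simps)
    also have "\<dots> = (norm (u 0) * exp (L * s1))\<^sup>2"
      by (simp add: power_mult_distrib exp_double[symmetric] mult.assoc)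
    finally show ?thesis by (rule power2_le_imp_le) simp
  qed simp
  have "norm (u s) < \<epsilon>" if s: "s \<in> {0..T}" for s
  proof (rule ccontr)
    assume n: "\<not> norm (u s) < \<epsilon>"
    \<comment> \<open>The times at which the norm is at least \<epsilon> form a compact set, so
      there would be a first one.\<close>
    define B where "B = {s \<in> {0..T}. norm (u s) \<in> {\<epsilon>..}}"
    have "closed B" unfolding B_def
      by (rule continuous_closed_preimage[of _ "\<lambda>s. norm (u s)", simplified vimage_def Int_def mem_Collect_eq])
        (auto intro!: continuous_intros cu)
    moreover have "B \<subseteq> {0..T}" by (auto simp: B_def)
    ultimately have "compact B" by (meson bounded_closed_interval bounded_subset compact_eq_bounded_closed)
    moreover have "s \<in> B" using s n by (auto simp: B_def)
    ultimately obtain s1 where s1: "s1 \<in> B" "\<And>s. s \<in> B \<Longrightarrow> s1 \<le> s"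
      using compact_attains_inf[of B] by blast
    have "norm (u s) \<le> \<epsilon>" if "0 < s" "s < s1" for s
      using s1(2)[of s] that s1(1) by (force simp: B_def)
    then have "norm (u s1) \<le> norm (u 0) * exp (L * s1)"
      using A[of s1] s1(1) by (auto simp: B_def)
    also have "\<dots> \<le> norm (u 0) * exp (L * T)"
      using s1(1) L by (intro mult_left_mono) (auto simp: B_def intro: mult_left_mono)
    finally show False using small s1(1) by (auto simp: B_def)
  qed
  then show ?thesis using A[OF s] s by (meson atLeastAtMost_iff less_imp_le order_trans)
qed

text \<open>The initial time may lie inside the interval; both directions of time reduce to the
  forward estimate by the substitution \<open>t0 + \<sigma> * r\<close> with a sign
  \<sigma>.\<close>

lemma gronwall:
  fixes u u' :: "real \<Rightarrow> 'a::euclidean_space"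
  assumes u: "\<And>s. s \<in> {c..d} \<Longrightarrow> (u has_vector_derivative u' s) (at s within {c..d})"
    and u': "\<And>s. s \<in> {c..d} \<Longrightarrow> norm (u s) \<le> \<epsilon> \<Longrightarrow> norm (u' s) \<le> L * norm (u s)"
    and L: "L \<ge> 0" and t0: "t0 \<in> {c..d}" and small: "norm (u t0) * exp (L * (d - c)) < \<epsilon>" and s: "s \<in> {c..d}"
  shows "norm (u s) \<le> norm (u t0) * exp (L * (d - c))"
proof -
  have key: "norm (u (t0 + \<sigma> * \<bar>s - t0\<bar>)) \<le> norm (u t0) * exp (L * \<bar>s - t0\<bar>)"
    if \<sigma>: "\<bar>\<sigma>\<bar> = 1" "t0 + \<sigma> * \<bar>s - t0\<bar> = s" for \<sigma> :: real
  proof -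
    let ?T = "\<bar>s - t0\<bar>" and ?f = "\<lambda>r. t0 + \<sigma> * r"
    have img: "?f ` {0..?T} \<subseteq> {c..d}"
      using \<sigma> s t0 by (auto simp: abs_if split: if_splits)
    have "norm ((u \<circ> ?f) ?T) \<le> norm ((u \<circ> ?f) 0) * exp (L * ?T)"
    proof (rule gronwall_from_0[where T="?T" and u'="\<lambda>r. \<sigma> *\<^sub>R u' (?f r)" and \<epsilon>=\<epsilon>])
      fix r assume r: "r \<in> {0..?T}"
      have "(?f has_vector_derivative \<sigma>) (at r within {0..?T})"
        by (auto intro!: derivative_eq_intros)
      moreover have "(u has_vector_derivative u' (?f r)) (at (?f r) within ?f ` {0..?T})"
        using u img r by (meson has_vector_derivative_within_subset imageI subsetD)
      ultimately show "(u \<circ> ?f has_vector_derivative \<sigma> *\<^sub>R u' (?f r)) (at r within {0..?T})"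
        by (rule vector_diff_chain_within)
      show "norm (\<sigma> *\<^sub>R u' (?f r)) \<le> L * norm ((u \<circ> ?f) r)" if "norm ((u \<circ> ?f) r) \<le> \<epsilon>"
        using u'[of "?f r"] that img r \<sigma> by (auto simp: image_subset_iff)
    next
      have "norm (u t0) * exp (L * ?T) \<le> norm (u t0) * exp (L * (d - c))"
        using s t0 L by (intro mult_left_mono) (auto intro!: mult_left_mono)
      then show "norm ((u \<circ> ?f) 0) * exp (L * ?T) < \<epsilon>" using small by simp
    qed (use L in auto)
    then show ?thesis by simp
  qed
  have "norm (u s) \<le> norm (u t0) * exp (L * \<bar>s - t0\<bar>)"
    using key[of 1] key[of "-1"] by (cases "s \<ge> t0") auto
  also have "\<dots> \<le> norm (u t0) * exp (L * (d - c))"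
    using s t0 L by (intro mult_left_mono) (auto intro!: mult_left_mono)
  finally show ?thesis .
qed

text \<open>The derivative is bounded on a compact neighbourhood of \<open>T\<close>, and the mean
  value inequality is applied in space at a fixed time, on a ball around \<open>p\<close>, which is
  convex whatever the shape of \<open>S\<close>.\<close>

lemma C1_lipschitz_near_compact:
  fixes v :: "real \<Rightarrow> 'a::euclidean_space \<Rightarrow> 'a"
  assumes T: "compact T" "T \<subseteq> S" and S: "open S" and v: "Ck_on 1 S (\<lambda>(t, x). v t x)"
  obtains \<epsilon> L where "\<epsilon> > 0" "L \<ge> 0"
    "\<And>t p x. (t, p) \<in> T \<Longrightarrow> dist x p \<le> \<epsilon> \<Longrightarrow> (t, x) \<in> S"
    "\<And>t p x. (t, p) \<in> T \<Longrightarrow> dist x p \<le> \<epsilon> \<Longrightarrow> norm (v t x - v t p) \<le> L * dist x p"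
proof -
  obtain N \<epsilon> where N: "compact N" "N \<subseteq> S" "\<epsilon> > 0" "\<And>x y. y \<in> T \<Longrightarrow> dist x y \<le> \<epsilon> \<Longrightarrow> x \<in> N"
    by (rule compact_neighbourhood[OF T(1) S T(2)]) (rule that)
  obtain f' where f': "\<And>z. z \<in> S \<Longrightarrow> ((\<lambda>(t, x). v t x) has_derivative blinfun_apply (f' z)) (at z)"
    and cf': "continuous_on S f'"
    by (rule Ck_on_1_derivative_blinfun[OF v]) (rule that)
  have "bounded (f' ` N)"
    by (rule compact_imp_bounded[OF compact_continuous_image[OF continuous_on_subset[OF cf' N(2)] N(1)]])
  then obtain L where L: "L > 0" "\<And>z. z \<in> N \<Longrightarrow> norm (f' z) \<le> L"
    unfolding bounded_pos by auto
  have inN: "(t, x) \<in> N" if "(t, p) \<in> T" "dist x p \<le> \<epsilon>" for t p x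
    using N(4)[OF that(1), of "(t, x)"] that by (simp add: dist_Pair_Pair)
  have lip: "norm (v t x - v t p) \<le> L * dist x p" if tp: "(t, p) \<in> T" and x: "dist x p \<le> \<epsilon>" for t p x
    unfolding dist_norm
  proof (rule differentiable_bound[where S="cball p \<epsilon>" and f="v t" and f'="\<lambda>y h. f' (t, y) (0, h)"])
    fix y assume y: "y \<in> cball p \<epsilon>"
    then have yN: "(t, y) \<in> N" using inN[OF tp] by (simp add: dist_commute)
    have "((\<lambda>y. (t, y)) has_derivative (\<lambda>h. (0, h))) (at y within cball p \<epsilon>)"
      by (auto intro!: derivative_eq_intros)
    from has_derivative_compose[OF this f'] yN N(2)
    show "(v t has_derivative (\<lambda>h. f' (t, y) (0, h))) (at y within cball p \<epsilon>)" by auto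
    show "onorm (\<lambda>h. f' (t, y) (0, h)) \<le> L"
    proof (rule onorm_le)
      fix h :: 'a
      have "norm (f' (t, y) (0, h)) \<le> norm (f' (t, y)) * norm (0::real, h)" by (rule norm_blinfun)
      also have "\<dots> \<le> L * norm h" using L(2)[OF yN] by (auto simp: norm_Pair intro: mult_right_mono)
      finally show "norm (f' (t, y) (0, h)) \<le> L * norm h" .
    qed
  qed (use x N(3) in \<open>auto simp: dist_commute\<close>)
  show ?thesis
    by (rule that[OF N(3) less_imp_le[OF L(1)]]) (use inN N(2) lip in blast)+
qed

text \<open>A solution on a compact time interval, in a space-time domain that need not be a product
  and without a distinguished initial time, so that the comparison of two solutions can start
  anywhere.\<close>

definition integral_curve ::
  "(real \<times> 'a) set \<Rightarrow> (real \<Rightarrow> 'a \<Rightarrow> 'a) \<Rightarrow> real \<Rightarrow> real \<Rightarrow> (real \<Rightarrow> 'a::euclidean_space) \<Rightarrow> bool" where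
  "integral_curve S v c d x \<longleftrightarrow>
     (\<forall>t\<in>{c..d}. (t, x t) \<in> S \<and> (x has_vector_derivative v t (x t)) (at t within {c..d}))"

lemma integral_curveD:
  assumes "integral_curve S v c d x" "t \<in> {c..d}"
  shows "(t, x t) \<in> S" "(x has_vector_derivative v t (x t)) (at t within {c..d})"
  using assms by (auto simp: integral_curve_def)

lemma continuous_on_integral_curve: "integral_curve S v c d x \<Longrightarrow> continuous_on {c..d} x"
  unfolding continuous_on_eq_continuous_within
  by (meson has_vector_derivative_continuous integral_curveD(2))

text \<open>That \<open>y\<close> stays near \<open>x\<close> is a consequence of the local form of
  Gronwall's inequality once the two are close at \<open>t0\<close>. The constants depend on
  \<open>x\<close> only, which gives continuous dependence and, for equal initial values,
  uniqueness.\<close>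

lemma ode_close:
  fixes v :: "real \<Rightarrow> 'a::euclidean_space \<Rightarrow> 'a"
  assumes S: "open S" and v: "Ck_on 1 S (\<lambda>(t, x). v t x)" and t0: "t0 \<in> {c..d}"
    and x: "integral_curve S v c d x"
  obtains \<epsilon> B where "\<epsilon> > 0" "B > 0" "\<And>y t. integral_curve S v c d y \<Longrightarrow> norm (y t0 - x t0) * B < \<epsilon> \<Longrightarrow> t \<in> {c..d} \<Longrightarrow> norm (y t - x t) \<le> norm (y t0 - x t0) * B"
proof -
  note cx = continuous_on_integral_curve[OF x]
  let ?T = "(\<lambda>t. (t, x t)) ` {c..d}"
  have T: "compact ?T" by (rule compact_continuous_image) (auto intro!: continuous_intros cx)
  have TS: "?T \<subseteq> S" using integral_curveD(1)[OF x] by blast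
  obtain \<epsilon> L where e: "\<epsilon> > 0" "L \<ge> 0"
    "\<And>t p x. (t, p) \<in> ?T \<Longrightarrow> dist x p \<le> \<epsilon> \<Longrightarrow> (t, x) \<in> S"
    "\<And>t p x. (t, p) \<in> ?T \<Longrightarrow> dist x p \<le> \<epsilon> \<Longrightarrow> norm (v t x - v t p) \<le> L * dist x p"
    by (rule C1_lipschitz_near_compact[OF T TS S v]) (rule that)
  show ?thesis
  proof (rule that[OF e(1), of "exp (L * (d - c))"])
    fix y t
    assume y: "integral_curve S v c d y"
      and small: "norm (y t0 - x t0) * exp (L * (d - c)) < \<epsilon>" and t: "t \<in> {c..d}"
    show "norm (y t - x t) \<le> norm (y t0 - x t0) * exp (L * (d - c))"
    proof (rule gronwall[where u="\<lambda>t. y t - x t" and u'="\<lambda>t. v t (y t) - v t (x t)", OF _ _ e(2) t0 small t])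
      fix s assume s: "s \<in> {c..d}"
      show "((\<lambda>t. y t - x t) has_vector_derivative v s (y s) - v s (x s)) (at s within {c..d})"
        by (intro has_vector_derivative_diff integral_curveD(2)[OF x s] integral_curveD(2)[OF y s])
      show "norm (v s (y s) - v s (x s)) \<le> L * norm (y s - x s)" if "norm (y s - x s) \<le> \<epsilon>"
        using e(4)[of s "x s" "y s"] that s by (auto simp: dist_norm)
    qed
  qed simp
qed

lemma ode_unique:
  fixes v :: "real \<Rightarrow> 'a::euclidean_space \<Rightarrow> 'a"
  assumes S: "open S" and v: "Ck_on 1 S (\<lambda>(t, x). v t x)" and t0: "t0 \<in> {c..d}"
    and x: "integral_curve S v c d x"
    and y: "integral_curve S v c d y"
    and eq: "x t0 = y t0" and t: "t \<in> {c..d}"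
  shows "x t = y t"
proof -
  obtain \<epsilon> B where e: "\<epsilon> > 0" "B > 0" "\<And>y t. integral_curve S v c d y \<Longrightarrow> norm (y t0 - x t0) * B < \<epsilon> \<Longrightarrow> t \<in> {c..d} \<Longrightarrow> norm (y t - x t) \<le> norm (y t0 - x t0) * B"
    by (rule ode_close[OF S v t0 x]) (rule that)
  have "norm (y t - x t) \<le> norm (y t0 - x t0) * B"
    by (rule e(3)[OF y]) (use eq e t in auto)
  then show ?thesis using eq by simp
qed

text \<open>The solutions that compete in the definite description of \<open>flow_map\<close> may
  live on different intervals, but all of these contain the segment from \<open>t0\<close> to
  \<open>t\<close>, where uniqueness applies.\<close>

lemma flow_map_eq:
  assumes J: "open J" and \<Omega>: "open \<Omega>" and v: "Ck_on 1 (J \<times> \<Omega>) (\<lambda>(t, x). v t x)"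
    and I: "open I" "is_interval I" "I \<subseteq> J" and x: "ode_solution v \<Omega> I t0 q x" and t: "t \<in> I"
  shows "flow_map v J \<Omega> t0 t q = x t"
  unfolding flow_map_def
proof (rule the_equality)
  show "\<exists>I y. open I \<and> is_interval I \<and> I \<subseteq> J \<and> t \<in> I \<and> ode_solution v \<Omega> I t0 q y \<and> x t = y t"
    using I x t by blast
  fix z assume "\<exists>I y. open I \<and> is_interval I \<and> I \<subseteq> J \<and> t \<in> I \<and> ode_solution v \<Omega> I t0 q y \<and> z = y t"
  then obtain I' y where I': "open I'" "is_interval I'" "I' \<subseteq> J" "t \<in> I'" "ode_solution v \<Omega> I' t0 q y" "z = y t"
    by blast
  have t0: "t0 \<in> I" "t0 \<in> I'" "x t0 = q" "y t0 = q"
    using x I'(5) by (auto simp: ode_solution_def)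
  have sub: "{min t0 t..max t0 t} \<subseteq> A" if "is_interval A" "t0 \<in> A" "t \<in> A" for A
    using closed_segment_subset[OF that(2,3)] that(1)
    by (auto simp: is_interval_convex_1 closed_segment_eq_real_ivl min_def max_def split: if_splits)
  have restrict: "integral_curve (J \<times> \<Omega>) v (min t0 t) (max t0 t) y"
    if "ode_solution v \<Omega> A t0 q y" "is_interval A" "A \<subseteq> J" "t \<in> A" for A y
    unfolding integral_curve_def
  proof
    fix s assume s: "s \<in> {min t0 t..max t0 t}"
    have "t0 \<in> A" using that(1) by (simp add: ode_solution_def)
    note sA = sub[OF that(2) this that(4)]
    then have "s \<in> A" using s by blast
    then have "s \<in> J" "y s \<in> \<Omega>" "(y has_vector_derivative v s (y s)) (at s within A)"
      using that by (auto simp: ode_solution_def)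
    then show "(s, y s) \<in> J \<times> \<Omega> \<and> (y has_vector_derivative v s (y s)) (at s within {min t0 t..max t0 t})"
      using has_vector_derivative_within_subset[OF _ sA] by auto
  qed
  have "x t = y t"
    by (rule ode_unique[OF open_Times[OF J \<Omega>] v, where c="min t0 t" and d="max t0 t" and ?t0.0=t0])
      (use restrict[OF x I(2,3) t] restrict[OF I'(5,2,3,4)] t0 in auto)
  then show "z = x t" using I' by simp
qed

section \<open>The tube swept out by the flow and the distance to it\<close>

lemma norm_plus_minus_le:
  fixes a b c :: "'a::real_normed_vector"
  shows "norm (a + b - c) \<le> norm a + norm b + norm c"
  using norm_triangle_ineq4[of "a + b" c] norm_triangle_ineq[of a b] by linarith

lemma norm_minus_plus_le:
  fixes a b c :: "'a::real_normed_vector"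
  shows "norm (a - b + c) \<le> norm a + norm b + norm c"
  using norm_triangle_ineq[of "a - b" c] norm_triangle_ineq4[of a b] by linarith

text \<open>Near the ends of the existence interval trajectories may leave every compact set, so
  uniform constants are sought on a compact window. \<open>G0\<close> is nonempty because
  \<open>infdist\<close> to the empty set is 0 by convention, which would break the link between
  distance zero and membership.\<close>

locale flow_window =
  fixes S :: "(real \<times> 'a::euclidean_space) set" and v :: "real \<Rightarrow> 'a \<Rightarrow> 'a"
    and c d t0 :: real and G0 :: "'a set" and X :: "'a \<Rightarrow> real \<Rightarrow> 'a"
  assumes S: "open S" and v: "Ck_on 1 S (\<lambda>(t, x). v t x)" and t0: "t0 \<in> {c..d}"
    and G0: "compact G0" "G0 \<noteq> {}"
    and X: "\<And>q. q \<in> G0 \<Longrightarrow> integral_curve S v c d (X q)"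
    and X0: "\<And>q. q \<in> G0 \<Longrightarrow> X q t0 = q"
begin

definition G :: "real \<Rightarrow> 'a set" where "G t = (\<lambda>q. X q t) ` G0"

definition tube :: "(real \<times> 'a) set" where "tube = {(t, x). t \<in> {c..d} \<and> x \<in> G t}"

text \<open>The estimate of \<open>ode_close\<close> is uniform in time. So the starting point is
  changed first, at the new time, and then the time is changed along the fixed trajectory of
  \<open>q\<close>.\<close>

lemma continuous_on_flow: "continuous_on ({c..d} \<times> G0) (\<lambda>(t, q). X q t)"
  unfolding continuous_on_iff
proof (intro ballI allI impI)
  fix z0 and e :: real
  assume "z0 \<in> {c..d} \<times> G0" and e: "0 < e"
  then obtain t q where z0: "z0 = (t, q)" and t: "t \<in> {c..d}" and q: "q \<in> G0" by blast
  obtain \<epsilon> B where B: "\<epsilon> > 0" "B > 0" "\<And>y t. integral_curve S v c d y \<Longrightarrow> norm (y t0 - X q t0) * B < \<epsilon> \<Longrightarrow> t \<in> {c..d} \<Longrightarrow> norm (y t - X q t) \<le> norm (y t0 - X q t0) * B"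
    by (rule ode_close[OF S v t0 X[OF q]]) (rule that)
  have "continuous_on {c..d} (X q)" using X[OF q] by (rule continuous_on_integral_curve)
  then obtain \<delta> where \<delta>: "\<delta> > 0" "\<And>s. s \<in> {c..d} \<Longrightarrow> dist s t < \<delta> \<Longrightarrow> dist (X q s) (X q t) < e / 2"
    using t e unfolding continuous_on_iff by (meson half_gt_zero)
  define \<rho> where "\<rho> = min \<epsilon> (e / 2) / B"
  have \<rho>: "\<rho> > 0" "\<rho> * B = min \<epsilon> (e / 2)" using B e by (auto simp: \<rho>_def)
  show "\<exists>d'>0. \<forall>x'\<in>{c..d} \<times> G0. dist x' z0 < d' \<longrightarrow> dist (case x' of (t, q) \<Rightarrow> X q t) (case z0 of (t, q) \<Rightarrow> X q t) < e"
  proof (intro exI[of _ "min \<delta> \<rho>"] conjI ballI impI)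
    show "min \<delta> \<rho> > 0" using \<delta> \<rho> by simp
    fix z assume z: "z \<in> {c..d} \<times> G0" "dist z z0 < min \<delta> \<rho>"
    obtain t' q' where z': "z = (t', q')" by (cases z)
    have t': "t' \<in> {c..d}" "q' \<in> G0" "dist t' t < \<delta>" "norm (q' - q) < \<rho>"
      using z dist_fst_le[of z z0] dist_snd_le[of z z0] by (auto simp: z' z0 dist_norm)
    have nB: "norm (q' - q) * B < \<rho> * B" using t'(4) B(2) by simp
    have "norm (X q' t' - X q t') \<le> norm (X q' t0 - X q t0) * B"
      by (rule B(3)[OF X[OF t'(2)] _ t'(1)]) (use nB \<rho> t' q in \<open>auto simp: X0\<close>)
    then have "norm (X q' t' - X q t') < e / 2" using nB \<rho>(2) t' q by (simp add: X0)
    moreover have "dist (X q t') (X q t) < e / 2" by (rule \<delta>(2)[OF t'(1,3)])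
    ultimately have "dist (X q' t') (X q t) < e"
      using dist_triangle[of "X q' t'" "X q t" "X q t'"] by (simp add: dist_norm)
    then show "dist (case z of (t, q) \<Rightarrow> X q t) (case z0 of (t, q) \<Rightarrow> X q t) < e" by (simp add: z' z0)
  qed
qed

lemma compact_tube: "compact tube"
proof -
  have "tube = (\<lambda>(t, q). (t, X q t)) ` ({c..d} \<times> G0)"
    by (auto simp: tube_def G_def image_iff)
  moreover have "continuous_on ({c..d} \<times> G0) (\<lambda>(t, q). (t, X q t))"
    using continuous_on_flow unfolding split_beta by (intro continuous_intros)
  ultimately show ?thesis using compact_continuous_image[OF _ compact_Times[OF compact_Icc G0(1)]] by simp
qed

lemma tube_subset: "tube \<subseteq> S"
  using integral_curveD(1)[OF X] by (auto simp: tube_def G_def)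

lemma compact_G: "t \<in> {c..d} \<Longrightarrow> compact (G t)"
proof -
  assume t: "t \<in> {c..d}"
  have "continuous_on G0 (\<lambda>q. (\<lambda>(t, q). X q t) (t, q))"
    by (rule continuous_on_compose2[OF continuous_on_flow]) (use t in \<open>auto intro!: continuous_intros\<close>)
  then show ?thesis unfolding G_def using compact_continuous_image[OF _ G0(1)] by simp
qed

lemma G_nonempty: "G t \<noteq> {}"
  using G0 by (simp add: G_def)

lemma nearest_in_G:
  assumes "t \<in> {c..d}"
  obtains q where "q \<in> G0" "infdist x (G t) = dist x (X q t)"
proof -
  obtain y where y: "y \<in> G t" "infdist x (G t) = dist x y"
    by (rule infdist_attains_inf[OF compact_imp_closed[OF compact_G[OF assms]] G_nonempty])
  then show ?thesis using that by (auto simp: G_def)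
qed

text \<open>The field is bounded on the compact tube, and the trajectories stay in the tube.\<close>

lemma flow_lipschitz:
  obtains M where "M \<ge> 0" "\<And>t p. (t, p) \<in> tube \<Longrightarrow> norm (v t p) \<le> M"
    "\<And>q s t. q \<in> G0 \<Longrightarrow> s \<in> {c..d} \<Longrightarrow> t \<in> {c..d} \<Longrightarrow> norm (X q t - X q s) \<le> M * \<bar>t - s\<bar>"
proof -
  have "compact ((\<lambda>(t, x). v t x) ` tube)"
    by (rule compact_continuous_image[OF continuous_on_subset[OF Ck_on_1D(3)[OF v] tube_subset] compact_tube])
  then obtain M where M: "M > 0" "\<And>z. z \<in> (\<lambda>(t, x). v t x) ` tube \<Longrightarrow> norm z \<le> M"
    using compact_imp_bounded bounded_pos by metis
  have Mv: "norm (v t p) \<le> M" if "(t, p) \<in> tube" for t p using M(2) that by force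
  have lip: "norm (X q t - X q s) \<le> M * \<bar>t - s\<bar>" if q: "q \<in> G0" and st: "s \<in> {c..d}" "t \<in> {c..d}" for q s t
  proof -
    have "norm (X q t - X q s) \<le> M * norm (t - s)"
    proof (rule differentiable_bound[where S="{c..d}" and f="X q" and f'="\<lambda>r h. h *\<^sub>R v r (X q r)"])
      fix r assume r: "r \<in> {c..d}"
      show "(X q has_derivative (\<lambda>h. h *\<^sub>R v r (X q r))) (at r within {c..d})"
        using integral_curveD(2)[OF X[OF q] r] by (simp add: has_vector_derivative_def)
      have "(r, X q r) \<in> tube" using q r by (auto simp: tube_def G_def)
      then show "onorm (\<lambda>h. h *\<^sub>R v r (X q r)) \<le> M"
        using Mv by (intro onorm_le) (auto simp: mult.commute[of M] intro: mult_left_mono)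
    qed (use st in auto)
    then show ?thesis by simp
  qed
  show ?thesis by (rule that[OF less_imp_le[OF M(1)] Mv lip])
qed

text \<open>
  The set moves with the flow, so along the field the distance to it can only change at the rate at
  which trajectories separate.
\<close>

lemma distance_along_field:
  obtains \<epsilon> L where "\<epsilon> > 0" "L \<ge> 0"
    "\<And>t x. t \<in> {c..d} \<Longrightarrow> infdist x (G t) \<le> \<epsilon> \<Longrightarrow> (t, x) \<in> S"
    "\<And>e. e > 0 \<Longrightarrow> \<exists>h0>0. \<forall>t x h. t \<in> {c..d} \<and> t + h \<in> {c..d} \<and> infdist x (G t) \<le> \<epsilon> \<and> \<bar>h\<bar> < h0 \<longrightarrow>
       \<bar>infdist (x + h *\<^sub>R v t x) (G (t + h)) - infdist x (G t)\<bar> \<le> \<bar>h\<bar> * (L * infdist x (G t) + e)"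
proof -
  obtain \<epsilon>0 L where e0: "\<epsilon>0 > 0" "L \<ge> 0"
    "\<And>t p x. (t, p) \<in> tube \<Longrightarrow> dist x p \<le> \<epsilon>0 \<Longrightarrow> (t, x) \<in> S"
    "\<And>t p x. (t, p) \<in> tube \<Longrightarrow> dist x p \<le> \<epsilon>0 \<Longrightarrow> norm (v t x - v t p) \<le> L * dist x p"
    by (rule C1_lipschitz_near_compact[OF compact_tube tube_subset S v]) (rule that)
  obtain M where M: "M \<ge> 0" "\<And>t p. (t, p) \<in> tube \<Longrightarrow> norm (v t p) \<le> M"
    "\<And>q s t. q \<in> G0 \<Longrightarrow> s \<in> {c..d} \<Longrightarrow> t \<in> {c..d} \<Longrightarrow> norm (X q t - X q s) \<le> M * \<bar>t - s\<bar>"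
    by (rule flow_lipschitz) (rule that)
  \<comment> \<open>Half of \<epsilon>0 is kept in reserve for the point of \<open>G t\<close> that
    the flow carries to the nearest point of \<open>G (t + h)\<close>: it can be somewhat further
    from \<open>x\<close> than \<epsilon>.\<close>
  define \<epsilon> where "\<epsilon> = \<epsilon>0 / 2"
  have nearest: "\<exists>q\<in>G0. infdist x (G t) = norm (x - X q t)" if "t \<in> {c..d}" for x t
    using nearest_in_G[OF that, of x] by (metis dist_norm)
  have inT: "(t, X q t) \<in> tube" if "q \<in> G0" "t \<in> {c..d}" for q t
    using that by (auto simp: tube_def G_def)
  have leG: "infdist x (G t) \<le> norm (x - X q t)" if "q \<in> G0" for x q t
    using that infdist_le[of "X q t" "G t" x] by (simp add: G_def dist_norm)
  have tubeS: "(t, x) \<in> S" if "t \<in> {c..d}" "infdist x (G t) \<le> \<epsilon>" for t x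
  proof -
    obtain q where "q \<in> G0" "infdist x (G t) = norm (x - X q t)" using nearest \<open>t \<in> _\<close> by blast
    then show ?thesis using e0(3)[OF inT, of q t x] that e0(1) by (auto simp: \<epsilon>_def dist_norm)
  qed
  have est: "\<exists>h0>0. \<forall>t x h. t \<in> {c..d} \<and> t + h \<in> {c..d} \<and> infdist x (G t) \<le> \<epsilon> \<and> \<bar>h\<bar> < h0 \<longrightarrow>
       \<bar>infdist (x + h *\<^sub>R v t x) (G (t + h)) - infdist x (G t)\<bar> \<le> \<bar>h\<bar> * (L * infdist x (G t) + e)"
    if e: "e > 0" for e
  proof -
    define \<omega> where "\<omega> = e / 2"
    have \<omega>: "\<omega> > 0" using e by (simp add: \<omega>_def)
    obtain \<delta> where \<delta>: "\<delta> > 0" "\<And>y z. y \<in> tube \<Longrightarrow> z \<in> tube \<Longrightarrow> dist y z \<le> \<delta> \<Longrightarrow>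
        dist ((\<lambda>(t, x). v t x) y) ((\<lambda>(t, x). v t x) z) \<le> \<omega>"
      by (rule compact_uniform_continuity[OF compact_tube continuous_on_subset[OF Ck_on_1D(3)[OF v] tube_subset] \<omega>]) (rule that)
    \<comment> \<open>Up to the factor |h|, \<open>C\<close> bounds how much further from
      \<open>x\<close> that point can be than the nearest point of \<open>G t\<close>; see
      \<open>PD\<close>.\<close>
    define C where "C = M + L * \<epsilon> + (L * \<epsilon> + \<omega>) + M + 1"
    have C: "C \<ge> 1" using M e0 \<omega> by (auto simp: C_def \<epsilon>_def)
    \<comment> \<open>The three bounds serve, in turn, the modulus of continuity of the field along
      trajectories, the estimate \<open>P \<le> \<epsilon>0\<close>, and
      \<open>L * (\<bar>h\<bar> * C) \<le> \<omega>\<close>.\<close>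
    define h0 where "h0 = Min {\<delta> / (M + 1), \<epsilon> / C, \<omega> / ((L + 1) * C)}"
    have pos: "\<delta> / (M + 1) > 0" "\<epsilon> / C > 0" "\<omega> / ((L + 1) * C) > 0"
      using \<delta>(1) M(1) e0(1,2) \<omega> C by (auto simp: \<epsilon>_def intro!: divide_pos_pos mult_pos_pos)
    have h0: "h0 > 0" "h0 \<le> \<delta> / (M + 1)" "h0 \<le> \<epsilon> / C" "h0 \<le> \<omega> / ((L + 1) * C)"
      using pos unfolding h0_def by (simp_all only: Min_gr_iff Min_le finite.intros insert_not_empty insert_iff simp_thms) auto
    \<comment> \<open>Trajectories are differentiable uniformly in time and starting point, because
      the field along them varies by at most \<omega> within the time |h|.\<close>
    have lin: "norm (X q (t + h) - X q t - h *\<^sub>R v t (X q t)) \<le> \<bar>h\<bar> * \<omega>"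
      if q: "q \<in> G0" and th: "t \<in> {c..d}" "t + h \<in> {c..d}" and h: "\<bar>h\<bar> < h0" for q t h
    proof -
      let ?I = "{min t (t + h)..max t (t + h)}"
      have I: "?I \<subseteq> {c..d}" using th by auto
      have "norm ((X q (t + h) - (t + h) *\<^sub>R v t (X q t)) - (X q t - t *\<^sub>R v t (X q t))) \<le> \<omega> * norm ((t + h) - t)"
      proof (rule differentiable_bound[where S="?I" and f="\<lambda>r. X q r - r *\<^sub>R v t (X q t)"
            and f'="\<lambda>r h. h *\<^sub>R (v r (X q r) - v t (X q t))"])
        fix r assume r: "r \<in> ?I"
        then have rcd: "r \<in> {c..d}" using I by blast
        have "(X q has_derivative (\<lambda>h. h *\<^sub>R v r (X q r))) (at r within ?I)"
          using has_vector_derivative_within_subset[OF integral_curveD(2)[OF X[OF q] rcd] I] by (simp add: has_vector_derivative_def)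
        then show "((\<lambda>r. X q r - r *\<^sub>R v t (X q t)) has_derivative (\<lambda>h. h *\<^sub>R (v r (X q r) - v t (X q t)))) (at r within ?I)"
          by (auto intro!: derivative_eq_intros simp: algebra_simps)
        have rt: "\<bar>r - t\<bar> \<le> \<bar>h\<bar>" using r by auto
        have "dist (r, X q r) (t, X q t) \<le> dist r t + dist (X q r) (X q t)"
          using sqrt_sum_squares_le_sum_abs[of "dist r t" "dist (X q r) (X q t)"] by (simp add: dist_Pair_Pair)
        also have "\<dots> \<le> (M + 1) * \<bar>r - t\<bar>"
          using M(3)[OF q th(1) rcd] by (simp add: dist_norm algebra_simps)
        also have "\<dots> \<le> (M + 1) * h0" using rt h M(1) by (intro mult_left_mono) auto
        also have "\<dots> \<le> \<delta>" using h0(2) M(1) by (simp add: pos_le_divide_eq mult.commute)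
        finally have "dist (v r (X q r)) (v t (X q t)) \<le> \<omega>"
          using \<delta>(2)[OF inT[OF q rcd] inT[OF q th(1)]] by simp
        then show "onorm (\<lambda>h. h *\<^sub>R (v r (X q r) - v t (X q t))) \<le> \<omega>"
          by (intro onorm_le) (auto simp: dist_norm mult.commute[of \<omega>] intro: mult_left_mono)
      qed (auto simp: min_def max_def)
      then show ?thesis by (simp add: algebra_simps)
    qed
    have "\<bar>infdist (x + h *\<^sub>R v t x) (G (t + h)) - infdist x (G t)\<bar> \<le> \<bar>h\<bar> * (L * infdist x (G t) + e)"
      if th: "t \<in> {c..d}" "t + h \<in> {c..d}" and x: "infdist x (G t) \<le> \<epsilon>" and h: "\<bar>h\<bar> < h0" for t x h
    proof -
      define D where "D = infdist x (G t)"
      define x' where "x' = x + h *\<^sub>R v t x"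
      define D' where "D' = infdist x' (G (t + h))"
      have D: "D \<ge> 0" "D \<le> \<epsilon>" using x by (auto simp: D_def infdist_nonneg)
      obtain q where q: "q \<in> G0" "D = norm (x - X q t)" using nearest[OF th(1)] D_def by blast
      obtain q' where q': "q' \<in> G0" "D' = norm (x' - X q' (t + h))" using nearest[OF th(2)] D'_def by blast
      have D\<epsilon>0: "D \<le> \<epsilon>0" using D e0(1) by (simp add: \<epsilon>_def)
      have vq: "norm (v t x - v t (X q t)) \<le> L * D"
        using e0(4)[OF inT[OF q(1) th(1)], of x] D\<epsilon>0 q(2) by (simp add: dist_norm)
      \<comment> \<open>For the upper bound, the point nearest to \<open>x\<close> at time
        \<open>t\<close> is carried along by the flow and competes at time
        \<open>t + h\<close>.\<close>
      have "D' \<le> norm (x' - X q (t + h))" unfolding D'_def by (rule leG[OF q(1)])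
      also have "x' - X q (t + h) = (x - X q t) + h *\<^sub>R (v t x - v t (X q t)) - (X q (t + h) - X q t - h *\<^sub>R v t (X q t))"
        by (simp add: x'_def algebra_simps)
      also have "norm \<dots> \<le> norm (x - X q t) + norm (h *\<^sub>R (v t x - v t (X q t))) + norm (X q (t + h) - X q t - h *\<^sub>R v t (X q t))"
        by (rule norm_plus_minus_le)
      also have "\<dots> \<le> D + \<bar>h\<bar> * (L * D) + \<bar>h\<bar> * \<omega>"
        using lin[OF q(1) th h] vq q(2) by (intro add_mono) (auto intro: mult_left_mono)
      finally have up: "D' \<le> D + \<bar>h\<bar> * (L * D) + \<bar>h\<bar> * \<omega>" .
      have "norm (v t x) \<le> norm (v t (X q t)) + norm (v t x - v t (X q t))"
        using norm_triangle_sub by blast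
      also have "\<dots> \<le> M + L * \<epsilon>"
        using M(2)[OF inT[OF q(1) th(1)]] vq D e0(2) mult_left_mono[of D \<epsilon> L] by linarith
      finally have vM: "norm (v t x) \<le> M + L * \<epsilon>" .
      \<comment> \<open>For the lower bound, the nearest point at time \<open>t + h\<close> is
        traced back to time \<open>t\<close>. A crude estimate of its distance \<open>P\<close>
        comes first, since the Lipschitz bound applies to it only once
        \<open>P \<le> \<epsilon>0\<close> is known.\<close>
      define P where "P = norm (x - X q' t)"
      have "x - X q' t = (x' - X q' (t + h)) - h *\<^sub>R v t x + (X q' (t + h) - X q' t)"
        by (simp add: x'_def algebra_simps)
      from this[THEN arg_cong[of _ _ norm]]
      have "P \<le> norm (x' - X q' (t + h)) + norm (h *\<^sub>R v t x) + norm (X q' (t + h) - X q' t)"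
        unfolding P_def by (simp only: norm_minus_plus_le)
      also have "\<dots> \<le> D' + \<bar>h\<bar> * (M + L * \<epsilon>) + M * \<bar>h\<bar>"
        using M(3)[OF q'(1) th] vM q'(2) by (intro add_mono) (auto intro: mult_left_mono)
      also have "\<dots> \<le> D + \<bar>h\<bar> * (L * \<epsilon>) + \<bar>h\<bar> * \<omega> + \<bar>h\<bar> * (M + L * \<epsilon>) + M * \<bar>h\<bar>"
        using up mult_left_mono[OF mult_left_mono[OF D(2) e0(2)], of "\<bar>h\<bar>"] by simp
      also have "\<dots> \<le> D + \<bar>h\<bar> * C" by (simp add: C_def algebra_simps)
      finally have PD: "P \<le> D + \<bar>h\<bar> * C" .
      have "\<bar>h\<bar> * C \<le> \<epsilon>" using h h0(3) C by (simp add: pos_le_divide_eq[symmetric])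
      then have "P \<le> \<epsilon>0" using PD D by (simp add: \<epsilon>_def)
      then have vq': "norm (v t x - v t (X q' t)) \<le> L * P"
        using e0(4)[OF inT[OF q'(1) th(1)], of x] by (simp add: dist_norm P_def)
      have "x - X q' t = (x' - X q' (t + h)) - h *\<^sub>R (v t x - v t (X q' t)) + (X q' (t + h) - X q' t - h *\<^sub>R v t (X q' t))"
        by (simp add: x'_def algebra_simps)
      from this[THEN arg_cong[of _ _ norm]]
      have "P \<le> norm (x' - X q' (t + h)) + norm (h *\<^sub>R (v t x - v t (X q' t))) + norm (X q' (t + h) - X q' t - h *\<^sub>R v t (X q' t))"
        unfolding P_def by (simp only: norm_minus_plus_le)
      also have "\<dots> \<le> D' + \<bar>h\<bar> * (L * P) + \<bar>h\<bar> * \<omega>"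
        using lin[OF q'(1) th h] vq' q'(2) by (intro add_mono) (auto intro: mult_left_mono)
      finally have P1: "P \<le> D' + \<bar>h\<bar> * (L * P + \<omega>)" by (simp add: algebra_simps)
      have "\<bar>h\<bar> * ((L + 1) * C) \<le> \<omega>"
        using h h0(4) C e0(2) by (simp add: pos_le_divide_eq[symmetric])
      moreover have "\<bar>h\<bar> * (L * C) \<le> \<bar>h\<bar> * ((L + 1) * C)" using C by (intro mult_left_mono mult_right_mono) auto
      ultimately have "L * (\<bar>h\<bar> * C) \<le> \<omega>" by (simp add: algebra_simps)
      moreover have "L * P \<le> L * (D + \<bar>h\<bar> * C)" using PD e0(2) by (rule mult_left_mono)
      ultimately have "L * P + \<omega> \<le> L * D + e" by (simp add: \<omega>_def algebra_simps)
      then have "\<bar>h\<bar> * (L * P + \<omega>) \<le> \<bar>h\<bar> * (L * D + e)" by (intro mult_left_mono) auto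
      moreover have "D \<le> P" unfolding D_def P_def by (rule leG[OF q'(1)])
      ultimately have lo: "D \<le> D' + \<bar>h\<bar> * (L * D + e)" using P1 by linarith
      have "\<bar>h\<bar> * (L * D) + \<bar>h\<bar> * \<omega> \<le> \<bar>h\<bar> * (L * D + e)"
        using e unfolding distrib_left[symmetric] by (intro mult_left_mono) (auto simp: \<omega>_def)
      then have "\<bar>D' - D\<bar> \<le> \<bar>h\<bar> * (L * D + e)" using up lo by linarith
      then show ?thesis by (simp add: D_def D'_def x'_def)
    qed
    then show ?thesis using h0(1) by blast
  qed
  show ?thesis
    by (rule that[of \<epsilon> L]) (use e0 tubeS est in \<open>auto simp: \<epsilon>_def\<close>)
qed

lemma infdist_G_lipschitz:
  obtains M where "M \<ge> 0"
    "\<And>x s t. s \<in> {c..d} \<Longrightarrow> t \<in> {c..d} \<Longrightarrow> infdist x (G t) \<le> infdist x (G s) + M * \<bar>t - s\<bar>"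
proof -
  obtain M where M: "M \<ge> 0" "\<And>t p. (t, p) \<in> tube \<Longrightarrow> norm (v t p) \<le> M"
    "\<And>q s t. q \<in> G0 \<Longrightarrow> s \<in> {c..d} \<Longrightarrow> t \<in> {c..d} \<Longrightarrow> norm (X q t - X q s) \<le> M * \<bar>t - s\<bar>"
    by (rule flow_lipschitz) (rule that)
  have "infdist x (G t) \<le> infdist x (G s) + M * \<bar>t - s\<bar>" if st: "s \<in> {c..d}" "t \<in> {c..d}" for x s t
  proof -
    obtain q where q: "q \<in> G0" "infdist x (G s) = dist x (X q s)"
      using nearest_in_G[OF st(1)] by metis
    have "infdist x (G t) \<le> dist x (X q t)" using q(1) by (auto simp: G_def intro: infdist_le)
    also have "\<dots> \<le> dist x (X q s) + dist (X q s) (X q t)" by (rule dist_triangle)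
    also have "dist (X q s) (X q t) \<le> M * \<bar>t - s\<bar>" using M(3)[OF q(1) st] by (simp add: dist_norm norm_minus_commute)
    finally show ?thesis using q(2) by simp
  qed
  then show ?thesis using that M(1) by blast
qed

end

section \<open>Test functions concentrated on a moving set\<close>

definition pos_part :: "real \<Rightarrow> real" where "pos_part u = max 0 u"

text \<open>The square of the positive part has the Lipschitz derivative
  \<open>2 * pos_part u\<close>, so its Taylor remainder is quadratic even across 0.\<close>

lemma pos_part_sq_estimate: "\<bar>(pos_part (u + h))\<^sup>2 - (pos_part u)\<^sup>2 - h * (2 * pos_part u)\<bar> \<le> h\<^sup>2"
proof -
  consider "u \<le> 0" "u + h \<le> 0" | "u \<le> 0" "u + h > 0" | "u > 0" "u + h \<ge> 0" | "u > 0" "u + h < 0" by linarith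
  then show ?thesis
  proof cases
    case 2
    then have "(u + h)\<^sup>2 \<le> h\<^sup>2" by (intro power_mono) auto
    then show ?thesis using 2 by (simp add: pos_part_def)
  next
    case 3
    then show ?thesis by (simp add: pos_part_def power2_eq_square algebra_simps)
  next
    case 4
    have "u * (u + 2 * h) \<le> u * h" using 4 by (intro mult_left_mono) auto
    moreover have "u * h \<le> 0" using 4 by (intro mult_nonneg_nonpos) auto
    moreover have "0 \<le> (u + h)\<^sup>2" by simp
    ultimately have "\<bar>u * (u + 2 * h)\<bar> \<le> h\<^sup>2" unfolding power2_eq_square by (simp add: algebra_simps)
    then show ?thesis using 4 by (simp add: pos_part_def power2_eq_square algebra_simps abs_minus_commute)
  qed (auto simp: pos_part_def)
qed

text \<open>A quadratic spline rising from 0 to 1 on \<open>[0, 1]\<close>, and its derivative, the hat function of height 2.\<close>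

definition smooth_step :: "real \<Rightarrow> real" where
  "smooth_step u = 2 * ((pos_part u)\<^sup>2 - 2 * (pos_part (u - 1/2))\<^sup>2 + (pos_part (u - 1))\<^sup>2)"

definition hat :: "real \<Rightarrow> real" where
  "hat u = 4 * (pos_part u - 2 * pos_part (u - 1/2) + pos_part (u - 1))"

text \<open>An explicit remainder, uniform in \<open>u\<close>, is what difference-quotient bounds
  on a whole set call for. The 8 is the sum 2 + 4 + 2 of the moduli of the coefficients.\<close>

lemma smooth_step_estimate: "\<bar>smooth_step (u + h) - smooth_step u - h * hat u\<bar> \<le> 8 * h\<^sup>2"
proof -
  have eq: "smooth_step (u + h) - smooth_step u - h * hat u =
    2 * ((pos_part (u + h))\<^sup>2 - (pos_part u)\<^sup>2 - h * (2 * pos_part u))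
    - 4 * ((pos_part (u - 1/2 + h))\<^sup>2 - (pos_part (u - 1/2))\<^sup>2 - h * (2 * pos_part (u - 1/2)))
    + 2 * ((pos_part (u - 1 + h))\<^sup>2 - (pos_part (u - 1))\<^sup>2 - h * (2 * pos_part (u - 1)))"
    unfolding smooth_step_def hat_def by (simp add: algebra_simps)
  have "\<bar>2 * a - 4 * b + 2 * c'\<bar> \<le> 8 * k" if "\<bar>a\<bar> \<le> k" "\<bar>b\<bar> \<le> k" "\<bar>c'\<bar> \<le> k" for a b c' k :: real
    using that by linarith
  then show ?thesis unfolding eq using pos_part_sq_estimate by blast
qed

lemma smooth_step_derivative: "(smooth_step has_real_derivative hat u) (at u)"
  unfolding DERIV_def
proof (rule Lim_null_comparison[THEN LIM_zero_cancel])
  have "\<forall>h. h \<noteq> 0 \<longrightarrow> norm ((smooth_step (u + h) - smooth_step u) / h - hat u) \<le> 8 * \<bar>h\<bar>"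
  proof (intro allI impI)
    fix h :: real assume h: "h \<noteq> 0"
    have "(smooth_step (u + h) - smooth_step u) / h - hat u = (smooth_step (u + h) - smooth_step u - h * hat u) / h"
      using h by (simp add: field_simps)
    then have "norm ((smooth_step (u + h) - smooth_step u) / h - hat u) = \<bar>smooth_step (u + h) - smooth_step u - h * hat u\<bar> / \<bar>h\<bar>"
      by simp
    also have "\<dots> \<le> 8 * h\<^sup>2 / \<bar>h\<bar>" by (intro divide_right_mono smooth_step_estimate) simp
    also have "\<dots> = 8 * \<bar>h\<bar>" using h by (simp add: power2_eq_square abs_if)
    finally show "norm ((smooth_step (u + h) - smooth_step u) / h - hat u) \<le> 8 * \<bar>h\<bar>" .
  qed
  then show "\<forall>\<^sub>F h in at 0. norm ((smooth_step (u + h) - smooth_step u) / h - hat u) \<le> 8 * \<bar>h\<bar>"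
    by (auto simp: eventually_at_filter)
  show "((\<lambda>h::real. 8 * \<bar>h\<bar>) \<longlongrightarrow> 0) (at 0)" by (auto intro!: tendsto_eq_intros)
qed

lemma hat_nonneg: "hat u \<ge> 0"
  and hat_eq_0: "u \<le> 0 \<or> u \<ge> 1 \<Longrightarrow> hat u = 0"
  and smooth_step_0: "u \<le> 0 \<Longrightarrow> smooth_step u = 0"
  and smooth_step_1: "u \<ge> 1 \<Longrightarrow> smooth_step u = 1"
  by (auto simp: hat_def smooth_step_def pos_part_def max_def power2_eq_square algebra_simps)

lemma continuous_on_hat: "continuous_on A hat"
  unfolding hat_def pos_part_def by (intro continuous_intros)

lemma smooth_step_mono: "u \<le> w \<Longrightarrow> smooth_step u \<le> smooth_step w"
  by (rule DERIV_nonneg_imp_nondecreasing) (use smooth_step_derivative hat_nonneg in blast)+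

lemma smooth_step_bounds: "0 \<le> smooth_step u" "smooth_step u \<le> 1"
proof -
  show "0 \<le> smooth_step u"
    using smooth_step_mono[of "min u 0" u] smooth_step_0[of "min u 0"] by simp
  show "smooth_step u \<le> 1"
    using smooth_step_mono[of u "max u 1"] smooth_step_1[of "max u 1"] by simp
qed

lemma hat_le: "hat u \<le> 2"
  by (auto simp: hat_def pos_part_def max_def)

lemma smooth_step_lipschitz: "\<bar>smooth_step u - smooth_step w\<bar> \<le> 2 * \<bar>u - w\<bar>"
proof -
  have "norm (smooth_step u - smooth_step w) \<le> 2 * norm (u - w)"
    by (rule field_differentiable_bound[of UNIV _ hat])
      (use smooth_step_derivative hat_nonneg hat_le in \<open>auto\<close>)
  then show ?thesis by simp
qed

text \<open>From here on the moving set enters through its distance function: this is Lipschitz in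
  time, and its rate along the field is bounded by a multiple of itself. The flow has served to
  prove these facts and the compactness of the tube.\<close>

locale moving_window =
  fixes S :: "(real \<times> 'a::euclidean_space) set" and v :: "real \<Rightarrow> 'a \<Rightarrow> 'a"
    and c d :: real and G :: "real \<Rightarrow> 'a set" and \<epsilon> L M :: real
  assumes cont_v: "continuous_on S (\<lambda>(t, x). v t x)" and cd: "c < d"
    and tube: "compact {(t, x). t \<in> {c..d} \<and> x \<in> G t}"
    and G: "\<And>t. t \<in> {c..d} \<Longrightarrow> closed (G t)" "\<And>t. t \<in> {c..d} \<Longrightarrow> G t \<noteq> {}"
    and \<epsilon>: "\<epsilon> > 0" and L: "L \<ge> 0" and M: "M \<ge> 0"
    and nbhd: "\<And>t x. t \<in> {c..d} \<Longrightarrow> infdist x (G t) \<le> \<epsilon> \<Longrightarrow> (t, x) \<in> S"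
    and along: "\<And>e. e > 0 \<Longrightarrow> \<exists>h0>0. \<forall>t x h. t \<in> {c..d} \<and> t + h \<in> {c..d} \<and> infdist x (G t) \<le> \<epsilon> \<and> \<bar>h\<bar> < h0 \<longrightarrow>
       \<bar>infdist (x + h *\<^sub>R v t x) (G (t + h)) - infdist x (G t)\<bar> \<le> \<bar>h\<bar> * (L * infdist x (G t) + e)"
    and lip: "\<And>x s t. s \<in> {c..d} \<Longrightarrow> t \<in> {c..d} \<Longrightarrow> infdist x (G t) \<le> infdist x (G s) + M * \<bar>t - s\<bar>"
begin

text \<open>Freezing the set outside \<open>[c, d]\<close> makes the distance to it Lipschitz in space and all of time.\<close>

definition clamp :: "real \<Rightarrow> real" where "clamp t = max c (min d t)"

lemma clamp_in: "clamp t \<in> {c..d}" using cd by (auto simp: clamp_def)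
lemma clamp_eq: "t \<in> {c..d} \<Longrightarrow> clamp t = t" by (auto simp: clamp_def)
lemma clamp_dist: "\<bar>clamp t - clamp s\<bar> \<le> \<bar>t - s\<bar>" by (auto simp: clamp_def max_def min_def)

definition D :: "real \<times> 'a \<Rightarrow> real" where "D z = infdist (snd z) (G (clamp (fst z)))"

lemma D_nonneg: "D z \<ge> 0" by (simp add: D_def infdist_nonneg)

lemma D_lipschitz: "\<bar>D (t, x) - D (s, y)\<bar> \<le> M * \<bar>t - s\<bar> + dist x y"
proof -
  have half: "D (t, x) \<le> D (s, y) + (M * \<bar>t - s\<bar> + dist x y)" for t x s y
  proof -
    have "D (t, x) \<le> infdist x (G (clamp s)) + M * \<bar>clamp t - clamp s\<bar>"
      unfolding D_def using lip[OF clamp_in clamp_in] by simp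
    also have "\<dots> \<le> infdist y (G (clamp s)) + dist x y + M * \<bar>t - s\<bar>"
      using infdist_triangle[of x "G (clamp s)" y] mult_left_mono[OF clamp_dist M, of t s] by linarith
    finally show ?thesis by (simp add: D_def)
  qed
  from half[of t x s y] half[of s y t x] show ?thesis by (simp add: abs_le_iff dist_commute abs_minus_commute)
qed

lemma D_lipschitz_dist: "\<bar>D z - D w\<bar> \<le> (M + 1) * dist z w"
proof -
  have "\<bar>D z - D w\<bar> \<le> M * dist (fst z) (fst w) + dist (snd z) (snd w)"
    using D_lipschitz[of "fst z" "snd z" "fst w" "snd w"] by (simp add: dist_real_def)
  also have "\<dots> \<le> M * dist z w + dist z w"
    by (intro add_mono mult_left_mono dist_fst_le dist_snd_le M)
  finally show ?thesis by (simp add: algebra_simps)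
qed

lemma continuous_on_D: "continuous_on A D"
proof -
  have "(M + 1)-lipschitz_on A D"
    using D_lipschitz_dist M by (intro lipschitz_onI) (auto simp: dist_real_def)
  then show ?thesis by (rule lipschitz_on_continuous_on)
qed

definition slab :: "real \<Rightarrow> real \<Rightarrow> real \<Rightarrow> (real \<times> 'a) set" where
  "slab c' d' r = {z. fst z \<in> {c'..d'} \<and> D z \<le> r}"

lemma compact_slab: "c \<le> c' \<Longrightarrow> d' \<le> d \<Longrightarrow> compact (slab c' d' r)"
proof -
  assume c': "c \<le> c'" "d' \<le> d"
  have "closed (slab c' d' r)"
  proof -
    have "slab c' d' r = {z. c' \<le> fst z} \<inter> {z. fst z \<le> d'} \<inter> {z. D z \<le> r}"
      by (auto simp: slab_def)
    then show ?thesis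
      by (auto intro!: closed_Int closed_Collect_le continuous_intros continuous_on_D)
  qed
  \<comment> \<open>A point of the slab differs from a nearest point of \<open>G t\<close> by a
    purely spatial vector of length at most \<open>r\<close>, so the slab lies in a Minkowski sum of
    compact sets.\<close>
  moreover have "slab c' d' r \<subseteq> {y + z |y z. y \<in> {(t, x). t \<in> {c..d} \<and> x \<in> G t} \<and> z \<in> cball 0 r}"
  proof clarify
    fix t x assume "(t, x) \<in> slab c' d' r"
    then have t: "t \<in> {c..d}" and r: "infdist x (G t) \<le> r"
      using c' by (auto simp: slab_def D_def clamp_eq)
    obtain y where "y \<in> G t" "infdist x (G t) = dist x y"
      using infdist_attains_inf[OF G[OF t]] by blast
    then have "(t, x) = (t, y) + (0, x - y)" "(t, y) \<in> {(t, x). t \<in> {c..d} \<and> x \<in> G t}" "(0::real, x - y) \<in> cball 0 r"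
      using t r unfolding mem_cball_0 norm_Pair by (auto simp: dist_norm)
    then show "\<exists>y z. (t, x) = y + z \<and> y \<in> {(t, x). t \<in> {c..d} \<and> x \<in> G t} \<and> z \<in> cball 0 r" by blast
  qed
  moreover have "compact {y + z |y z. y \<in> {(t, x). t \<in> {c..d} \<and> x \<in> G t} \<and> z \<in> cball (0::real \<times> 'a) r}"
    by (rule compact_sums[OF tube compact_cball])
  ultimately show ?thesis
    by (meson bounded_subset compact_eq_bounded_closed)
qed

definition N :: "(real \<times> 'a) set" where "N = slab c d \<epsilon>"

lemma compact_N: "compact N" unfolding N_def by (rule compact_slab) auto

lemma N_subset: "N \<subseteq> S"
  using nbhd by (auto simp: N_def slab_def D_def clamp_eq)

definition V :: "real \<times> 'a \<Rightarrow> real \<times> 'a" where "V z = (1, v (fst z) (snd z))"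

lemma continuous_on_V: "A \<subseteq> S \<Longrightarrow> continuous_on A V"
  unfolding V_def using continuous_on_subset[OF cont_v] by (auto simp: split_beta intro!: continuous_intros)

section \<open>Cutoffs in space and time\<close>

definition space_cutoff :: "real \<Rightarrow> real \<times> 'a \<Rightarrow> real" where
  "space_cutoff m z = pos_part (1 - m * D z)"

text \<open>Where the cutoff is positive, \<open>u = m * D z\<close> is below 1 and the rate along
  the field is at most \<open>L * u\<close>. The tent that follows \<open>u\<close> up to 1 and
  returns to 0 at 2 is a continuous majorant, as the mollification lemma requires of its error
  function; stopping at \<open>u = 1\<close> would make a jump.\<close>

definition field_error :: "real \<Rightarrow> real \<times> 'a \<Rightarrow> real" where
  "field_error m z = L * pos_part (min (m * D z) (2 - m * D z))"

text \<open>Both ramps, \<open>[\<sigma>, \<sigma> + \<delta>]\<close> and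
  \<open>[\<tau>, \<tau> + \<delta>]\<close>, lie to the right of their base points, so the limit
  for small \<delta> is the indicator of a half-open interval that omits \<sigma> and contains
  \<tau>.\<close>

definition time_cutoff :: "real \<Rightarrow> real \<Rightarrow> real \<Rightarrow> real \<Rightarrow> real" where
  "time_cutoff \<sigma> \<tau> \<delta> t = smooth_step ((t - \<sigma>) / \<delta>) - smooth_step ((t - \<tau>) / \<delta>)"

definition time_cutoff' :: "real \<Rightarrow> real \<Rightarrow> real \<Rightarrow> real \<Rightarrow> real" where
  "time_cutoff' \<sigma> \<tau> \<delta> t = hat ((t - \<sigma>) / \<delta>) / \<delta> - hat ((t - \<tau>) / \<delta>) / \<delta>"

lemma space_cutoff_bounds: "m \<ge> 0 \<Longrightarrow> 0 \<le> space_cutoff m z" "m \<ge> 0 \<Longrightarrow> space_cutoff m z \<le> 1"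
  using mult_nonneg_nonneg[OF _ D_nonneg, of m z] by (auto simp: space_cutoff_def pos_part_def)

lemma space_cutoff_eq_0: "m > 0 \<Longrightarrow> D z \<ge> 1 / m \<Longrightarrow> space_cutoff m z = 0"
  by (simp add: space_cutoff_def pos_part_def field_simps)

lemma space_cutoff_lipschitz: "m \<ge> 0 \<Longrightarrow> \<bar>space_cutoff m z - space_cutoff m w\<bar> \<le> m * \<bar>D z - D w\<bar>"
proof -
  assume m: "m \<ge> 0"
  have "\<bar>space_cutoff m z - space_cutoff m w\<bar> \<le> \<bar>(1 - m * D z) - (1 - m * D w)\<bar>"
    unfolding space_cutoff_def pos_part_def by linarith
  also have "(1 - m * D z) - (1 - m * D w) = m * (D w - D z)" by (simp add: algebra_simps)
  also have "\<bar>\<dots>\<bar> = m * \<bar>D z - D w\<bar>" using m by (simp add: abs_mult abs_minus_commute)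
  finally show ?thesis .
qed

lemma time_cutoff_bounds:
  assumes "\<sigma> \<le> \<tau>" "\<delta> > 0"
  shows "0 \<le> time_cutoff \<sigma> \<tau> \<delta> t" "time_cutoff \<sigma> \<tau> \<delta> t \<le> 1"
proof -
  have "smooth_step ((t - \<tau>) / \<delta>) \<le> smooth_step ((t - \<sigma>) / \<delta>)"
    using assms by (intro smooth_step_mono divide_right_mono) auto
  then show "0 \<le> time_cutoff \<sigma> \<tau> \<delta> t" by (simp add: time_cutoff_def)
  show "time_cutoff \<sigma> \<tau> \<delta> t \<le> 1"
    using smooth_step_bounds[of "(t - \<sigma>) / \<delta>"] smooth_step_bounds[of "(t - \<tau>) / \<delta>"] by (simp add: time_cutoff_def)
qed

lemma time_cutoff_eq_0:
  assumes "\<sigma> \<le> \<tau>" "\<delta> > 0" "t \<le> \<sigma> \<or> t \<ge> \<tau> + \<delta>"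
  shows "time_cutoff \<sigma> \<tau> \<delta> t = 0" "time_cutoff' \<sigma> \<tau> \<delta> t = 0"
proof -
  consider "t \<le> \<sigma>" | "t \<ge> \<tau> + \<delta>" using assms by blast
  then show "time_cutoff \<sigma> \<tau> \<delta> t = 0" "time_cutoff' \<sigma> \<tau> \<delta> t = 0"
    using assms(1,2) by (cases; simp add: time_cutoff_def time_cutoff'_def smooth_step_0 smooth_step_1 hat_eq_0 divide_le_0_iff le_divide_eq)+
qed

lemma time_cutoff_lipschitz:
  assumes "\<delta> > 0"
  shows "\<bar>time_cutoff \<sigma> \<tau> \<delta> t - time_cutoff \<sigma> \<tau> \<delta> s\<bar> \<le> (4 / \<delta>) * \<bar>t - s\<bar>"
proof -
  have "\<bar>smooth_step ((t - r) / \<delta>) - smooth_step ((s - r) / \<delta>)\<bar> \<le> (2 / \<delta>) * \<bar>t - s\<bar>" for r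
  proof -
    have "(t - r) / \<delta> - (s - r) / \<delta> = (t - s) / \<delta>" using assms by (simp add: field_simps)
    then show ?thesis using smooth_step_lipschitz[of "(t - r) / \<delta>" "(s - r) / \<delta>"] assms by simp
  qed
  from this[of \<sigma>] this[of \<tau>] have "\<bar>time_cutoff \<sigma> \<tau> \<delta> t - time_cutoff \<sigma> \<tau> \<delta> s\<bar> \<le> (2 / \<delta>) * \<bar>t - s\<bar> + (2 / \<delta>) * \<bar>t - s\<bar>"
    unfolding time_cutoff_def by linarith
  then show ?thesis by simp
qed

lemma time_cutoff_estimate:
  assumes "\<delta> > 0"
  shows "\<bar>time_cutoff \<sigma> \<tau> \<delta> (t + h) - time_cutoff \<sigma> \<tau> \<delta> t - h * time_cutoff' \<sigma> \<tau> \<delta> t\<bar> \<le> (16 / \<delta>\<^sup>2) * h\<^sup>2"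
proof -
  have "\<bar>smooth_step ((t + h - r) / \<delta>) - smooth_step ((t - r) / \<delta>) - h * (hat ((t - r) / \<delta>) / \<delta>)\<bar> \<le> (8 / \<delta>\<^sup>2) * h\<^sup>2" for r
  proof -
    have "(t + h - r) / \<delta> = (t - r) / \<delta> + h / \<delta>" using assms by (simp add: field_simps)
    then show ?thesis using smooth_step_estimate[of "(t - r) / \<delta>" "h / \<delta>"] by (simp add: power_divide)
  qed
  moreover have "\<bar>(p - q) - (p' - q') - (x - y)\<bar> \<le> k + k"
    if "\<bar>p - p' - x\<bar> \<le> k" "\<bar>q - q' - y\<bar> \<le> k" for p q p' q' x y k :: real
    using that by linarith
  ultimately
  have *: "\<bar>time_cutoff \<sigma> \<tau> \<delta> (t + h) - time_cutoff \<sigma> \<tau> \<delta> t - h * time_cutoff' \<sigma> \<tau> \<delta> t\<bar> \<le> (8 / \<delta>\<^sup>2) * h\<^sup>2 + (8 / \<delta>\<^sup>2) * h\<^sup>2"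
    unfolding time_cutoff_def time_cutoff'_def right_diff_distrib by blast
  show ?thesis using * by simp
qed

text \<open>Multiplication by \<open>m\<close> turns the rate of the distance into
  \<open>L * u + e\<close> with \<open>u = m * D (t, x)\<close>, which settles the points with
  \<open>u\<close> at most 1. Beyond them the cutoff changes only if \<open>u\<close> drops below 1
  within the time |h|, and the descending half of the tent pays for that.\<close>

lemma space_cutoff_along_field:
  assumes m: "m \<ge> 1" and e: "e > 0"
  obtains h0 where "h0 > 0" "\<And>t x h. t \<in> {c..d} \<Longrightarrow> t + h \<in> {c..d} \<Longrightarrow> D (t, x) \<le> \<epsilon> \<Longrightarrow> \<bar>h\<bar> < h0 \<Longrightarrow>
     \<bar>space_cutoff m ((t, x) + h *\<^sub>R V (t, x)) - space_cutoff m (t, x)\<bar> \<le> \<bar>h\<bar> * (field_error m (t, x) + e)"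
proof -
  have "e / m > 0" using m e by simp
  from along[OF this] obtain h1 where h1': "h1 > 0" "\<forall>t x h. t \<in> {c..d} \<and> t + h \<in> {c..d} \<and> infdist x (G t) \<le> \<epsilon> \<and> \<bar>h\<bar> < h1 \<longrightarrow>
       \<bar>infdist (x + h *\<^sub>R v t x) (G (t + h)) - infdist x (G t)\<bar> \<le> \<bar>h\<bar> * (L * infdist x (G t) + e / m)"
    by blast
  then have h1: "h1 > 0" "\<And>t x h. t \<in> {c..d} \<Longrightarrow> t + h \<in> {c..d} \<Longrightarrow> infdist x (G t) \<le> \<epsilon> \<Longrightarrow> \<bar>h\<bar> < h1 \<Longrightarrow>
       \<bar>infdist (x + h *\<^sub>R v t x) (G (t + h)) - infdist x (G t)\<bar> \<le> \<bar>h\<bar> * (L * infdist x (G t) + e / m)"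
    by blast+
  \<comment> \<open>The second bound gives \<open>2 * k \<le> 1\<close> for
    \<open>k = \<bar>h\<bar> * L\<close>. For \<open>u\<close> between 1 and 2 the estimate
    \<open>1 - u + k * u \<le> k * (2 - u)\<close> is then just the nonnegativity of (u - 1)(1 -
    2k).\<close>
  define h0 where "h0 = min h1 (1 / (2 * L + 1))"
  show ?thesis
  proof (rule that[of h0])
    show "h0 > 0" using h1(1) L by (simp add: h0_def add_nonneg_pos)
    fix t x h assume th: "t \<in> {c..d}" "t + h \<in> {c..d}" and x: "D (t, x) \<le> \<epsilon>" and h: "\<bar>h\<bar> < h0"
    define u where "u = m * D (t, x)"
    define u' where "u' = m * D ((t, x) + h *\<^sub>R V (t, x))"
    have Dt: "D (t, x) = infdist x (G t)" using th by (simp add: D_def clamp_eq)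
    have Dth: "D ((t, x) + h *\<^sub>R V (t, x)) = infdist (x + h *\<^sub>R v t x) (G (t + h))"
      using th by (simp add: D_def clamp_eq V_def)
    have "\<bar>D ((t, x) + h *\<^sub>R V (t, x)) - D (t, x)\<bar> \<le> \<bar>h\<bar> * (L * D (t, x) + e / m)"
      using h1(2)[OF th] x h unfolding Dt Dth by (simp add: h0_def)
    then have "m * \<bar>D ((t, x) + h *\<^sub>R V (t, x)) - D (t, x)\<bar> \<le> m * (\<bar>h\<bar> * (L * D (t, x) + e / m))"
      using m by (intro mult_left_mono) auto
    moreover have "\<bar>u' - u\<bar> = m * \<bar>D ((t, x) + h *\<^sub>R V (t, x)) - D (t, x)\<bar>"
      using m unfolding u_def u'_def by (simp add: right_diff_distrib[symmetric] abs_mult)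
    moreover have "m * (\<bar>h\<bar> * (L * D (t, x) + e / m)) = \<bar>h\<bar> * (L * u) + \<bar>h\<bar> * e"
      using m by (simp add: u_def algebra_simps)
    ultimately have uu: "\<bar>u' - u\<bar> \<le> \<bar>h\<bar> * (L * u) + \<bar>h\<bar> * e" by simp
    have u0: "u \<ge> 0" using m D_nonneg by (simp add: u_def)
    have he: "0 \<le> \<bar>h\<bar> * e" using e by simp
    define k where "k = \<bar>h\<bar> * L"
    have "\<bar>h\<bar> * (2 * L + 1) \<le> 1" using h L by (simp add: h0_def pos_less_divide_eq add_nonneg_pos)
    then have k: "0 \<le> k" "2 * k \<le> 1" using L abs_ge_zero[of h] by (auto simp: k_def algebra_simps)
    have uu': "\<bar>u' - u\<bar> \<le> k * u + \<bar>h\<bar> * e" using uu by (simp add: k_def)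
    have "\<bar>pos_part (1 - u') - pos_part (1 - u)\<bar> \<le> k * pos_part (min u (2 - u)) + \<bar>h\<bar> * e"
    proof -
      consider "u \<le> 1" | "1 < u" "u \<le> 2" | "u > 2" by linarith
      then show ?thesis
      proof cases
        case 1
        then have "pos_part (min u (2 - u)) = u" using u0 by (simp add: pos_part_def)
        then show ?thesis using uu' unfolding pos_part_def by linarith
      next
        case 2
        then have p: "pos_part (min u (2 - u)) = 2 - u" by (simp add: pos_part_def)
        have "k * (2 * (u - 1)) \<le> 1 / 2 * (2 * (u - 1))" using k 2 by (intro mult_right_mono) auto
        then have "1 - u + k * u \<le> k * (2 - u)" by (simp add: algebra_simps)
        then have "1 - u' \<le> k * (2 - u) + \<bar>h\<bar> * e" using uu' by linarith
        moreover have "0 \<le> k * (2 - u) + \<bar>h\<bar> * e" using k 2 he by simp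
        ultimately show ?thesis using 2 unfolding p pos_part_def by (simp add: max_def)
      next
        case 3
        then have p: "pos_part (min u (2 - u)) = 0" by (simp add: pos_part_def)
        have "k * u \<le> 1 / 2 * u" using k u0 by (intro mult_right_mono) auto
        then have "1 - u' \<le> \<bar>h\<bar> * e" using uu' 3 by linarith
        then show ?thesis using 3 he unfolding p pos_part_def by (simp add: max_def)
      qed
    qed
    then show "\<bar>space_cutoff m ((t, x) + h *\<^sub>R V (t, x)) - space_cutoff m (t, x)\<bar> \<le> \<bar>h\<bar> * (field_error m (t, x) + e)"
      unfolding space_cutoff_def field_error_def u_def[symmetric] u'_def[symmetric]
      by (simp add: k_def algebra_simps)
  qed
qed

lemma continuous_on_space_cutoff: "continuous_on A (space_cutoff m)"
  unfolding space_cutoff_def pos_part_def by (intro continuous_intros continuous_on_D)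

lemma continuous_on_field_error: "continuous_on A (field_error m)"
  unfolding field_error_def pos_part_def by (intro continuous_intros continuous_on_D)

lemma continuous_on_time_cutoff': "\<delta> > 0 \<Longrightarrow> continuous_on A (\<lambda>z. time_cutoff' \<sigma> \<tau> \<delta> (fst z))"
  unfolding time_cutoff'_def
  by (auto intro!: continuous_intros continuous_on_compose2[OF continuous_on_hat[of UNIV]])

lemma field_error_nonneg: "field_error m z \<ge> 0"
  using L by (simp add: field_error_def pos_part_def)

text \<open>Along the field, the time factor of the product of the two cutoffs contributes the main
  term and the space factor only the error \<open>field_error\<close>;
  \<open>smooth_approximation_along_field\<close> makes a test function of the product.\<close>

lemma ex_tube_test_function:
  assumes st: "c < \<sigma>" "\<sigma> \<le> \<tau>" and \<delta>: "\<delta> > 0" "\<tau> + \<delta> < d" and m: "m \<ge> 1" "2 / m \<le> \<epsilon>" and e: "e > 0"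
  obtains \<phi> where "test_function S \<phi>"
    "\<And>z. \<bar>\<phi> z - time_cutoff \<sigma> \<tau> \<delta> (fst z) * space_cutoff m z\<bar> \<le> e"
    "\<And>z. \<bar>frechet_derivative \<phi> (at z) (V z) - time_cutoff' \<sigma> \<tau> \<delta> (fst z) * space_cutoff m z\<bar> \<le> field_error m z + e"
    "\<And>z. z \<notin> N \<Longrightarrow> \<phi> z = 0"
    "\<And>z h. z \<notin> N \<Longrightarrow> frechet_derivative \<phi> (at z) h = 0"
proof -
  define \<theta> where "\<theta> z = time_cutoff \<sigma> \<tau> \<delta> (fst z) * space_cutoff m z" for z
  define \<alpha> where "\<alpha> z = time_cutoff' \<sigma> \<tau> \<delta> (fst z) * space_cutoff m z" for z
  define K where "K = slab \<sigma> (\<tau> + \<delta>) (1 / m)"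
  \<comment> \<open>The room around the support \<open>K\<close>: at most half of the distance to
    \<open>c\<close> and \<open>d\<close>, so that \<open>t + h\<close> stays in the window for
    points of \<open>N'\<close> and |h| below \<rho>, and so small that \<open>D\<close> grows by at
    most \<open>1 / m\<close>, that is, up to \<open>2 / m\<close>.\<close>
  define \<rho> where "\<rho> = Min {(\<sigma> - c) / 2, (d - (\<tau> + \<delta>)) / 2, 1 / (m * (M + 1))}"
  define N' where "N' = slab (\<sigma> - \<rho>) (\<tau> + \<delta> + \<rho>) (2 / m)"
  have "(\<sigma> - c) / 2 > 0" "(d - (\<tau> + \<delta>)) / 2 > 0" "1 / (m * (M + 1)) > 0"
    using st \<delta> m M by (auto intro!: mult_pos_pos)
  then have \<rho>: "\<rho> > 0" "\<rho> \<le> (\<sigma> - c) / 2" "\<rho> \<le> (d - (\<tau> + \<delta>)) / 2" "\<rho> \<le> 1 / (m * (M + 1))"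
    unfolding \<rho>_def by (simp_all only: Min_gr_iff Min_le finite.intros insert_not_empty insert_iff simp_thms) auto
  have m0: "m > 0" "m \<ge> 0" using m by auto
  have mM: "(M + 1) * \<rho> \<le> 1 / m"
  proof -
    have "(M + 1) * \<rho> \<le> (M + 1) * (1 / (m * (M + 1)))" using \<rho>(4) M by (intro mult_left_mono) auto
    also have "\<dots> = 1 / m" using M m0 by (simp add: field_simps add_nonneg_eq_0_iff)
    finally show ?thesis .
  qed
  have N'_compact: "compact N'" unfolding N'_def using \<rho> st \<delta> by (intro compact_slab) auto
  have N'N: "N' \<subseteq> N" using \<rho> st \<delta> m by (auto simp: N'_def N_def slab_def)
  have K_compact: "compact K" unfolding K_def using st \<delta> by (intro compact_slab) auto
  have K0: "\<theta> z = 0" "\<alpha> z = 0" if "z \<notin> K" for z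
  proof -
    have "fst z \<le> \<sigma> \<or> fst z \<ge> \<tau> + \<delta> \<or> D z \<ge> 1 / m" using that by (auto simp: K_def slab_def)
    then show "\<theta> z = 0" "\<alpha> z = 0"
      using time_cutoff_eq_0[OF st(2) \<delta>(1), of "fst z"] space_cutoff_eq_0[OF m0(1), of z]
      by (auto simp: \<theta>_def \<alpha>_def)
  qed
  have KN': "x \<in> N'" if "y \<in> K" "dist x y \<le> \<rho>" for x y
  proof -
    have "dist (fst x) (fst y) \<le> \<rho>" using dist_fst_le[of x y] that by simp
    moreover have "D x \<le> D y + 1 / m"
    proof -
      have "(M + 1) * dist x y \<le> (M + 1) * \<rho>" using that M by (intro mult_left_mono) auto
      then show ?thesis using D_lipschitz_dist[of x y] mM by linarith
    qed
    ultimately show ?thesis using that by (auto simp: K_def N'_def slab_def dist_real_def field_simps)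
  qed
  have lip\<theta>: "(m * (M + 1) + 4 / \<delta>)-lipschitz_on UNIV \<theta>"
  proof (rule lipschitz_onI)
    fix z w :: "real \<times> 'a"
    let ?t = "\<lambda>z. time_cutoff \<sigma> \<tau> \<delta> (fst z)" and ?s = "space_cutoff m"
    have "\<theta> z - \<theta> w = ?t z * (?s z - ?s w) + (?t z - ?t w) * ?s w" by (simp add: \<theta>_def algebra_simps)
    then have "\<bar>\<theta> z - \<theta> w\<bar> \<le> \<bar>?t z\<bar> * \<bar>?s z - ?s w\<bar> + \<bar>?t z - ?t w\<bar> * \<bar>?s w\<bar>"
      by (metis abs_mult abs_triangle_ineq)
    also have "\<dots> \<le> 1 * (m * ((M + 1) * dist z w)) + (4 / \<delta> * dist z w) * 1"
    proof (intro add_mono mult_mono)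
      show "\<bar>?s z - ?s w\<bar> \<le> m * ((M + 1) * dist z w)"
        using space_cutoff_lipschitz[OF m0(2), of z w] mult_left_mono[OF D_lipschitz_dist m0(2), of z w] by linarith
      have "(4 / \<delta>) * \<bar>fst z - fst w\<bar> \<le> 4 / \<delta> * dist z w"
        using dist_fst_le[of z w] \<delta> by (intro mult_left_mono) (auto simp: dist_real_def)
      then show "\<bar>?t z - ?t w\<bar> \<le> 4 / \<delta> * dist z w"
        using time_cutoff_lipschitz[OF \<delta>(1), of \<sigma> \<tau> "fst z" "fst w"] by linarith
    qed (use time_cutoff_bounds[OF st(2) \<delta>(1)] space_cutoff_bounds[OF m0(2)] M m0 \<delta> in auto)
    finally show "dist (\<theta> z) (\<theta> w) \<le> (m * (M + 1) + 4 / \<delta>) * dist z w"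
      by (simp add: dist_real_def algebra_simps)
  qed (use M m0 \<delta> in auto)
  have c\<alpha>: "continuous_on A \<alpha>" for A
    unfolding \<alpha>_def by (intro continuous_intros continuous_on_time_cutoff' continuous_on_space_cutoff \<delta>)
  have est: "\<exists>h0>0. \<forall>y\<in>N'. \<forall>h. 0 < \<bar>h\<bar> \<and> \<bar>h\<bar> < h0 \<longrightarrow>
       \<bar>\<theta> (y + h *\<^sub>R V y) - \<theta> y - h * \<alpha> y\<bar> \<le> \<bar>h\<bar> * (field_error m y + e')" if e': "e' > 0" for e'
  proof -
    have "e' / 2 > 0" using e' by simp
    from space_cutoff_along_field[OF m(1) this]
    obtain h1 where h1: "h1 > 0" "\<And>t x h. t \<in> {c..d} \<Longrightarrow> t + h \<in> {c..d} \<Longrightarrow> D (t, x) \<le> \<epsilon> \<Longrightarrow> \<bar>h\<bar> < h1 \<Longrightarrow>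
      \<bar>space_cutoff m ((t, x) + h *\<^sub>R V (t, x)) - space_cutoff m (t, x)\<bar> \<le> \<bar>h\<bar> * (field_error m (t, x) + e' / 2)"
      by metis
    \<comment> \<open>The last bound makes the remainder
      \<open>(16 / \<delta>\<^sup>2) * h\<^sup>2\<close> of the time cutoff at most
      \<open>\<bar>h\<bar> * (e' / 2)\<close>.\<close>
    define h0 where "h0 = min h1 (min \<rho> (e' * \<delta>\<^sup>2 / 32))"
    have h0: "h0 > 0" using h1(1) \<rho>(1) e' \<delta>(1) by (simp add: h0_def)
    have "\<bar>\<theta> (y + h *\<^sub>R V y) - \<theta> y - h * \<alpha> y\<bar> \<le> \<bar>h\<bar> * (field_error m y + e')"
      if y: "y \<in> N'" and h: "\<bar>h\<bar> < h0" for y h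
    proof -
      obtain t x where yt: "y = (t, x)" by (cases y)
      have "t \<in> {\<sigma> - \<rho>..\<tau> + \<delta> + \<rho>}" "D (t, x) \<le> \<epsilon>" using y m by (auto simp: N'_def slab_def yt)
      moreover have "\<bar>h\<bar> < \<rho>" using h by (simp add: h0_def)
      ultimately have th: "t \<in> {c..d}" "t + h \<in> {c..d}" "D (t, x) \<le> \<epsilon>"
        using \<rho> st \<delta> by auto
      let ?\<chi> = "time_cutoff \<sigma> \<tau> \<delta>"
      define s where "s = space_cutoff m y"
      define s' where "s' = space_cutoff m (y + h *\<^sub>R V y)"
      have A: "\<bar>s' - s\<bar> \<le> \<bar>h\<bar> * (field_error m y + e' / 2)"
        using h1(2)[OF th] h by (simp add: s_def s'_def yt h0_def)
      have "\<bar>h\<bar> \<le> e' * \<delta>\<^sup>2 / 32" using h by (simp add: h0_def)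
      then have "\<bar>h\<bar> * \<bar>h\<bar> \<le> \<bar>h\<bar> * (e' * \<delta>\<^sup>2 / 32)" by (intro mult_left_mono) auto
      then have "(16 / \<delta>\<^sup>2) * h\<^sup>2 \<le> (16 / \<delta>\<^sup>2) * (\<bar>h\<bar> * (e' * \<delta>\<^sup>2 / 32))"
        using \<delta>(1) by (intro mult_left_mono) (auto simp: power2_eq_square)
      also have "\<dots> = \<bar>h\<bar> * (e' / 2)" using \<delta>(1) by simp
      finally have B: "\<bar>?\<chi> (t + h) - ?\<chi> t - h * time_cutoff' \<sigma> \<tau> \<delta> t\<bar> \<le> \<bar>h\<bar> * (e' / 2)"
        using time_cutoff_estimate[OF \<delta>(1), of \<sigma> \<tau> t h] by linarith
      have fy: "fst (y + h *\<^sub>R V y) = t + h" by (simp add: yt V_def)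
      have "\<theta> (y + h *\<^sub>R V y) = ?\<chi> (t + h) * s'" unfolding \<theta>_def s'_def fy ..
      moreover have "\<theta> y = ?\<chi> t * s" "\<alpha> y = time_cutoff' \<sigma> \<tau> \<delta> t * s" by (simp_all add: \<theta>_def \<alpha>_def s_def yt)
      \<comment> \<open>A discrete product rule: weighting the increment of the space factor by the
        time factor at the shifted time leaves two terms, each with a single estimate.\<close>
      ultimately have "\<theta> (y + h *\<^sub>R V y) - \<theta> y - h * \<alpha> y =
          ?\<chi> (t + h) * (s' - s) + (?\<chi> (t + h) - ?\<chi> t - h * time_cutoff' \<sigma> \<tau> \<delta> t) * s"
        by (simp add: algebra_simps)
      then have "\<bar>\<theta> (y + h *\<^sub>R V y) - \<theta> y - h * \<alpha> y\<bar> \<le>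
          \<bar>?\<chi> (t + h)\<bar> * \<bar>s' - s\<bar> + \<bar>?\<chi> (t + h) - ?\<chi> t - h * time_cutoff' \<sigma> \<tau> \<delta> t\<bar> * \<bar>s\<bar>"
        by (metis abs_mult abs_triangle_ineq)
      also have "\<dots> \<le> 1 * (\<bar>h\<bar> * (field_error m y + e' / 2)) + (\<bar>h\<bar> * (e' / 2)) * 1"
        using A B time_cutoff_bounds[OF st(2) \<delta>(1), of "t + h"] space_cutoff_bounds[OF m0(2), of y] e'
        by (intro add_mono mult_mono) (auto simp: s_def)
      also have "\<dots> = \<bar>h\<bar> * (field_error m y + e')" by (simp add: algebra_simps)
      finally show ?thesis .
    qed
    then show ?thesis using h0 by blast
  qed
  \<comment> \<open>With this accuracy the support of \<phi> stays within \<open>\<rho> / 4\<close>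
    of \<open>K\<close>, inside the region where the derivative is controlled; beyond it \<phi> and
    the main term both vanish.\<close>
  have e2: "min e (\<rho> / 4) > 0" using e \<rho>(1) by simp
  obtain \<phi> where \<phi>: "\<And>k. Ck_on k UNIV \<phi>" "\<And>x. \<bar>\<phi> x - \<theta> x\<bar> \<le> min e (\<rho> / 4)"
    "\<And>x. \<phi> x \<noteq> 0 \<Longrightarrow> \<exists>y\<in>K. dist x y \<le> min e (\<rho> / 4)"
    "\<And>x y. y \<in> K \<Longrightarrow> dist x y \<le> \<rho> / 2 \<Longrightarrow> \<bar>frechet_derivative \<phi> (at x) (V x) - \<alpha> x\<bar> \<le> field_error m x + min e (\<rho> / 4)"
    by (rule smooth_approximation_along_field[where C="m * (M + 1) + 4 / \<delta>" and \<theta>=\<theta> and K=K and N=N' and \<epsilon>=\<rho>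
            and V=V and \<alpha>=\<alpha> and \<beta>="field_error m" and e="min e (\<rho> / 4)"];
          (rule lip\<theta> K_compact K0 N'_compact \<rho>(1) KN' continuous_on_V[OF order_trans[OF N'N N_subset]] c\<alpha> continuous_on_field_error e2 est that; assumption))
  have cl: "closed (\<Union>y\<in>K. cball y (\<rho> / 4))"
    by (rule compact_imp_closed[OF compact_UN_cball[OF K_compact]])
  have supp: "\<phi> z = 0" if "z \<notin> (\<Union>y\<in>K. cball y (\<rho> / 4))" for z
    using \<phi>(3)[of z] that by (force simp: dist_commute)
  have D0: "frechet_derivative \<phi> (at z) h = 0" if "z \<notin> (\<Union>y\<in>K. cball y (\<rho> / 4))" for z h
    by (rule frechet_derivative_eq_0_outside[OF cl supp that])
  have subN: "(\<Union>y\<in>K. cball y (\<rho> / 4)) \<subseteq> N"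
    using KN' N'N \<rho>(1) by (fastforce simp: dist_commute)
  show ?thesis
  proof (rule that)
    show "test_function S \<phi>"
      by (rule test_functionI[OF \<phi>(1) compact_N N_subset]) (use supp subN in blast)
    show "\<bar>\<phi> z - time_cutoff \<sigma> \<tau> \<delta> (fst z) * space_cutoff m z\<bar> \<le> e" for z
      using \<phi>(2)[of z] by (simp add: \<theta>_def)
    show "\<bar>frechet_derivative \<phi> (at z) (V z) - time_cutoff' \<sigma> \<tau> \<delta> (fst z) * space_cutoff m z\<bar> \<le> field_error m z + e" for z
    proof (cases "z \<in> (\<Union>y\<in>K. cball y (\<rho> / 4))")
      case True
      then obtain y where "y \<in> K" "dist z y \<le> \<rho> / 4" by (auto simp: dist_commute)
      then show ?thesis using \<phi>(4)[of y z] \<rho>(1) by (simp add: \<alpha>_def)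
    next
      case False
      then have "z \<notin> K" using \<rho>(1) by force
      then have p0: "time_cutoff' \<sigma> \<tau> \<delta> (fst z) * space_cutoff m z = 0" using K0(2)[of z] unfolding \<alpha>_def by blast
      show ?thesis unfolding p0 D0[OF False] using field_error_nonneg[of m z] e by simp
    qed
    show "\<phi> z = 0" "frechet_derivative \<phi> (at z) h = 0" if "z \<notin> N" for z h
      using supp D0 subN that by blast+
  qed
qed

end

section \<open>Transport of integrals over a moving set\<close>

lemma set_integrable_one_compact:
  "compact (A :: 'a::euclidean_space set) \<Longrightarrow> set_integrable lebesgue A (\<lambda>x. 1::real)"
  using lmeasurable_compact[of A] by (simp add: set_integrable_def lmeasurable_iff_integrable)

lemma set_integrable_mult_continuous:
  fixes f h :: "'b::euclidean_space \<Rightarrow> real"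
  assumes f: "set_integrable lebesgue A f" and A: "compact A" and h: "continuous_on A h"
  shows "set_integrable lebesgue A (\<lambda>x. f x * h x)"
proof -
  obtain C where C: "C > 0" "\<And>x. x \<in> A \<Longrightarrow> \<bar>h x\<bar> \<le> C"
    using compact_imp_bounded[OF compact_continuous_image[OF h A]] unfolding bounded_pos by auto
  have i: "integrable lebesgue (\<lambda>x. indicator A x *\<^sub>R f x)" using f unfolding set_integrable_def .
  have "(\<lambda>x. indicator A x *\<^sub>R h x) \<in> borel_measurable borel"
    using A h by (intro borel_measurable_continuous_on_indicator) (auto simp: compact_imp_closed)
  then have m: "(\<lambda>x. indicator A x *\<^sub>R h x) \<in> borel_measurable lebesgue"
    by (intro measurable_completion) simp
  have "(\<lambda>x. (indicator A x *\<^sub>R f x) * (indicator A x *\<^sub>R h x)) \<in> borel_measurable lebesgue"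
    using i m by (intro borel_measurable_times) auto
  moreover have "(\<lambda>x. (indicator A x *\<^sub>R f x) * (indicator A x *\<^sub>R h x)) = (\<lambda>x. indicator A x *\<^sub>R (f x * h x))"
    by (auto simp: indicator_def)
  ultimately have meas: "(\<lambda>x. indicator A x *\<^sub>R (f x * h x)) \<in> borel_measurable lebesgue" by simp
  have "integrable lebesgue (\<lambda>x. C * (indicator A x *\<^sub>R f x))" using i by simp
  then show ?thesis unfolding set_integrable_def
    by (rule Bochner_Integration.integrable_bound[OF _ meas])
      (use C in \<open>auto simp: indicator_def abs_mult mult.commute[of C] intro!: mult_left_mono\<close>)
qed

lemma set_integral_mult_dominated_convergence:
  fixes f :: "'b::euclidean_space \<Rightarrow> real" and h :: "nat \<Rightarrow> 'b \<Rightarrow> real"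
  assumes f: "set_integrable lebesgue A f" and A: "compact A" and h: "\<And>k. continuous_on A (h k)"
    and C: "\<And>k x. x \<in> A \<Longrightarrow> \<bar>h k x\<bar> \<le> C" and lim: "\<And>x. x \<in> A \<Longrightarrow> (\<lambda>k. h k x) \<longlonglongrightarrow> l x"
  shows "(\<lambda>k. LINT x:A|lebesgue. f x * h k x) \<longlonglongrightarrow> (LINT x:A|lebesgue. f x * l x)"
proof -
  have i: "integrable lebesgue (\<lambda>x. indicator A x *\<^sub>R f x)" using f unfolding set_integrable_def .
  have m: "(\<lambda>x. indicator A x *\<^sub>R (f x * h k x)) \<in> borel_measurable lebesgue" for k
    using set_integrable_mult_continuous[OF f A h[of k]] unfolding set_integrable_def by auto
  have l: "(\<lambda>k. indicator A x *\<^sub>R (f x * h k x)) \<longlonglongrightarrow> indicator A x *\<^sub>R (f x * l x)" for x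
    using lim[of x] by (cases "x \<in> A") (auto intro!: tendsto_intros)
  have ml: "(\<lambda>x. indicator A x *\<^sub>R (f x * l x)) \<in> borel_measurable lebesgue"
    by (rule borel_measurable_LIMSEQ_real[OF _ m]) (rule l)
  show ?thesis
    unfolding set_lebesgue_integral_def
  proof (rule integral_dominated_convergence[OF ml m])
    show "integrable lebesgue (\<lambda>x. C * \<bar>indicator A x *\<^sub>R f x\<bar>)" using i by simp
    show "AE x in lebesgue. norm (indicator A x *\<^sub>R (f x * h k x)) \<le> C * \<bar>indicator A x *\<^sub>R f x\<bar>" for k
      using C by (intro AE_I2) (auto simp: indicator_def abs_mult mult.commute[of C] intro!: mult_left_mono)
  qed (use l in auto)
qed

lemma set_integral_mult_bound:
  fixes f h :: "'b::euclidean_space \<Rightarrow> real"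
  assumes f: "set_integrable lebesgue A f" and A: "compact A" and h: "continuous_on A h"
    and C: "\<And>x. x \<in> A \<Longrightarrow> \<bar>h x\<bar> \<le> C"
  shows "\<bar>LINT x:A|lebesgue. f x * h x\<bar> \<le> C * (LINT x:A|lebesgue. \<bar>f x\<bar>)"
proof -
  have i: "integrable lebesgue (\<lambda>x. indicator A x *\<^sub>R f x)" using f unfolding set_integrable_def .
  have j: "integrable lebesgue (\<lambda>x. indicator A x *\<^sub>R (f x * h x))"
    using set_integrable_mult_continuous[OF f A h] unfolding set_integrable_def .
  have "\<bar>LINT x:A|lebesgue. f x * h x\<bar> \<le> (LINT x|lebesgue. \<bar>indicator A x *\<^sub>R (f x * h x)\<bar>)"
    unfolding set_lebesgue_integral_def by (rule integral_abs_bound)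
  also have "\<dots> \<le> (LINT x|lebesgue. C * \<bar>indicator A x *\<^sub>R f x\<bar>)"
    by (intro integral_mono integrable_abs[OF j] integrable_mult_right[OF integrable_abs[OF i]])
      (use C in \<open>auto simp: indicator_def abs_mult mult.commute[of C] intro!: mult_left_mono\<close>)
  also have "\<dots> = C * (LINT x|lebesgue. \<bar>indicator A x *\<^sub>R f x\<bar>)" by simp
  also have "(\<lambda>x. \<bar>indicator A x *\<^sub>R f x\<bar>) = (\<lambda>x. indicator A x *\<^sub>R \<bar>f x\<bar>)" by (auto simp: indicator_def)
  finally show ?thesis unfolding set_lebesgue_integral_def .
qed

lemma set_integral_eq_on_subset:
  fixes f g :: "'b::euclidean_space \<Rightarrow> real"
  assumes "A \<subseteq> B" "\<And>x. x \<in> A \<Longrightarrow> f x = g x" "\<And>x. x \<in> B \<Longrightarrow> x \<notin> A \<Longrightarrow> g x = 0"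
  shows "(LINT x:A|lebesgue. f x) = (LINT x:B|lebesgue. g x)"
  unfolding set_lebesgue_integral_def
  by (rule Bochner_Integration.integral_cong) (use assms in \<open>auto simp: indicator_def\<close>)

text \<open>Being probability densities, the scaled hats turn the derivative of the time cutoff into
  a difference of two time averages, just after \<sigma> and just after \<tau>.\<close>

lemma scaled_hat_integral:
  fixes s \<delta> :: real
  assumes \<delta>: "\<delta> > 0"
  shows "integrable lebesgue (\<lambda>t. hat ((t - s) / \<delta>) / \<delta>)" "(LINT t|lebesgue. hat ((t - s) / \<delta>) / \<delta>) = 1"
proof -
  have d: "((\<lambda>t. smooth_step ((t - s) / \<delta>)) has_real_derivative hat ((t - s) / \<delta>) / \<delta>) (at t)" for t
  proof -
    have "((\<lambda>t. (t - s) / \<delta>) has_real_derivative 1 / \<delta>) (at t)"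
      using \<delta> by (auto intro!: derivative_eq_intros)
    from DERIV_chain2[OF smooth_step_derivative this] show ?thesis by simp
  qed
  have c: "continuous_on UNIV (\<lambda>t. hat ((t - s) / \<delta>) / \<delta>)"
    using \<delta> by (auto intro!: continuous_intros continuous_on_compose2[OF continuous_on_hat[of UNIV]])
  have z: "hat ((t - s) / \<delta>) / \<delta> * indicator {s..s + \<delta>} t = hat ((t - s) / \<delta>) / \<delta>" for t
  proof (cases "t \<in> {s..s + \<delta>}")
    case False
    then have "(t - s) / \<delta> \<le> 0 \<or> (t - s) / \<delta> \<ge> 1" using \<delta> by (auto simp: divide_le_0_iff le_divide_eq)
    then show ?thesis by (simp add: hat_eq_0)
  qed simp
  have "has_bochner_integral lborel (\<lambda>t. hat ((t - s) / \<delta>) / \<delta> * indicator {s..s + \<delta>} t)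
      (smooth_step ((s + \<delta> - s) / \<delta>) - smooth_step ((s - s) / \<delta>))"
    by (rule has_bochner_integral_FTC_Icc_real) (use \<delta> d c in \<open>auto simp: continuous_on_eq_continuous_at\<close>)
  then have b: "has_bochner_integral lborel (\<lambda>t. hat ((t - s) / \<delta>) / \<delta>) 1"
    unfolding z using \<delta> by (simp add: smooth_step_0 smooth_step_1)
  have m: "(\<lambda>t. hat ((t - s) / \<delta>) / \<delta>) \<in> borel_measurable lborel"
    using borel_measurable_continuous_onI[OF c] by simp
  show "integrable lebesgue (\<lambda>t. hat ((t - s) / \<delta>) / \<delta>)" "(LINT t|lebesgue. hat ((t - s) / \<delta>) / \<delta>) = 1"
    using b integrable_completion[OF m] integral_completion[OF m] by (auto simp: has_bochner_integral_iff)
qed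

lemma weighted_average_bound:
  fixes w A :: "real \<Rightarrow> real"
  assumes w: "integrable lebesgue w" "(LINT t|lebesgue. w t) = 1" "\<And>t. w t \<ge> 0"
    and wA: "integrable lebesgue (\<lambda>t. w t * A t)" and le: "\<And>t. w t \<noteq> 0 \<Longrightarrow> \<bar>A t - F\<bar> \<le> \<rho>"
  shows "\<bar>(LINT t|lebesgue. w t * A t) - F\<bar> \<le> \<rho>"
proof -
  have "(LINT t|lebesgue. w t * A t) - F = (LINT t|lebesgue. w t * A t) - (LINT t|lebesgue. w t * F)"
    using w by simp
  also have "\<dots> = (LINT t|lebesgue. w t * A t - w t * F)"
    using w wA by (subst Bochner_Integration.integral_diff) auto
  also have "\<bar>\<dots>\<bar> \<le> (LINT t|lebesgue. \<bar>w t * A t - w t * F\<bar>)" by (rule integral_abs_bound)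
  also have "\<dots> \<le> (LINT t|lebesgue. w t * \<rho>)"
  proof (rule integral_mono)
    show "\<bar>w t * A t - w t * F\<bar> \<le> w t * \<rho>" for t
      using w(3)[of t] le[of t] by (cases "w t = 0") (auto simp: right_diff_distrib[symmetric] abs_mult intro: mult_left_mono)
  qed (use w wA in auto)
  also have "\<dots> = \<rho>" using w by simp
  finally show ?thesis .
qed

section \<open>Limits of the cutoffs and the transport identity\<close>

context moving_window
begin

lemma mem_G_iff_D_eq_0: "t \<in> {c..d} \<Longrightarrow> x \<in> G t \<longleftrightarrow> D (t, x) = 0"
  using G[of t] by (auto simp: D_def clamp_eq in_closed_iff_infdist_zero)

text \<open>Where the distance is zero both functions do not depend on \<open>m\<close>; elsewhere
  \<open>m * D z\<close> eventually exceeds 2 and both vanish.\<close>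

lemma space_cutoff_tendsto:
  assumes "filterlim m at_top sequentially"
  shows "(\<lambda>k. space_cutoff (m k) z) \<longlonglongrightarrow> (if D z = 0 then 1 else 0)"
    and "(\<lambda>k. field_error (m k) z) \<longlonglongrightarrow> 0"
proof -
  have ev: "\<forall>\<^sub>F k in sequentially. m k * D z \<ge> 2" if "D z \<noteq> 0"
  proof -
    have D: "D z > 0" using D_nonneg[of z] that by simp
    have "\<forall>\<^sub>F k in sequentially. m k \<ge> 2 / D z" using assms by (simp add: filterlim_at_top)
    then show ?thesis by eventually_elim (use D in \<open>simp add: pos_divide_le_eq\<close>)
  qed
  show "(\<lambda>k. space_cutoff (m k) z) \<longlonglongrightarrow> (if D z = 0 then 1 else 0)"
  proof (cases "D z = 0")
    case False
    have "\<forall>\<^sub>F k in sequentially. 0 = space_cutoff (m k) z"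
      using ev[OF False] by eventually_elim (auto simp: space_cutoff_def pos_part_def)
    from Lim_transform_eventually[OF tendsto_const this] False show ?thesis by simp
  qed (simp add: space_cutoff_def pos_part_def)
  show "(\<lambda>k. field_error (m k) z) \<longlonglongrightarrow> 0"
  proof (cases "D z = 0")
    case False
    have "\<forall>\<^sub>F k in sequentially. 0 = field_error (m k) z"
      using ev[OF False] by eventually_elim (auto simp: field_error_def pos_part_def)
    from Lim_transform_eventually[OF tendsto_const this] show ?thesis by simp
  qed (simp add: field_error_def pos_part_def)
qed

lemma field_error_le: "field_error m z \<le> L"
proof -
  have "pos_part (min (m * D z) (2 - m * D z)) \<le> 1" by (auto simp: pos_part_def)
  then show ?thesis using mult_left_mono[OF _ L] unfolding field_error_def by fastforce
qed

text \<open>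
  The time scale \<open>1 / m\<^sup>2\<close> is small against the width \<open>1 / m\<close> of the spatial cutoff, which therefore
  hardly moves while the average in time is taken. This replaces continuity of \<open>G\<close> in measure.
\<close>

lemma cutoff_average_tendsto:
  fixes \<psi> :: "real \<times> 'a \<Rightarrow> real"
  assumes m: "filterlim m at_top sequentially" "\<And>k. m k \<ge> 1" "\<And>k. 2 / m k \<le> \<epsilon>"
    and s: "c < s" "s < d"
    and \<psi>: "set_integrable lebesgue N \<psi>" and K: "compact K" "snd ` N \<subseteq> K"
    and slice: "\<And>t. t \<in> {c..d} \<Longrightarrow> set_integrable lebesgue K (\<lambda>x. \<psi> (t, x))"
    and cont: "((\<lambda>t. LINT x:K|lebesgue. \<bar>\<psi> (t, x) - \<psi> (s, x)\<bar>) \<longlongrightarrow> 0) (at s within {c..d})"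
  shows "(\<lambda>k. LINT z:N|lebesgue. \<psi> z * (hat ((fst z - s) / (1 / (m k)\<^sup>2)) / (1 / (m k)\<^sup>2) * space_cutoff (m k) z))
    \<longlonglongrightarrow> (LINT x:G s|lebesgue. \<psi> (s, x))"
proof -
  define \<delta> where "\<delta> k = 1 / (m k)\<^sup>2" for k
  define w where "w k t = hat ((t - s) / \<delta> k) / \<delta> k" for k t
  define A where "A k t = (LINT x:K|lebesgue. \<psi> (t, x) * space_cutoff (m k) (t, x))" for k t
  define F where "F = (LINT x:G s|lebesgue. \<psi> (s, x))"
  define I where "I = (LINT x:K|lebesgue. \<bar>\<psi> (s, x)\<bar>)"
  have m0: "m k > 0" for k using m(2)[of k] by simp
  have \<delta>: "\<delta> k > 0" for k using m0[of k] by (simp add: \<delta>_def)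
  have scd: "s \<in> {c..d}" using s by auto
  have inv: "(\<lambda>k. 1 / m k) \<longlonglongrightarrow> 0"
    using tendsto_inverse_0_at_top[OF m(1)] by (simp add: inverse_eq_divide)
  have \<delta>0: "\<delta> \<longlonglongrightarrow> 0"
    using tendsto_mult[OF inv inv] by (simp add: \<delta>_def[abs_def] power2_eq_square)
  have cs: "continuous_on B (\<lambda>x. space_cutoff (m k) (t, x))" for B k t
    by (rule continuous_on_compose2[OF continuous_on_space_cutoff[of UNIV]]) (auto intro!: continuous_intros)
  have w0: "t \<in> {s<..<s + \<delta> k}" if "w k t \<noteq> 0" for k t
  proof -
    have "\<not> ((t - s) / \<delta> k \<le> 0 \<or> (t - s) / \<delta> k \<ge> 1)" using that hat_eq_0 by (auto simp: w_def)
    then show ?thesis using \<delta>[of k] by (auto simp: divide_le_0_iff le_divide_eq not_le)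
  qed
  have wnn: "w k t \<ge> 0" for k t using hat_nonneg \<delta>[of k] by (simp add: w_def less_imp_le)
  have inN: "(t, x) \<in> N" if "space_cutoff (m k) (t, x) \<noteq> 0" "t \<in> {c..d}" for k t x
  proof -
    have "D (t, x) < 1 / m k" using space_cutoff_eq_0[OF m0] that by (meson not_le)
    also have "\<dots> \<le> 2 / m k" using m0[of k] by (simp add: divide_right_mono)
    also have "\<dots> \<le> \<epsilon>" by (rule m(3))
    finally show ?thesis using that by (simp add: N_def slab_def)
  qed
  \<comment> \<open>By Fubini the space-time integral is an average over time of the slice integrals
    \<open>A k t\<close>; the condition on \<delta> keeps the weight inside the window.\<close>
  have reduce: "integrable lebesgue (\<lambda>t. w k t * A k t) \<and>
      (LINT z:N|lebesgue. \<psi> z * (w k (fst z) * space_cutoff (m k) z)) = (LINT t|lebesgue. w k t * A k t)"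
    if k: "s + \<delta> k < d" for k
  proof -
    have cw: "continuous_on N (\<lambda>z. w k (fst z))"
      unfolding w_def using \<delta>[of k]
      by (auto intro!: continuous_intros continuous_on_compose2[OF continuous_on_hat[of UNIV]])
    have si: "set_integrable lebesgue N (\<lambda>z. \<psi> z * (w k (fst z) * space_cutoff (m k) z))"
      by (intro set_integrable_mult_continuous \<psi> compact_N continuous_on_mult cw continuous_on_space_cutoff)
    have eq: "(LINT x:{x. (t, x) \<in> N}|lebesgue. \<psi> (t, x) * (w k (fst (t, x)) * space_cutoff (m k) (t, x))) = w k t * A k t" for t
    proof (cases "w k t = 0")
      case False
      then have t: "t \<in> {c..d}" using w0 k s by fastforce
      have "(LINT x:{x. (t, x) \<in> N}|lebesgue. \<psi> (t, x) * (w k (fst (t, x)) * space_cutoff (m k) (t, x))) =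
          (LINT x:K|lebesgue. w k t * (\<psi> (t, x) * space_cutoff (m k) (t, x)))"
        by (rule set_integral_eq_on_subset) (use K inN[of k t] t in \<open>force simp: image_subset_iff\<close>)+
      then show ?thesis by (simp add: A_def)
    qed simp
    show ?thesis
      using integrable_set_integral_slice[OF si] set_integral_slices[OF si] unfolding eq by simp
  qed
  have Flim: "(\<lambda>k. LINT x:K|lebesgue. \<psi> (s, x) * space_cutoff (m k) (s, x)) \<longlonglongrightarrow> F"
  proof -
    have "(\<lambda>k. LINT x:K|lebesgue. \<psi> (s, x) * space_cutoff (m k) (s, x)) \<longlonglongrightarrow>
        (LINT x:K|lebesgue. \<psi> (s, x) * (if D (s, x) = 0 then 1 else 0))"
      by (rule set_integral_mult_dominated_convergence[OF slice[OF scd] K(1) cs, where C=1])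
        (use space_cutoff_bounds m0 space_cutoff_tendsto(1)[OF m(1)] in \<open>auto simp: less_imp_le\<close>)
    also have "(LINT x:K|lebesgue. \<psi> (s, x) * (if D (s, x) = 0 then 1 else 0)) = F"
      unfolding F_def
    proof (rule set_integral_eq_on_subset[symmetric])
      show "G s \<subseteq> K"
      proof
        fix x assume "x \<in> G s"
        then have "(s, x) \<in> N" using mem_G_iff_D_eq_0[OF scd] scd \<epsilon> by (auto simp: N_def slab_def)
        then show "x \<in> K" using K(2) by force
      qed
    qed (use mem_G_iff_D_eq_0[OF scd] in auto)
    finally show ?thesis .
  qed
  \<comment> \<open>There are two errors: the L^1 distance between slices of \<psi>, and the motion
    of the cutoff, where the slope \<open>m k\<close> times the drift \<open>M * \<delta> k\<close>
    of the distance is \<open>M * (1 / m k)\<close>.\<close>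
  have close: "\<bar>A k t - (LINT x:K|lebesgue. \<psi> (s, x) * space_cutoff (m k) (s, x))\<bar> \<le>
      (LINT x:K|lebesgue. \<bar>\<psi> (t, x) - \<psi> (s, x)\<bar>) + M * (1 / m k) * I"
    if t: "t \<in> {c..d}" "\<bar>t - s\<bar> \<le> \<delta> k" for k t
  proof -
    let ?e = "\<lambda>t x. space_cutoff (m k) (t, x)"
    have i1: "set_integrable lebesgue K (\<lambda>x. (\<psi> (t, x) - \<psi> (s, x)) * ?e t x)"
      by (intro set_integrable_mult_continuous set_integral_diff slice t scd K cs)
    have cd: "continuous_on K (\<lambda>x. ?e t x - ?e s x)" by (intro continuous_intros cs)
    have i2: "set_integrable lebesgue K (\<lambda>x. \<psi> (s, x) * (?e t x - ?e s x))"
      by (intro set_integrable_mult_continuous slice scd K cd)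
    have i3: "set_integrable lebesgue K (\<lambda>x. \<psi> (s, x) * ?e s x)"
      by (intro set_integrable_mult_continuous slice scd K cs)
    have "A k t = (LINT x:K|lebesgue. ((\<psi> (t, x) - \<psi> (s, x)) * ?e t x + \<psi> (s, x) * (?e t x - ?e s x)) + \<psi> (s, x) * ?e s x)"
      unfolding A_def by (simp add: algebra_simps)
    also have "\<dots> = (LINT x:K|lebesgue. (\<psi> (t, x) - \<psi> (s, x)) * ?e t x) + (LINT x:K|lebesgue. \<psi> (s, x) * (?e t x - ?e s x))
        + (LINT x:K|lebesgue. \<psi> (s, x) * ?e s x)"
      using i1 i2 i3 by (simp add: set_integral_add)
    finally have split: "A k t - (LINT x:K|lebesgue. \<psi> (s, x) * ?e s x) =
       (LINT x:K|lebesgue. (\<psi> (t, x) - \<psi> (s, x)) * ?e t x) + (LINT x:K|lebesgue. \<psi> (s, x) * (?e t x - ?e s x))" by simp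
    have b1: "\<bar>LINT x:K|lebesgue. (\<psi> (t, x) - \<psi> (s, x)) * ?e t x\<bar> \<le> 1 * (LINT x:K|lebesgue. \<bar>\<psi> (t, x) - \<psi> (s, x)\<bar>)"
      by (rule set_integral_mult_bound[OF set_integral_diff(1)[OF slice[OF t(1)] slice[OF scd]] K(1) cs])
        (use space_cutoff_bounds[of "m k"] m0[of k] in \<open>auto simp: less_imp_le\<close>)
    have b2: "\<bar>LINT x:K|lebesgue. \<psi> (s, x) * (?e t x - ?e s x)\<bar> \<le> (M * (1 / m k)) * I"
      unfolding I_def
    proof (rule set_integral_mult_bound[OF slice[OF scd] K(1) cd])
      fix x
      have "\<bar>?e t x - ?e s x\<bar> \<le> m k * \<bar>D (t, x) - D (s, x)\<bar>" by (rule space_cutoff_lipschitz[OF less_imp_le[OF m0]])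
      also have "\<dots> \<le> m k * (M * \<delta> k)"
        using D_lipschitz[of t x s x] mult_left_mono[OF t(2) M] m0[of k] by (intro mult_left_mono) auto
      also have "\<dots> = M * (1 / m k)" using m0[of k] by (simp add: \<delta>_def power2_eq_square)
      finally show "\<bar>?e t x - ?e s x\<bar> \<le> M * (1 / m k)" .
    qed
    show ?thesis unfolding split using b1 b2 by linarith
  qed
  have "(\<lambda>k. LINT z:N|lebesgue. \<psi> z * (w k (fst z) * space_cutoff (m k) z)) \<longlonglongrightarrow> F"
  proof (rule tendstoI)
    fix \<rho> :: real assume \<rho>: "\<rho> > 0"
    then have r4: "\<rho> / 4 > 0" by simp
    from tendstoD[OF cont r4] obtain \<beta> where \<beta>': "\<beta> > 0" "\<forall>t\<in>{c..d}. t \<noteq> s \<and> dist t s < \<beta> \<longrightarrow>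
        dist (LINT x:K|lebesgue. \<bar>\<psi> (t, x) - \<psi> (s, x)\<bar>) 0 < \<rho> / 4"
      unfolding eventually_at by blast
    have \<beta>2: "(LINT x:K|lebesgue. \<bar>\<psi> (t, x) - \<psi> (s, x)\<bar>) < \<rho> / 4"
      if "t \<in> {c..d}" "t \<noteq> s" "dist t s < \<beta>" for t
      using \<beta>'(2)[rule_format, OF that(1) conjI[OF that(2,3)]] unfolding dist_real_def by linarith
    note \<beta> = \<beta>'(1) \<beta>2
    have "(\<lambda>k. M * (1 / m k) * I) \<longlonglongrightarrow> M * 0 * I" by (intro tendsto_intros inv)
    then have e1: "\<forall>\<^sub>F k in sequentially. M * (1 / m k) * I < \<rho> / 4"
      by (rule order_tendstoD(2)) (use r4 in simp)
    have e2: "\<forall>\<^sub>F k in sequentially. \<delta> k < min \<beta> (d - s)" using \<delta>0 \<beta>(1) s by (intro order_tendstoD(2)) auto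
    have e3: "\<forall>\<^sub>F k in sequentially. dist (LINT x:K|lebesgue. \<psi> (s, x) * space_cutoff (m k) (s, x)) F < \<rho> / 4"
      using tendstoD[OF Flim r4] .
    show "\<forall>\<^sub>F k in sequentially. dist (LINT z:N|lebesgue. \<psi> z * (w k (fst z) * space_cutoff (m k) z)) F < \<rho>"
      using e1 e2 e3
    proof eventually_elim
      case (elim k)
      then have sd: "s + \<delta> k < d" by simp
      note red = reduce[OF sd]
      \<comment> \<open>One quarter of \<rho> each for the slices of \<psi>, the motion of the
        cutoff and the limit at time \<open>s\<close>; the last quarter makes the final inequality
        strict.\<close>
      have "\<bar>(LINT t|lebesgue. w k t * A k t) - F\<bar> \<le> 3 * (\<rho> / 4)"
      proof (rule weighted_average_bound[where w="w k"])
        show "integrable lebesgue (w k)" "(LINT t|lebesgue. w k t) = 1"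
          using scaled_hat_integral[OF \<delta>[of k]] by (simp_all add: w_def[abs_def])
        fix t assume "w k t \<noteq> 0"
        then have t: "s < t" "t < s + \<delta> k" using w0 by auto
        have tcd: "t \<in> {c..d}" "\<bar>t - s\<bar> \<le> \<delta> k" using t s sd by auto
        have "dist t s < \<beta>" using t elim by (simp add: dist_real_def)
        then have "(LINT x:K|lebesgue. \<bar>\<psi> (t, x) - \<psi> (s, x)\<bar>) < \<rho> / 4" using \<beta>(2) tcd t by auto
        then show "\<bar>A k t - F\<bar> \<le> 3 * (\<rho> / 4)"
          using close[OF tcd] elim unfolding dist_real_def by linarith
      qed (use wnn red in auto)
      then show ?case using red \<rho> by (simp add: dist_real_def)
    qed
  qed
  then show ?thesis unfolding w_def \<delta>_def F_def .
qed

lemma time_cutoff_tendsto: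
  assumes \<delta>: "\<delta> \<longlonglongrightarrow> 0" "\<And>k. \<delta> k > 0" and st: "\<sigma> \<le> \<tau>"
  shows "(\<lambda>k. time_cutoff \<sigma> \<tau> (\<delta> k) t) \<longlonglongrightarrow> (if \<sigma> < t \<and> t \<le> \<tau> then 1 else 0)"
proof -
  have step: "(\<lambda>k. smooth_step ((t - r) / \<delta> k)) \<longlonglongrightarrow> (if r < t then 1 else 0)" for r
  proof (cases "r < t")
    case True
    then have "\<forall>\<^sub>F k in sequentially. \<delta> k < t - r" using \<delta>(1) by (intro order_tendstoD(2)) auto
    then have "\<forall>\<^sub>F k in sequentially. 1 = smooth_step ((t - r) / \<delta> k)"
      by eventually_elim (simp add: smooth_step_1 \<delta>(2))
    from Lim_transform_eventually[OF tendsto_const this] True show ?thesis by simp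
  next
    case False
    then have "smooth_step ((t - r) / \<delta> k) = 0" for k
      using \<delta>(2)[of k] by (intro smooth_step_0) (simp add: divide_le_0_iff)
    then show ?thesis using False by simp
  qed
  from tendsto_diff[OF step[of \<sigma>] step[of \<tau>]] show ?thesis
    using st by (auto simp: time_cutoff_def split: if_splits)
qed

text \<open>Tested with the k-th cutoff, the weak equation has four terms: two averages after
  \<sigma> and \<tau>, which tend to integrals over single slices, an error with the factor
  \<open>E k\<close>, which is bounded and tends to 0 pointwise, and a right-hand side that tends to
  an integral over the tube.\<close>

lemma transport_identity:
  fixes \<psi> g :: "real \<times> 'a \<Rightarrow> real"
  assumes \<psi>: "set_integrable lebesgue N \<psi>" and g: "set_integrable lebesgue N g"
    and weak: "\<And>\<phi>. test_function S \<phi> \<Longrightarrow>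
      (LINT z:S|lebesgue. \<psi> z * frechet_derivative \<phi> (at z) (V z)) = - (LINT z:S|lebesgue. g z * \<phi> z)"
    and K: "compact K" "snd ` N \<subseteq> K"
    and slice: "\<And>t. t \<in> {c..d} \<Longrightarrow> set_integrable lebesgue K (\<lambda>x. \<psi> (t, x))"
    and cont: "\<And>s. s \<in> {c..d} \<Longrightarrow> ((\<lambda>t. LINT x:K|lebesgue. \<bar>\<psi> (t, x) - \<psi> (s, x)\<bar>) \<longlongrightarrow> 0) (at s within {c..d})"
    and st: "c < \<sigma>" "\<sigma> \<le> \<tau>" "\<tau> < d"
  shows "(LINT x:G \<tau>|lebesgue. \<psi> (\<tau>, x)) - (LINT x:G \<sigma>|lebesgue. \<psi> (\<sigma>, x)) =
    (LINT z:{z. \<sigma> < fst z \<and> fst z \<le> \<tau> \<and> snd z \<in> G (fst z)}|lebesgue. g z)"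
proof -
  \<comment> \<open>The summands ensure \<open>m k \<ge> 1\<close>,
    \<open>2 / m k \<le> \<epsilon>\<close> and \<open>\<tau> + \<delta> k < d\<close> for every
    \<open>k\<close>, so that no initial terms have to be discarded.\<close>
  define m where "m k = 1 + 2 / \<epsilon> + 1 / (d - \<tau>) + real k" for k :: nat
  define \<delta> where "\<delta> k = 1 / (m k)\<^sup>2" for k
  have pos: "2 / \<epsilon> > 0" "1 / (d - \<tau>) > 0" using \<epsilon> st by auto
  have m1: "m k \<ge> 1" for k using pos by (simp add: m_def)
  then have m0: "m k > 0" for k by (smt (verit))
  have m2: "2 / m k \<le> \<epsilon>" for k
  proof -
    have "2 / \<epsilon> \<le> m k" using pos by (simp add: m_def)
    then show ?thesis using \<epsilon> m0[of k] by (simp add: field_simps)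
  qed
  have m_lim: "filterlim m at_top sequentially"
    unfolding m_def using filterlim_real_sequentially by (rule filterlim_tendsto_add_at_top[OF tendsto_const])
  have \<delta>: "\<delta> k > 0" for k using m0[of k] by (simp add: \<delta>_def)
  have \<delta>d: "\<tau> + \<delta> k < d" for k
  proof -
    have "m k * 1 \<le> m k * m k" using m1[of k] m0[of k] by (intro mult_left_mono) auto
    moreover have "1 / (d - \<tau>) < m k" using \<epsilon> by (simp add: m_def add_pos_nonneg)
    ultimately have "1 / (d - \<tau>) < (m k)\<^sup>2" by (simp add: power2_eq_square)
    then show ?thesis using st m0[of k] by (simp add: \<delta>_def field_simps)
  qed
  have inv: "(\<lambda>k. 1 / m k) \<longlonglongrightarrow> 0"
    using tendsto_inverse_0_at_top[OF m_lim] by (simp add: inverse_eq_divide)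
  have \<delta>0: "\<delta> \<longlonglongrightarrow> 0"
    using tendsto_mult[OF inv inv] by (simp add: \<delta>_def[abs_def] power2_eq_square)
  have e: "1 / m k > 0" for k using m0 by simp
  have "\<exists>\<phi>. test_function S \<phi> \<and>
    (\<forall>z. \<bar>\<phi> z - time_cutoff \<sigma> \<tau> (\<delta> k) (fst z) * space_cutoff (m k) z\<bar> \<le> 1 / m k) \<and>
    (\<forall>z. \<bar>frechet_derivative \<phi> (at z) (V z) - time_cutoff' \<sigma> \<tau> (\<delta> k) (fst z) * space_cutoff (m k) z\<bar> \<le> field_error (m k) z + 1 / m k) \<and>
    (\<forall>z. z \<notin> N \<longrightarrow> \<phi> z = 0) \<and> (\<forall>z h. z \<notin> N \<longrightarrow> frechet_derivative \<phi> (at z) h = 0)" for k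
    by (rule ex_tube_test_function[OF st(1,2) \<delta>[of k] \<delta>d m1 m2 e[of k]]) blast
  then obtain \<phi> where \<phi>: "\<And>k. test_function S (\<phi> k)"
    "\<And>k z. \<bar>\<phi> k z - time_cutoff \<sigma> \<tau> (\<delta> k) (fst z) * space_cutoff (m k) z\<bar> \<le> 1 / m k"
    "\<And>k z. \<bar>frechet_derivative (\<phi> k) (at z) (V z) - time_cutoff' \<sigma> \<tau> (\<delta> k) (fst z) * space_cutoff (m k) z\<bar> \<le> field_error (m k) z + 1 / m k"
    "\<And>k z. z \<notin> N \<Longrightarrow> \<phi> k z = 0" "\<And>k z h. z \<notin> N \<Longrightarrow> frechet_derivative (\<phi> k) (at z) h = 0"
    by metis
  define \<alpha> where "\<alpha> k z = time_cutoff' \<sigma> \<tau> (\<delta> k) (fst z) * space_cutoff (m k) z" for k z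
  define E where "E k z = frechet_derivative (\<phi> k) (at z) (V z) - \<alpha> k z" for k z
  define T where "T = {z. \<sigma> < fst z \<and> fst z \<le> \<tau> \<and> snd z \<in> G (fst z)}"
  have TN: "T \<subseteq> N"
    using st \<epsilon> mem_G_iff_D_eq_0 by (auto simp: T_def N_def slab_def)
  have C1: "Ck_on 1 UNIV (\<phi> k)" for k using \<phi>(1)[of k] unfolding test_function_def by blast
  have c\<phi>: "continuous_on N (\<phi> k)" for k using continuous_on_subset[OF Ck_on_1D(3)[OF C1]] by blast
  have c\<alpha>: "continuous_on N (\<alpha> k)" for k
    unfolding \<alpha>_def by (intro continuous_intros continuous_on_time_cutoff' continuous_on_space_cutoff \<delta>)
  have cE: "continuous_on N (E k)" for k
  proof -
    obtain \<phi>' where \<phi>': "\<And>x. x \<in> UNIV \<Longrightarrow> blinfun_apply (\<phi>' x) = frechet_derivative (\<phi> k) (at x)" "continuous_on UNIV \<phi>'"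
      using Ck_on_1_derivative_blinfun[OF C1[of k]] by metis
    have "continuous_on N (\<lambda>z. blinfun_apply (\<phi>' z) (V z))"
      using continuous_on_subset[OF \<phi>'(2)] continuous_on_V[OF N_subset] by (intro continuous_intros) auto
    then show ?thesis unfolding E_def using \<phi>'(1) by (intro continuous_intros c\<alpha>) auto
  qed
  have A: "(\<lambda>k. LINT z:N|lebesgue. g z * \<phi> k z) \<longlonglongrightarrow> (LINT z:N|lebesgue. g z * indicator T z)"
  proof (rule set_integral_mult_dominated_convergence[OF g compact_N c\<phi>, where C=2])
    fix k z
    have "\<bar>time_cutoff \<sigma> \<tau> (\<delta> k) (fst z) * space_cutoff (m k) z\<bar> \<le> 1 * 1"
      unfolding abs_mult using time_cutoff_bounds[OF st(2) \<delta>] space_cutoff_bounds[OF less_imp_le[OF m0]]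
      by (intro mult_mono) auto
    moreover have "1 / m k \<le> 1" using m1[of k] by simp
    ultimately show "\<bar>\<phi> k z\<bar> \<le> 2" using \<phi>(2)[of k z] by linarith
  next
    fix z assume z: "z \<in> N"
    have "(\<lambda>k. \<phi> k z - time_cutoff \<sigma> \<tau> (\<delta> k) (fst z) * space_cutoff (m k) z) \<longlonglongrightarrow> 0"
      by (rule Lim_null_comparison[OF _ inv]) (use \<phi>(2) in auto)
    moreover have "(\<lambda>k. time_cutoff \<sigma> \<tau> (\<delta> k) (fst z) * space_cutoff (m k) z) \<longlonglongrightarrow>
        (if \<sigma> < fst z \<and> fst z \<le> \<tau> then 1 else 0) * (if D z = 0 then 1 else 0)"
      by (intro tendsto_mult time_cutoff_tendsto[OF \<delta>0 \<delta> st(2)] space_cutoff_tendsto(1)[OF m_lim])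
    ultimately have "(\<lambda>k. \<phi> k z) \<longlonglongrightarrow> 0 + (if \<sigma> < fst z \<and> fst z \<le> \<tau> then 1 else 0) * (if D z = 0 then 1 else 0)"
      using tendsto_add by fastforce
    moreover have "0 + (if \<sigma> < fst z \<and> fst z \<le> \<tau> then 1 else 0) * (if D z = 0 then 1 else 0) = (indicator T z :: real)"
      using mem_G_iff_D_eq_0[of "fst z" "snd z"] st by (auto simp: T_def indicator_def)
    ultimately show "(\<lambda>k. \<phi> k z) \<longlonglongrightarrow> indicator T z" by simp
  qed
  have AT: "(LINT z:N|lebesgue. g z * indicator T z) = (LINT z:T|lebesgue. g z)"
    by (rule set_integral_eq_on_subset[symmetric, OF TN]) auto
  have B: "(\<lambda>k. LINT z:N|lebesgue. \<psi> z * E k z) \<longlonglongrightarrow> (LINT z:N|lebesgue. \<psi> z * 0)"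
  proof (rule set_integral_mult_dominated_convergence[OF \<psi> compact_N cE, where C="L + 1"])
    fix k z
    have "1 / m k \<le> 1" using m1[of k] by simp
    then show "\<bar>E k z\<bar> \<le> L + 1" using \<phi>(3)[of k z] field_error_le[of "m k" z] unfolding E_def \<alpha>_def by linarith
  next
    fix z
    have "(\<lambda>k. field_error (m k) z + 1 / m k) \<longlonglongrightarrow> 0 + 0"
      by (intro tendsto_add space_cutoff_tendsto(2)[OF m_lim] inv)
    then show "(\<lambda>k. E k z) \<longlonglongrightarrow> 0"
      by (intro Lim_null_comparison[of "\<lambda>k. E k z" "\<lambda>k. field_error (m k) z + 1 / m k"])
        (use \<phi>(3) in \<open>auto simp: E_def \<alpha>_def\<close>)
  qed
  define C where "C s k = (LINT z:N|lebesgue. \<psi> z * (hat ((fst z - s) / \<delta> k) / \<delta> k * space_cutoff (m k) z))" for s k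
  have Clim: "C s \<longlonglongrightarrow> (LINT x:G s|lebesgue. \<psi> (s, x))" if "c < s" "s < d" for s
    unfolding C_def[abs_def] \<delta>_def
    by (rule cutoff_average_tendsto[OF m_lim m1 m2 that \<psi> K slice cont]) (use that in auto)
  have iC: "set_integrable lebesgue N (\<lambda>z. \<psi> z * (hat ((fst z - s) / \<delta> k) / \<delta> k * space_cutoff (m k) z))" for s k
    using \<delta>[of k]
    by (intro set_integrable_mult_continuous \<psi> compact_N continuous_on_mult continuous_on_space_cutoff)
      (auto intro!: continuous_intros continuous_on_compose2[OF continuous_on_hat[of UNIV]])
  have eq: "(LINT z:N|lebesgue. \<psi> z * E k z) + (C \<sigma> k - C \<tau> k) = - (LINT z:N|lebesgue. g z * \<phi> k z)" for k
  proof -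
    have "(LINT z:N|lebesgue. \<psi> z * E k z) + (C \<sigma> k - C \<tau> k) =
      (LINT z:N|lebesgue. \<psi> z * E k z + (\<psi> z * (hat ((fst z - \<sigma>) / \<delta> k) / \<delta> k * space_cutoff (m k) z)
         - \<psi> z * (hat ((fst z - \<tau>) / \<delta> k) / \<delta> k * space_cutoff (m k) z)))"
      unfolding C_def using set_integrable_mult_continuous[OF \<psi> compact_N cE] iC
      by (simp add: set_integral_add set_integral_diff)
    also have "\<dots> = (LINT z:N|lebesgue. \<psi> z * frechet_derivative (\<phi> k) (at z) (V z))"
      by (simp add: E_def \<alpha>_def time_cutoff'_def algebra_simps)
    also have "\<dots> = (LINT z:S|lebesgue. \<psi> z * frechet_derivative (\<phi> k) (at z) (V z))"
      by (rule set_integral_eq_on_subset[OF N_subset]) (use \<phi>(5) in auto)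
    also have "\<dots> = - (LINT z:S|lebesgue. g z * \<phi> k z)" by (rule weak[OF \<phi>(1)])
    also have "(LINT z:S|lebesgue. g z * \<phi> k z) = (LINT z:N|lebesgue. g z * \<phi> k z)"
      by (rule set_integral_eq_on_subset[symmetric, OF N_subset]) (use \<phi>(4) in auto)
    finally show ?thesis .
  qed
  have "(\<lambda>k. (LINT z:N|lebesgue. \<psi> z * E k z) + (C \<sigma> k - C \<tau> k)) \<longlonglongrightarrow>
      (LINT z:N|lebesgue. \<psi> z * 0) + ((LINT x:G \<sigma>|lebesgue. \<psi> (\<sigma>, x)) - (LINT x:G \<tau>|lebesgue. \<psi> (\<tau>, x)))"
    using st by (intro tendsto_intros B Clim) auto
  moreover have "(\<lambda>k. - (LINT z:N|lebesgue. g z * \<phi> k z)) \<longlonglongrightarrow> - (LINT z:T|lebesgue. g z)"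
    using tendsto_minus[OF A] unfolding AT .
  ultimately have "(LINT z:N|lebesgue. \<psi> z * 0) + ((LINT x:G \<sigma>|lebesgue. \<psi> (\<sigma>, x)) - (LINT x:G \<tau>|lebesgue. \<psi> (\<tau>, x))) =
      - (LINT z:T|lebesgue. g z)"
    unfolding eq by (rule LIMSEQ_unique)
  then show ?thesis unfolding T_def by (simp add: set_lebesgue_integral_def)
qed

end

section \<open>Weak partial derivatives\<close>

text \<open>By translation invariance every difference quotient has integral zero. For steps of size
  at most 1 the quotients are bounded by \<open>C * norm e\<close> and vanish off one ball, so the
  limit can be taken under the integral.\<close>

lemma integral_directional_derivative_eq_0:
  fixes f :: "'a::euclidean_space \<Rightarrow> real"
  assumes f: "Ck_on 1 UNIV f" and K: "compact K" "\<And>x. x \<notin> K \<Longrightarrow> f x = 0"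
  shows "(LINT x|lborel. frechet_derivative f (at x) e) = 0"
proof -
  obtain C where lip: "C-lipschitz_on UNIV f" using C1_compact_support_lipschitz[OF f K] .
  have C: "C \<ge> 0" using lip by (rule lipschitz_on_nonneg)
  obtain R where R: "R > 0" "\<And>x. x \<in> K \<Longrightarrow> norm x \<le> R"
    using compact_imp_bounded[OF K(1)] unfolding bounded_pos by auto
  define h where "h k = 1 / (real k + 1)" for k
  have h: "0 < h k" "h k \<le> 1" for k by (auto simp: h_def)
  have h0: "h \<longlonglongrightarrow> 0" unfolding h_def using LIMSEQ_inverse_real_of_nat by (simp add: inverse_eq_divide add.commute)
  define q where "q k x = (f (x + h k *\<^sub>R e) - f x) / h k" for k x
  have cf: "continuous_on UNIV f" by (rule Ck_on_1D(3)[OF f])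
  have mf [measurable]: "f \<in> borel_measurable borel" by (rule borel_measurable_continuous_onI[OF cf])
  have fi: "integrable lborel f"
  proof -
    have "integrable lborel (\<lambda>x. indicator K x *\<^sub>R f x)"
      by (rule borel_integrable_compact[OF K(1)]) (rule continuous_on_subset[OF cf], simp)
    moreover have "(\<lambda>x. indicator K x *\<^sub>R f x) = f" using K(2) by (force simp: indicator_def)
    ultimately show ?thesis by simp
  qed
  have fti: "integrable lborel (\<lambda>x. f (x + h k *\<^sub>R e))" for k
  proof -
    have ct: "continuous_on UNIV (\<lambda>x. f (x + h k *\<^sub>R e))"
      by (rule continuous_on_compose2[OF cf]) (auto intro!: continuous_intros)
    have "integrable lborel (\<lambda>x. indicator (cball 0 (R + norm e)) x *\<^sub>R f (x + h k *\<^sub>R e))"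
      by (rule borel_integrable_compact[OF compact_cball]) (rule continuous_on_subset[OF ct], simp)
    moreover have "indicator (cball 0 (R + norm e)) x *\<^sub>R f (x + h k *\<^sub>R e) = f (x + h k *\<^sub>R e)" for x
    proof (cases "x + h k *\<^sub>R e \<in> K")
      case True
      have "norm x \<le> norm (x + h k *\<^sub>R e) + norm (h k *\<^sub>R e)"
        using norm_triangle_ineq4[of "x + h k *\<^sub>R e" "h k *\<^sub>R e"] by simp
      also have "\<dots> \<le> R + 1 * norm e" using R(2)[OF True] h[of k] unfolding norm_scaleR
        by (intro add_mono mult_right_mono) auto
      finally show ?thesis by (simp add: indicator_def)
    qed (use K(2) in simp)
    ultimately show ?thesis by (simp only:)
  qed
  have int0: "(LINT x|lborel. q k x) = 0" for k
  proof -
    have "(LINT x|lborel. f (x + h k *\<^sub>R e)) = (LINT x|lborel. f x)"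
      using lborel_integral_translate[OF mf, of "h k *\<^sub>R e"] by (simp add: add.commute)
    then show ?thesis using fi fti[of k] by (simp add: q_def)
  qed
  have lim: "(\<lambda>k. q k x) \<longlonglongrightarrow> frechet_derivative f (at x) e" for x
  proof -
    have "((\<lambda>h. (f (x + h *\<^sub>R e) - f x) / h) \<longlongrightarrow> frechet_derivative f (at x) e) (at 0)"
      by (rule directional_derivative_tendsto) (use Ck_on_1D(1)[OF f] in simp)
    moreover have "filterlim h (at 0) sequentially"
      unfolding filterlim_at using h0 h by (auto simp: less_imp_neq[OF h(1), symmetric])
    ultimately show ?thesis unfolding q_def by (rule filterlim_compose)
  qed
  have bound: "\<bar>q k x\<bar> \<le> indicator (cball 0 (R + norm e)) x *\<^sub>R (C * norm e)" for k x
  proof (cases "x \<in> cball 0 (R + norm e)")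
    case True
    have "\<bar>f (x + h k *\<^sub>R e) - f x\<bar> \<le> C * norm (h k *\<^sub>R e)"
      using lipschitz_onD[OF lip, of "x + h k *\<^sub>R e" x] by (simp add: dist_norm)
    then have "\<bar>q k x\<bar> \<le> C * norm e" using h[of k] by (simp add: q_def field_simps)
    then show ?thesis using True by simp
  next
    case False
    then have "x \<notin> K" using R(2)[of x] by (auto simp: add_increasing2)
    moreover have "x + h k *\<^sub>R e \<notin> K"
    proof
      assume "x + h k *\<^sub>R e \<in> K"
      have "norm x \<le> norm (x + h k *\<^sub>R e) + norm (h k *\<^sub>R e)"
        using norm_triangle_ineq4[of "x + h k *\<^sub>R e" "h k *\<^sub>R e"] by simp
      also have "\<dots> \<le> R + 1 * norm e" using R(2)[OF \<open>x + h k *\<^sub>R e \<in> K\<close>] h[of k] unfolding norm_scaleR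
        by (intro add_mono mult_right_mono) auto
      finally show False using False by simp
    qed
    ultimately show ?thesis using K(2) False by (simp add: q_def)
  qed
  have mq: "q k \<in> borel_measurable lborel" for k
    unfolding q_def by measurable
  have "(\<lambda>k. LINT x|lborel. q k x) \<longlonglongrightarrow> (LINT x|lborel. frechet_derivative f (at x) e)"
  proof (rule integral_dominated_convergence)
    show "(\<lambda>x. frechet_derivative f (at x) e) \<in> borel_measurable lborel"
      using borel_measurable_continuous_onI[OF Ck_on_1D(2)[OF f]] by simp
    show "integrable lborel (\<lambda>x. indicator (cball (0::'a) (R + norm e)) x *\<^sub>R (C * norm e))"
      by (rule borel_integrable_compact[OF compact_cball]) auto
  qed (use lim mq bound in auto)
  then show ?thesis unfolding int0 by (simp add: LIMSEQ_const_iff)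
qed

lemma test_functionE:
  assumes "test_function S \<phi>"
  obtains K where "compact K" "K \<subseteq> S" "\<And>x. x \<notin> K \<Longrightarrow> \<phi> x = 0" "Ck_on 1 UNIV \<phi>"
  using assms closure_subset[of "{x. \<phi> x \<noteq> 0}"] unfolding test_function_def
  by (intro that[of "closure {x. \<phi> x \<noteq> 0}"]) blast+

text \<open>As \<open>f\<close> is differentiable only on \<open>S\<close>, the derivative of the
  product is glued together from \<open>S\<close> and the complement of \<open>K\<close>, two open
  sets that cover the space.\<close>

lemma C1_mult_compact_support:
  fixes f \<phi> :: "'a::euclidean_space \<Rightarrow> real"
  assumes S: "open S" and f: "Ck_on 1 S f" and \<phi>: "Ck_on 1 UNIV \<phi>"
    and K: "compact K" "K \<subseteq> S" "\<And>x. x \<notin> K \<Longrightarrow> \<phi> x = 0"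
  shows "Ck_on 1 UNIV (\<lambda>x. f x * \<phi> x)"
    and "x \<in> S \<Longrightarrow> frechet_derivative (\<lambda>x. f x * \<phi> x) (at x) h =
      f x * frechet_derivative \<phi> (at x) h + frechet_derivative f (at x) h * \<phi> x"
proof -
  let ?p = "\<lambda>x. f x * \<phi> x"
  have dS: "(?p has_derivative (\<lambda>h. f x * frechet_derivative \<phi> (at x) h + frechet_derivative f (at x) h * \<phi> x)) (at x)"
    if "x \<in> S" for x
    using has_derivative_mult[OF Ck_on_1D(1)[OF f that] Ck_on_1D(1)[OF \<phi>, of x]] by simp
  show eq: "frechet_derivative ?p (at x) h = f x * frechet_derivative \<phi> (at x) h + frechet_derivative f (at x) h * \<phi> x"
    if "x \<in> S" for x h
    using frechet_derivative_at[OF dS[OF that]] by metis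
  have oK: "open (- K)" using K(1) by (simp add: compact_imp_closed open_Compl)
  have dK: "(?p has_derivative (\<lambda>h. 0)) (at x)" if "x \<notin> K" for x
  proof -
    have "((\<lambda>x. 0) has_derivative (\<lambda>h. 0)) (at x)" by simp
    then show ?thesis
      by (rule has_derivative_transform_within_open[OF _ oK]) (use K that in auto)
  qed
  have U: "UNIV = S \<union> - K" using K by auto
  show "Ck_on 1 UNIV ?p"
    unfolding One_nat_def Ck_on.simps
  proof (intro conjI ballI allI)
    show "?p differentiable at x" for x
      using dS[of x] dK[of x] K(2) unfolding differentiable_def by blast
    fix h
    have "continuous_on S (\<lambda>x. f x * frechet_derivative \<phi> (at x) h + frechet_derivative f (at x) h * \<phi> x)"
      using continuous_on_subset[OF Ck_on_1D(2)[OF \<phi>]] continuous_on_subset[OF Ck_on_1D(3)[OF \<phi>]]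
      by (intro continuous_intros Ck_on_1D(2,3)[OF f]) auto
    then have "continuous_on S (\<lambda>x. frechet_derivative ?p (at x) h)"
      by (rule continuous_on_eq) (simp add: eq)
    moreover have "continuous_on (- K) (\<lambda>x. frechet_derivative ?p (at x) h)"
    proof (rule continuous_on_eq[OF continuous_on_const])
      fix x assume "x \<in> - K"
      then show "0 = frechet_derivative ?p (at x) h" using frechet_derivative_at[OF dK[of x]] by (metis ComplD)
    qed
    ultimately show "continuous_on UNIV (\<lambda>x. frechet_derivative ?p (at x) h)"
      unfolding U using S oK by (intro continuous_on_open_Un) auto
  qed
qed

section \<open>Classical derivatives and the product rule in the weak sense\<close>

lemma locally_integrable_on_continuous:
  fixes f :: "'a::euclidean_space \<Rightarrow> real"
  assumes "continuous_on S f"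
  shows "locally_integrable_on S f"
  unfolding locally_integrable_on_def
proof (intro allI impI)
  fix K assume K: "compact K \<and> K \<subseteq> S"
  have "set_integrable lebesgue K (\<lambda>x. 1::real)"
    using K by (simp add: set_integrable_one_compact)
  from set_integrable_mult_continuous[OF this, of f] K continuous_on_subset[OF assms, of K]
  show "set_integrable lebesgue K f" by simp
qed

lemma locally_integrable_on_mult_continuous:
  fixes f w :: "'a::euclidean_space \<Rightarrow> real"
  assumes "locally_integrable_on S f" "continuous_on S w"
  shows "locally_integrable_on S (\<lambda>x. f x * w x)"
  unfolding locally_integrable_on_def
proof (intro allI impI)
  fix K assume K: "compact K \<and> K \<subseteq> S"
  then show "set_integrable lebesgue K (\<lambda>x. f x * w x)"
    using assms unfolding locally_integrable_on_def
    by (intro set_integrable_mult_continuous) (auto intro: continuous_on_subset)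
qed

lemma locally_integrable_on_add:
  "locally_integrable_on S f \<Longrightarrow> locally_integrable_on S g \<Longrightarrow> locally_integrable_on S (\<lambda>x. f x + g x)"
  unfolding locally_integrable_on_def by (auto intro: set_integral_add)

lemma locally_integrable_on_sum:
  "finite I \<Longrightarrow> (\<And>i. i \<in> I \<Longrightarrow> locally_integrable_on S (f i)) \<Longrightarrow> locally_integrable_on S (\<lambda>x. \<Sum>i\<in>I. f i x)"
proof (induction I rule: finite_induct)
  case empty
  then show ?case using locally_integrable_on_continuous[OF continuous_on_const, of S 0] by simp
qed (auto intro: locally_integrable_on_add)

text \<open>The directional derivative of the product of \<open>f\<close> and \<phi> integrates to
  zero; it is split by the product rule on a compact set outside which \<phi> vanishes, where both
  terms are integrable.\<close>

lemma has_weak_partial_C1: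
  fixes f :: "'a::euclidean_space \<Rightarrow> real"
  assumes S: "open S" and f: "Ck_on 1 S f"
  shows "has_weak_partial S e f (\<lambda>x. frechet_derivative f (at x) e)"
  unfolding has_weak_partial_def
proof (intro conjI allI impI)
  show lf: "locally_integrable_on S f" by (rule locally_integrable_on_continuous[OF Ck_on_1D(3)[OF f]])
  show lg: "locally_integrable_on S (\<lambda>x. frechet_derivative f (at x) e)"
    by (rule locally_integrable_on_continuous[OF Ck_on_1D(2)[OF f]])
  fix \<phi> assume "test_function S \<phi>"
  then obtain K where K: "compact K" "K \<subseteq> S" "\<And>x. x \<notin> K \<Longrightarrow> \<phi> x = 0" and \<phi>: "Ck_on 1 UNIV \<phi>"
    by (rule test_functionE) blast
  let ?p = "\<lambda>x. f x * \<phi> x"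
  have p: "Ck_on 1 UNIV ?p" by (rule C1_mult_compact_support(1)[OF S f \<phi> K])
  have p0: "?p x = 0" if "x \<notin> K" for x using K(3)[OF that] by simp
  have D0: "frechet_derivative \<phi> (at x) e = 0" if "x \<notin> K" for x
    by (rule frechet_derivative_eq_0_outside[OF compact_imp_closed[OF K(1)] K(3) that])
  have Dp0: "frechet_derivative ?p (at x) e = 0" if "x \<notin> K" for x
    by (rule frechet_derivative_eq_0_outside[OF compact_imp_closed[OF K(1)] p0 that])
  have i1: "set_integrable lebesgue K (\<lambda>x. f x * frechet_derivative \<phi> (at x) e)"
    using lf K continuous_on_subset[OF Ck_on_1D(2)[OF \<phi>]] unfolding locally_integrable_on_def
    by (intro set_integrable_mult_continuous) auto
  have i2: "set_integrable lebesgue K (\<lambda>x. frechet_derivative f (at x) e * \<phi> x)"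
    using lg K continuous_on_subset[OF Ck_on_1D(3)[OF \<phi>]] unfolding locally_integrable_on_def
    by (intro set_integrable_mult_continuous) auto
  have "(\<lambda>x. frechet_derivative ?p (at x) e) \<in> borel_measurable lborel"
    using borel_measurable_continuous_onI[OF Ck_on_1D(2)[OF p]] by simp
  then have "(LINT x|lebesgue. frechet_derivative ?p (at x) e) = 0"
    using integral_directional_derivative_eq_0[OF p K(1) p0] by (simp add: integral_completion)
  also have "(LINT x|lebesgue. frechet_derivative ?p (at x) e) =
      (LINT x:K|lebesgue. f x * frechet_derivative \<phi> (at x) e + frechet_derivative f (at x) e * \<phi> x)"
    unfolding set_lebesgue_integral_def
    by (rule Bochner_Integration.integral_cong)
      (use Dp0 C1_mult_compact_support(2)[OF S f \<phi> K] K(2) in \<open>auto simp: indicator_def\<close>)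
  also have "\<dots> = (LINT x:K|lebesgue. f x * frechet_derivative \<phi> (at x) e) + (LINT x:K|lebesgue. frechet_derivative f (at x) e * \<phi> x)"
    using i1 i2 by (rule set_integral_add)
  also have "(LINT x:K|lebesgue. f x * frechet_derivative \<phi> (at x) e) = (LINT x:S|lebesgue. f x * frechet_derivative \<phi> (at x) e)"
    by (rule set_integral_eq_on_subset[OF K(2)]) (use D0 in auto)
  also have "(LINT x:K|lebesgue. frechet_derivative f (at x) e * \<phi> x) = (LINT x:S|lebesgue. frechet_derivative f (at x) e * \<phi> x)"
    by (rule set_integral_eq_on_subset[OF K(2)]) (use K in auto)
  finally show "(LINT x:S|lebesgue. f x * frechet_derivative \<phi> (at x) e) = - (LINT x:S|lebesgue. frechet_derivative f (at x) e * \<phi> x)"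
    by simp
qed

text \<open>The product rule below multiplies a test function by a factor that is only C^1. Uniform
  approximation on one compact set carries the weak equation over to such functions.\<close>

lemma has_weak_partial_C1_test_function:
  fixes f g \<theta> :: "'a::euclidean_space \<Rightarrow> real"
  assumes S: "open S" and fg: "has_weak_partial S e f g" and \<theta>: "Ck_on 1 UNIV \<theta>"
    and K: "compact K" "K \<subseteq> S" "\<And>x. x \<notin> K \<Longrightarrow> \<theta> x = 0"
  shows "(LINT x:S|lebesgue. f x * frechet_derivative \<theta> (at x) e) = - (LINT x:S|lebesgue. g x * \<theta> x)"
proof -
  obtain N where N: "compact N" "K \<subseteq> N" "N \<subseteq> S"
    "\<And>\<epsilon>. \<epsilon> > 0 \<Longrightarrow> \<exists>\<phi>. test_function S \<phi> \<and> (\<forall>x. \<bar>\<phi> x - \<theta> x\<bar> \<le> \<epsilon>) \<and> (\<forall>x. x \<notin> N \<longrightarrow> \<phi> x = 0) \<and>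
      (\<forall>x. \<bar>frechet_derivative \<phi> (at x) e - frechet_derivative \<theta> (at x) e\<bar> \<le> \<epsilon>)"
    using C1_approximation_by_test_functions[OF \<theta> K(1,3) S K(2), of e] by blast
  have f: "set_integrable lebesgue N f" and g: "set_integrable lebesgue N g"
    using fg N unfolding has_weak_partial_def locally_integrable_on_def by auto
  have toN: "(LINT x:S|lebesgue. u x * frechet_derivative \<phi> (at x) e) = (LINT x:N|lebesgue. u x * frechet_derivative \<phi> (at x) e)"
      "(LINT x:S|lebesgue. u x * \<phi> x) = (LINT x:N|lebesgue. u x * \<phi> x)"
    if "\<And>x. x \<notin> N \<Longrightarrow> \<phi> x = 0" for u \<phi> :: "'a \<Rightarrow> real"
  proof -
    have "frechet_derivative \<phi> (at x) e = 0" if "x \<notin> N" for x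
      by (rule frechet_derivative_eq_0_outside[OF compact_imp_closed[OF N(1)] _ that]) (rule \<open>\<And>x. x \<notin> N \<Longrightarrow> \<phi> x = 0\<close>)
    then show "(LINT x:S|lebesgue. u x * frechet_derivative \<phi> (at x) e) = (LINT x:N|lebesgue. u x * frechet_derivative \<phi> (at x) e)"
      by (intro set_integral_eq_on_subset[symmetric] N) auto
    show "(LINT x:S|lebesgue. u x * \<phi> x) = (LINT x:N|lebesgue. u x * \<phi> x)"
      using that by (intro set_integral_eq_on_subset[symmetric] N) auto
  qed
  have \<theta>N: "\<theta> x = 0" if "x \<notin> N" for x using K(3) N(2) that by blast
  define a where "a = (LINT x:N|lebesgue. f x * frechet_derivative \<theta> (at x) e) + (LINT x:N|lebesgue. g x * \<theta> x)"
  define B where "B = (LINT x:N|lebesgue. \<bar>f x\<bar>) + (LINT x:N|lebesgue. \<bar>g x\<bar>)"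
  have bound: "\<bar>a\<bar> \<le> \<epsilon> * B" if \<epsilon>: "\<epsilon> > 0" for \<epsilon>
  proof -
    obtain \<phi> where \<phi>: "test_function S \<phi>" "\<And>x. \<bar>\<phi> x - \<theta> x\<bar> \<le> \<epsilon>" "\<And>x. x \<notin> N \<Longrightarrow> \<phi> x = 0"
        "\<And>x. \<bar>frechet_derivative \<phi> (at x) e - frechet_derivative \<theta> (at x) e\<bar> \<le> \<epsilon>"
      using N(4)[OF \<epsilon>] by blast
    have C1: "Ck_on 1 UNIV \<phi>" using \<phi>(1) unfolding test_function_def by blast
    have c: "continuous_on N \<phi>" "continuous_on N \<theta>" "continuous_on N (\<lambda>x. frechet_derivative \<phi> (at x) e)"
       "continuous_on N (\<lambda>x. frechet_derivative \<theta> (at x) e)"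
      using Ck_on_1D(2,3)[OF C1] Ck_on_1D(2,3)[OF \<theta>] by (auto intro: continuous_on_subset)
    have "(LINT x:N|lebesgue. f x * frechet_derivative \<phi> (at x) e) = - (LINT x:N|lebesgue. g x * \<phi> x)"
    proof -
      have "(LINT x:S|lebesgue. f x * frechet_derivative \<phi> (at x) e) = - (LINT x:S|lebesgue. g x * \<phi> x)"
        using fg \<phi>(1) unfolding has_weak_partial_def by blast
      moreover have "(LINT x:S|lebesgue. f x * frechet_derivative \<phi> (at x) e) = (LINT x:N|lebesgue. f x * frechet_derivative \<phi> (at x) e)"
        by (rule toN(1)) (rule \<phi>(3))
      moreover have "(LINT x:S|lebesgue. g x * \<phi> x) = (LINT x:N|lebesgue. g x * \<phi> x)"
        by (rule toN(2)) (rule \<phi>(3))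
      ultimately show ?thesis by simp
    qed
    then have "a = - (LINT x:N|lebesgue. f x * (frechet_derivative \<phi> (at x) e - frechet_derivative \<theta> (at x) e))
        - (LINT x:N|lebesgue. g x * (\<phi> x - \<theta> x))"
      unfolding a_def right_diff_distrib
      using set_integrable_mult_continuous[OF f N(1)] set_integrable_mult_continuous[OF g N(1)] c
      by (simp add: set_integral_diff)
    moreover have "\<bar>LINT x:N|lebesgue. f x * (frechet_derivative \<phi> (at x) e - frechet_derivative \<theta> (at x) e)\<bar> \<le> \<epsilon> * (LINT x:N|lebesgue. \<bar>f x\<bar>)"
      by (rule set_integral_mult_bound[OF f N(1)]) (use c \<phi>(4) in \<open>auto intro: continuous_intros\<close>)
    moreover have "\<bar>LINT x:N|lebesgue. g x * (\<phi> x - \<theta> x)\<bar> \<le> \<epsilon> * (LINT x:N|lebesgue. \<bar>g x\<bar>)"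
      by (rule set_integral_mult_bound[OF g N(1)]) (use c \<phi>(2) in \<open>auto intro: continuous_intros\<close>)
    ultimately show ?thesis unfolding B_def distrib_left by linarith
  qed
  have "a = 0"
  proof (rule ccontr)
    assume "a \<noteq> 0"
    \<comment> \<open>With this tolerance, \<open>bound\<close> makes |a| at most half of
      itself.\<close>
    then have "\<bar>a\<bar> / (2 * (\<bar>B\<bar> + 1)) > 0" by (simp add: add_nonneg_pos)
    from bound[OF this] have "\<bar>a\<bar> \<le> \<bar>a\<bar> / (2 * (\<bar>B\<bar> + 1)) * (\<bar>B\<bar> + 1)"
      using \<open>\<bar>a\<bar> / _ > 0\<close> by (smt (verit) mult_left_mono)
    also have "\<dots> = \<bar>a\<bar> / 2" by (simp add: field_simps)
    finally show False using \<open>a \<noteq> 0\<close> by simp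
  qed
  moreover have "(LINT x:S|lebesgue. f x * frechet_derivative \<theta> (at x) e) = (LINT x:N|lebesgue. f x * frechet_derivative \<theta> (at x) e)"
    by (rule toN(1)) (rule \<theta>N)
  moreover have "(LINT x:S|lebesgue. g x * \<theta> x) = (LINT x:N|lebesgue. g x * \<theta> x)"
    by (rule toN(2)) (rule \<theta>N)
  ultimately show ?thesis unfolding a_def by simp
qed

text \<open>The factor \<open>w\<close> is moved to the test function: the equation for
  \<open>f\<close> is tested with \<open>w\<close> times \<phi>. This is how the weak divergence of
  \<psi> v is known to exist.\<close>

lemma has_weak_partial_mult_C1:
  fixes f g w :: "'a::euclidean_space \<Rightarrow> real"
  assumes S: "open S" and fg: "has_weak_partial S e f g" and w: "Ck_on 1 S w"
  shows "has_weak_partial S e (\<lambda>x. f x * w x) (\<lambda>x. g x * w x + f x * frechet_derivative w (at x) e)"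
  unfolding has_weak_partial_def
proof (intro conjI allI impI)
  have lf: "locally_integrable_on S f" and lg: "locally_integrable_on S g"
    using fg by (auto simp: has_weak_partial_def)
  note cw = Ck_on_1D(3)[OF w] Ck_on_1D(2)[OF w]
  show lfw: "locally_integrable_on S (\<lambda>x. f x * w x)" by (rule locally_integrable_on_mult_continuous[OF lf cw(1)])
  show lgw: "locally_integrable_on S (\<lambda>x. g x * w x + f x * frechet_derivative w (at x) e)"
    by (intro locally_integrable_on_add locally_integrable_on_mult_continuous lf lg cw)
  fix \<phi> assume "test_function S \<phi>"
  then obtain K where K: "compact K" "K \<subseteq> S" "\<And>x. x \<notin> K \<Longrightarrow> \<phi> x = 0" and \<phi>: "Ck_on 1 UNIV \<phi>"
    by (rule test_functionE) blast
  have \<phi>0: "w x * \<phi> x = 0" if "x \<notin> K" for x using K(3)[OF that] by simp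
  have D0: "frechet_derivative \<phi> (at x) e = 0" if "x \<notin> K" for x
    by (rule frechet_derivative_eq_0_outside[OF compact_imp_closed[OF K(1)] K(3) that])
  have c\<phi>: "continuous_on K \<phi>" "continuous_on K (\<lambda>x. frechet_derivative \<phi> (at x) e)"
    using Ck_on_1D(2,3)[OF \<phi>] by (auto intro: continuous_on_subset)
  have wp: "(LINT x:S|lebesgue. f x * frechet_derivative (\<lambda>x. w x * \<phi> x) (at x) e) = - (LINT x:S|lebesgue. g x * (w x * \<phi> x))"
    by (rule has_weak_partial_C1_test_function[OF S fg C1_mult_compact_support(1)[OF S w \<phi> K] K(1,2) \<phi>0])
  have iK: "set_integrable lebesgue K u" if "locally_integrable_on S u" for u
    using that K unfolding locally_integrable_on_def by blast
  have i1: "set_integrable lebesgue K (\<lambda>x. f x * w x * frechet_derivative \<phi> (at x) e)"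
    by (rule set_integrable_mult_continuous[OF iK[OF lfw] K(1) c\<phi>(2)])
  have i2: "set_integrable lebesgue K (\<lambda>x. f x * frechet_derivative w (at x) e * \<phi> x)"
    by (rule set_integrable_mult_continuous[OF iK[OF locally_integrable_on_mult_continuous[OF lf cw(2)]] K(1) c\<phi>(1)])
  have i3: "set_integrable lebesgue K (\<lambda>x. g x * w x * \<phi> x)"
    by (rule set_integrable_mult_continuous[OF iK[OF locally_integrable_on_mult_continuous[OF lg cw(1)]] K(1) c\<phi>(1)])
  have "(LINT x:S|lebesgue. f x * frechet_derivative (\<lambda>x. w x * \<phi> x) (at x) e) =
      (LINT x:K|lebesgue. f x * w x * frechet_derivative \<phi> (at x) e + f x * frechet_derivative w (at x) e * \<phi> x)"
    by (rule set_integral_eq_on_subset[OF K(2), symmetric])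
      (use C1_mult_compact_support(2)[OF S w \<phi> K] K(2,3) D0 in \<open>auto simp: algebra_simps\<close>)
  also have "\<dots> = (LINT x:K|lebesgue. f x * w x * frechet_derivative \<phi> (at x) e) + (LINT x:K|lebesgue. f x * frechet_derivative w (at x) e * \<phi> x)"
    using i1 i2 by (rule set_integral_add)
  finally have 1: "(LINT x:K|lebesgue. f x * w x * frechet_derivative \<phi> (at x) e) + (LINT x:K|lebesgue. f x * frechet_derivative w (at x) e * \<phi> x)
      = - (LINT x:S|lebesgue. g x * (w x * \<phi> x))" unfolding wp by simp
  have "(LINT x:S|lebesgue. g x * (w x * \<phi> x)) = (LINT x:K|lebesgue. g x * w x * \<phi> x)"
    by (rule set_integral_eq_on_subset[OF K(2), symmetric]) (use K in auto)
  moreover have "(LINT x:S|lebesgue. f x * w x * frechet_derivative \<phi> (at x) e) = (LINT x:K|lebesgue. f x * w x * frechet_derivative \<phi> (at x) e)"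
    by (rule set_integral_eq_on_subset[OF K(2), symmetric]) (use D0 in auto)
  moreover have "(LINT x:S|lebesgue. (g x * w x + f x * frechet_derivative w (at x) e) * \<phi> x) =
      (LINT x:K|lebesgue. g x * w x * \<phi> x + f x * frechet_derivative w (at x) e * \<phi> x)"
    by (rule set_integral_eq_on_subset[OF K(2), symmetric]) (use K in \<open>auto simp: algebra_simps\<close>)
  moreover have "\<dots> = (LINT x:K|lebesgue. g x * w x * \<phi> x) + (LINT x:K|lebesgue. f x * frechet_derivative w (at x) e * \<phi> x)"
    using i3 i2 by (rule set_integral_add)
  ultimately show "(LINT x:S|lebesgue. f x * w x * frechet_derivative \<phi> (at x) e) =
     - (LINT x:S|lebesgue. (g x * w x + f x * frechet_derivative w (at x) e) * \<phi> x)"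
    using 1 by linarith
qed

lemma has_weak_partial_set_integrable:
  assumes "has_weak_partial S e f g" "compact K" "K \<subseteq> S"
  shows "set_integrable lebesgue K f" "set_integrable lebesgue K g"
  using assms unfolding has_weak_partial_def locally_integrable_on_def by blast+

lemma weak_partial_works: "has_weak_partial S e f g \<Longrightarrow> has_weak_partial S e f (weak_partial S e f)"
  unfolding weak_partial_def by (rule someI[of "has_weak_partial S e f"])

lemma set_integral_sum:
  fixes f :: "'i \<Rightarrow> 'a \<Rightarrow> real"
  assumes "finite I" "\<And>i. i \<in> I \<Longrightarrow> set_integrable M A (f i)"
  shows "set_integrable M A (\<lambda>x. \<Sum>i\<in>I. f i x)" "(LINT x:A|M. \<Sum>i\<in>I. f i x) = (\<Sum>i\<in>I. LINT x:A|M. f i x)"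
proof -
  have i: "integrable M (\<lambda>x. indicator A x *\<^sub>R f i x)" if "i \<in> I" for i
    using assms(2)[OF that] unfolding set_integrable_def .
  show "set_integrable M A (\<lambda>x. \<Sum>i\<in>I. f i x)"
    unfolding set_integrable_def scaleR_sum_right by (rule Bochner_Integration.integrable_sum) (rule i)
  show "(LINT x:A|M. \<Sum>i\<in>I. f i x) = (\<Sum>i\<in>I. LINT x:A|M. f i x)"
    unfolding set_lebesgue_integral_def scaleR_sum_right by (rule Bochner_Integration.integral_sum) (rule i)
qed

text \<open>The derivative of \<phi> is linear in the direction, so the one along (1, v) splits into
  partial derivatives whose coefficients can be moved onto \<psi>. Integrals are split over a
  compact set outside which \<phi> vanishes, where every term is integrable.\<close>

lemma weak_transport_equation:
  fixes \<psi> :: "real \<times> (real^'n) \<Rightarrow> real" and v :: "real \<Rightarrow> real^'n \<Rightarrow> real^'n"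
  assumes g0: "has_weak_partial S (1, 0) \<psi> g0"
    and gi: "\<And>i. has_weak_partial S (0, axis i 1) (\<lambda>z. \<psi> z * v (fst z) (snd z) $ i) (gi i)"
    and \<phi>: "test_function S \<phi>"
  shows "(LINT z:S|lebesgue. \<psi> z * frechet_derivative \<phi> (at z) (1, v (fst z) (snd z))) =
    - (LINT z:S|lebesgue. (g0 z + (\<Sum>i\<in>UNIV. gi i z)) * \<phi> z)"
proof -
  obtain K where K: "compact K" "K \<subseteq> S" "\<And>x. x \<notin> K \<Longrightarrow> \<phi> x = 0" and C1: "Ck_on 1 UNIV \<phi>"
    using \<phi> by (rule test_functionE) blast
  have D0: "frechet_derivative \<phi> (at x) h = 0" if "x \<notin> K" for x h
    by (rule frechet_derivative_eq_0_outside[OF compact_imp_closed[OF K(1)] K(3) that])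
  have cK: "continuous_on K \<phi>" "continuous_on K (\<lambda>z. frechet_derivative \<phi> (at z) h)" for h
    by (rule continuous_on_subset[OF Ck_on_1D(3)[OF C1]], simp, rule continuous_on_subset[OF Ck_on_1D(2)[OF C1]], simp)
  let ?D = "\<lambda>z i. frechet_derivative \<phi> (at z) (0, axis i 1)"
  let ?E = "\<lambda>z. frechet_derivative \<phi> (at z) (1, 0)"
  let ?vi = "\<lambda>z i. \<psi> z * v (fst z) (snd z) $ i"
  have lin: "frechet_derivative \<phi> (at z) (1, y) = ?E z + (\<Sum>i\<in>UNIV. y $ i * ?D z i)" for z and y :: "real^'n"
  proof -
    have L: "linear (frechet_derivative \<phi> (at z))"
      using Ck_on_1D(1)[OF C1, of z] has_derivative_linear by blast
    have "(0::real, y) = (\<Sum>i\<in>UNIV. y $ i *\<^sub>R (0, axis i 1))"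
      using basis_expansion[of y] by (simp add: prod_eq_iff fst_sum snd_sum scalar_mult_eq_scaleR)
    then have "(1::real, y) = (1, 0) + (\<Sum>i\<in>UNIV. y $ i *\<^sub>R (0, axis i 1))"
      by (metis add_Pair add.right_neutral add.left_neutral)
    then have "frechet_derivative \<phi> (at z) (1, y) =
        ?E z + (\<Sum>i\<in>UNIV. frechet_derivative \<phi> (at z) (y $ i *\<^sub>R (0, axis i 1)))"
      by (simp only: linear_add[OF L] linear_sum[OF L])
    then show ?thesis by (simp only: linear_cmul[OF L] real_scaleR_def)
  qed
  have loc: "set_integrable lebesgue K \<psi>" "set_integrable lebesgue K g0"
    "\<And>i. set_integrable lebesgue K (\<lambda>z. ?vi z i)" "\<And>i. set_integrable lebesgue K (gi i)"
    by (rule has_weak_partial_set_integrable[OF g0 K(1,2)] has_weak_partial_set_integrable[OF gi K(1,2)])+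
  have "(LINT z:S|lebesgue. \<psi> z * frechet_derivative \<phi> (at z) (1, v (fst z) (snd z))) =
     (LINT z:K|lebesgue. \<psi> z * ?E z + (\<Sum>i\<in>UNIV. ?vi z i * ?D z i))"
  proof (rule set_integral_eq_on_subset[OF K(2), symmetric])
    show "\<psi> z * ?E z + (\<Sum>i\<in>UNIV. ?vi z i * ?D z i) = \<psi> z * frechet_derivative \<phi> (at z) (1, v (fst z) (snd z))" for z
      unfolding lin[of z "v (fst z) (snd z)"] by (simp only: distrib_left sum_distrib_left mult.assoc)
    show "\<psi> z * frechet_derivative \<phi> (at z) (1, v (fst z) (snd z)) = 0" if "z \<notin> K" for z
      by (simp only: D0[OF that] mult_zero_right)
  qed
  also have "\<dots> = (LINT z:K|lebesgue. \<psi> z * ?E z) + (\<Sum>i\<in>UNIV. LINT z:K|lebesgue. ?vi z i * ?D z i)"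
    using set_integrable_mult_continuous[OF loc(1) K(1) cK(2)]
      set_integral_sum[of UNIV lebesgue K "\<lambda>i z. ?vi z i * ?D z i"] set_integrable_mult_continuous[OF loc(3) K(1) cK(2)]
    by (simp add: set_integral_add)
  also have "(LINT z:K|lebesgue. \<psi> z * ?E z) = (LINT z:S|lebesgue. \<psi> z * ?E z)"
    by (rule set_integral_eq_on_subset[OF K(2)]) (use D0 in auto)
  also have "\<dots> = - (LINT z:S|lebesgue. g0 z * \<phi> z)"
    using g0 \<phi> unfolding has_weak_partial_def by blast
  also have "(LINT z:S|lebesgue. g0 z * \<phi> z) = (LINT z:K|lebesgue. g0 z * \<phi> z)"
    by (rule set_integral_eq_on_subset[OF K(2), symmetric]) (use K in auto)
  also have "(\<Sum>i\<in>UNIV. LINT z:K|lebesgue. ?vi z i * ?D z i) = (\<Sum>i\<in>UNIV. - (LINT z:K|lebesgue. gi i z * \<phi> z))"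
  proof (rule sum.cong[OF refl])
    fix i :: 'n
    have "(LINT z:K|lebesgue. ?vi z i * ?D z i) = (LINT z:S|lebesgue. ?vi z i * ?D z i)"
      by (rule set_integral_eq_on_subset[OF K(2)]) (use D0 in auto)
    also have "\<dots> = - (LINT z:S|lebesgue. gi i z * \<phi> z)"
      using gi[of i] \<phi> unfolding has_weak_partial_def by blast
    also have "(LINT z:S|lebesgue. gi i z * \<phi> z) = (LINT z:K|lebesgue. gi i z * \<phi> z)"
      by (rule set_integral_eq_on_subset[OF K(2), symmetric]) (use K in auto)
    finally show "(LINT z:K|lebesgue. ?vi z i * ?D z i) = - (LINT z:K|lebesgue. gi i z * \<phi> z)" .
  qed
  also have "- (LINT z:K|lebesgue. g0 z * \<phi> z) + (\<Sum>i\<in>UNIV. - (LINT z:K|lebesgue. gi i z * \<phi> z)) =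
      - (LINT z:K|lebesgue. g0 z * \<phi> z + (\<Sum>i\<in>UNIV. gi i z * \<phi> z))"
    using set_integrable_mult_continuous[OF loc(2) K(1) cK(1)]
      set_integral_sum[of UNIV lebesgue K "\<lambda>i z. gi i z * \<phi> z"] set_integrable_mult_continuous[OF loc(4) K(1) cK(1)]
    by (simp add: set_integral_add sum_negf)
  also have "(LINT z:K|lebesgue. g0 z * \<phi> z + (\<Sum>i\<in>UNIV. gi i z * \<phi> z)) =
      (LINT z:S|lebesgue. (g0 z + (\<Sum>i\<in>UNIV. gi i z)) * \<phi> z)"
    by (rule set_integral_eq_on_subset[OF K(2)]) (use K in \<open>auto simp: distrib_right sum_distrib_right\<close>)
  finally show ?thesis .
qed

section \<open>Integral and differential form of the transport theorem\<close>

context moving_window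
begin

lemma set_integrals_over_G:
  fixes g :: "real \<times> 'a \<Rightarrow> real"
  assumes g: "locally_integrable_on S g" and st: "c < \<sigma>" "\<sigma> \<le> \<tau>" "\<tau> < d"
  shows "AE t in lebesgue. t \<in> {\<sigma>..\<tau>} \<longrightarrow> set_integrable lebesgue (G t) (\<lambda>x. g (t, x))"
    and "set_integrable lebesgue {\<sigma>..\<tau>} (\<lambda>t. LINT x:G t|lebesgue. g (t, x))"
    and "(LINT t:{\<sigma>..\<tau>}|lebesgue. (LINT x:G t|lebesgue. g (t, x))) =
      (LINT z:{z. \<sigma> < fst z \<and> fst z \<le> \<tau> \<and> snd z \<in> G (fst z)}|lebesgue. g z)"
proof -
  \<comment> \<open>Radius 0 gives the part of the tube over \<open>[\<sigma>, \<tau>]\<close>, a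
    compact set, so that \<open>g\<close> is integrable over it and Fubini applies.\<close>
  define T where "T = slab \<sigma> \<tau> 0"
  have T: "compact T" unfolding T_def using st by (intro compact_slab) auto
  have "T \<subseteq> N" using st \<epsilon> by (auto simp: T_def N_def slab_def)
  then have TS: "T \<subseteq> S" using N_subset by blast
  have iT: "set_integrable lebesgue T g" using g T TS unfolding locally_integrable_on_def by blast
  have mem: "(t, x) \<in> T \<longleftrightarrow> t \<in> {\<sigma>..\<tau>} \<and> x \<in> G t" for t x
    using mem_G_iff_D_eq_0[of t x] st D_nonneg[of "(t, x)"] by (auto simp: T_def slab_def)
  have slice: "{x. (t, x) \<in> T} = (if t \<in> {\<sigma>..\<tau>} then G t else {})" for t
    by (auto simp: mem)
  show "AE t in lebesgue. t \<in> {\<sigma>..\<tau>} \<longrightarrow> set_integrable lebesgue (G t) (\<lambda>x. g (t, x))"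
    using AE_set_integrable_slice[OF iT] by eventually_elim (auto simp: slice split: if_splits)
  have eq: "(LINT x:{x. (t, x) \<in> T}|lebesgue. g (t, x)) = indicator {\<sigma>..\<tau>} t *\<^sub>R (LINT x:G t|lebesgue. g (t, x))" for t
    by (auto simp: slice set_lebesgue_integral_def)
  show "set_integrable lebesgue {\<sigma>..\<tau>} (\<lambda>t. LINT x:G t|lebesgue. g (t, x))"
    using integrable_set_integral_slice[OF iT] unfolding eq set_integrable_def .
  \<comment> \<open>Leaving out the slice at time \<sigma>, part of a hyperplane, turns
    \<open>T\<close> into the half-open set that arose as the limit of the cutoffs.\<close>
  define T' where "T' = {z. \<sigma> < fst z \<and> fst z \<le> \<tau> \<and> snd z \<in> G (fst z)}"
  have T': "T' = T \<inter> {z. \<sigma> < fst z}" using mem by (auto simp: T'_def)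
  have "open {z :: real \<times> 'a. \<sigma> < fst z}" by (intro open_Collect_less continuous_intros)
  then have "T' \<in> sets lebesgue" unfolding T' using T by (intro sets.Int) (auto simp: compact_imp_closed)
  then have iT': "set_integrable lebesgue T' g"
    by (rule set_integrable_subset[OF iT]) (auto simp: T')
  have "negligible {z :: real \<times> 'a. z \<bullet> (1, 0) = \<sigma>}"
    by (rule negligible_standard_hyperplane) (simp add: Basis_prod_def)
  then have "{z :: real \<times> 'a. fst z = \<sigma>} \<in> null_sets lebesgue"
    by (simp add: negligible_iff_null_sets inner_Pair_0 inner_prod_def)
  from AE_not_in[OF this] have ae: "AE z in lebesgue. indicator T z *\<^sub>R g z = indicator T' z *\<^sub>R g z"
    by eventually_elim (auto simp: mem T'_def indicator_def)
  have "(LINT t:{\<sigma>..\<tau>}|lebesgue. (LINT x:G t|lebesgue. g (t, x))) = (LINT z:T|lebesgue. g z)"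
    unfolding set_lebesgue_integral_def[of lebesgue "{\<sigma>..\<tau>}"] using set_integral_slices[OF iT] unfolding eq .
  also have "\<dots> = (LINT z:T'|lebesgue. g z)"
    unfolding set_lebesgue_integral_def
    by (rule integral_cong_AE)
      (use iT iT' ae in \<open>auto simp: set_integrable_def dest: borel_measurable_integrable\<close>)
  finally show "(LINT t:{\<sigma>..\<tau>}|lebesgue. (LINT x:G t|lebesgue. g (t, x))) =
      (LINT z:{z. \<sigma> < fst z \<and> fst z \<le> \<tau> \<and> snd z \<in> G (fst z)}|lebesgue. g z)"
    unfolding T'_def .
qed

lemma compact_snd_N: "compact (snd ` N)"
  by (intro compact_continuous_image compact_N continuous_intros)

lemma snd_N_subset: "S \<subseteq> I \<times> \<Omega> \<Longrightarrow> snd ` N \<subseteq> \<Omega>"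
  using N_subset by force

lemma G_subset_snd_N: "t \<in> {c..d} \<Longrightarrow> G t \<subseteq> snd ` N"
proof
  fix x assume t: "t \<in> {c..d}" and "x \<in> G t"
  then have "(t, x) \<in> N" using mem_G_iff_D_eq_0[OF t] \<epsilon> by (auto simp: N_def slab_def)
  then show "x \<in> snd ` N" by force
qed

lemma transport_formula:
  fixes \<psi> g :: "real \<times> 'a \<Rightarrow> real"
  assumes \<psi>: "locally_integrable_on S \<psi>" and g: "locally_integrable_on S g"
    and weak: "\<And>\<phi>. test_function S \<phi> \<Longrightarrow>
      (LINT z:S|lebesgue. \<psi> z * frechet_derivative \<phi> (at z) (1, v (fst z) (snd z))) = - (LINT z:S|lebesgue. g z * \<phi> z)"
    and slice: "\<And>t. t \<in> {c..d} \<Longrightarrow> set_integrable lebesgue (snd ` N) (\<lambda>x. \<psi> (t, x))"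
    and cont: "\<And>s. s \<in> {c..d} \<Longrightarrow>
      ((\<lambda>t. LINT x:snd ` N|lebesgue. \<bar>\<psi> (t, x) - \<psi> (s, x)\<bar>) \<longlongrightarrow> 0) (at s within {c..d})"
    and st: "c < \<sigma>" "\<sigma> \<le> \<tau>" "\<tau> < d"
  shows "(LINT x:G \<tau>|lebesgue. \<psi> (\<tau>, x)) - (LINT x:G \<sigma>|lebesgue. \<psi> (\<sigma>, x)) =
    (LINT t:{\<sigma>..\<tau>}|lebesgue. (LINT x:G t|lebesgue. g (t, x)))"
proof -
  have iN: "set_integrable lebesgue N f" if "locally_integrable_on S f" for f
    using that compact_N N_subset unfolding locally_integrable_on_def by blast
  show ?thesis
    unfolding set_integrals_over_G(3)[OF g st]
    by (rule transport_identity[OF iN[OF \<psi>] iN[OF g] _ compact_snd_N order_refl slice cont st])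
      (use weak in \<open>simp_all add: V_def\<close>)
qed

end

section \<open>Continuity in time of integrals over the moving set\<close>

lemma slice_L1_tendsto:
  fixes p :: "real \<times> 'a::euclidean_space \<Rightarrow> real"
  assumes A: "compact A" and K: "compact K" and p: "continuous_on (A \<times> K) p"
    and u: "\<And>k. u k \<in> A" "u \<longlonglongrightarrow> s" "s \<in> A"
  shows "(\<lambda>k. LINT x:K|lebesgue. \<bar>p (u k, x) - p (s, x)\<bar>) \<longlonglongrightarrow> 0"
proof -
  obtain C where C: "C > 0" "\<And>z. z \<in> A \<times> K \<Longrightarrow> \<bar>p z\<bar> \<le> C"
    using compact_imp_bounded[OF compact_continuous_image[OF p compact_Times[OF A K]]] unfolding bounded_pos by auto
  note one = set_integrable_one_compact[OF K]
  have cp: "continuous_on K (\<lambda>x. p (t, x))" if "t \<in> A" for t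
    by (rule continuous_on_compose2[OF p]) (use that in \<open>auto intro!: continuous_intros\<close>)
  have "(\<lambda>k. LINT x:K|lebesgue. 1 * \<bar>p (u k, x) - p (s, x)\<bar>) \<longlonglongrightarrow> (LINT x:K|lebesgue. 1 * 0)"
  proof (rule set_integral_mult_dominated_convergence[OF one K, where C="2 * C"])
    show "continuous_on K (\<lambda>x. \<bar>p (u k, x) - p (s, x)\<bar>)" for k
      by (intro continuous_intros cp u)
    show "\<bar>\<bar>p (u k, x) - p (s, x)\<bar>\<bar> \<le> 2 * C" if "x \<in> K" for k x
      using C(2)[of "(u k, x)"] C(2)[of "(s, x)"] u that by auto
    fix x assume x: "x \<in> K"
    have "(\<lambda>k. p (u k, x)) \<longlonglongrightarrow> p (s, x)"
      by (rule continuous_on_tendsto_compose[OF p, of "\<lambda>k. (u k, x)"])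
        (use u x in \<open>auto intro!: tendsto_intros\<close>)
    then show "(\<lambda>k. \<bar>p (u k, x) - p (s, x)\<bar>) \<longlonglongrightarrow> 0"
      using tendsto_rabs[of "\<lambda>k. p (u k, x) - p (s, x)" 0] LIM_zero by force
  qed
  then show ?thesis by (simp add: set_lebesgue_integral_def)
qed

context moving_window
begin

lemma slice_L1_continuous:
  fixes p :: "real \<times> 'a \<Rightarrow> real"
  assumes S: "{c..d} \<times> snd ` N \<subseteq> S" and p: "continuous_on S p" and s: "s \<in> {c..d}"
  shows "((\<lambda>t. LINT x:snd ` N|lebesgue. \<bar>p (t, x) - p (s, x)\<bar>) \<longlongrightarrow> 0) (at s within {c..d})"
  unfolding tendsto_at_iff_sequentially comp_def
  using slice_L1_tendsto[OF compact_Icc compact_snd_N continuous_on_subset[OF p S]] s by blast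

text \<open>
  \<open>G t - G s\<close> shrinks to a null set because the tube is closed; for \<open>G s - G t\<close> the continuity
  of the volume is needed.
\<close>

lemma integral_over_G_continuous:
  fixes g :: "real \<times> 'a \<Rightarrow> real"
  assumes S: "{c..d} \<times> snd ` N \<subseteq> S" and g: "continuous_on S g"
    and vol: "continuous_on {c<..<d} (\<lambda>t. measure lebesgue (G t))" and s: "s \<in> {c<..<d}"
  shows "isCont (\<lambda>t. LINT x:G t|lebesgue. g (t, x)) s"
  unfolding continuous_at_sequentially
proof (intro allI impI)
  let ?K = "snd ` N" and ?R = "\<lambda>t. LINT x:G t|lebesgue. g (t, x)"
  fix u assume u: "u \<longlonglongrightarrow> s"
  \<comment> \<open>The sequence is corrected where it lies outside the window, which happens only
    finitely often as it converges to an interior point.\<close>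
  define w where "w k = (if u k \<in> {c<..<d} then u k else s)" for k
  have ev: "\<forall>\<^sub>F k in sequentially. w k = u k"
  proof -
    have "\<forall>\<^sub>F k in sequentially. u k \<in> {c<..<d}"
      using topological_tendstoD[OF u open_greaterThanLessThan s] .
    then show ?thesis by eventually_elim (simp add: w_def)
  qed
  then have ws: "w \<longlonglongrightarrow> s" using u tendsto_cong by fast
  have wcd: "w k \<in> {c<..<d}" for k using s by (simp add: w_def)
  then have wcd': "w k \<in> {c..d}" for k by (meson greaterThanLessThan_subseteq_atLeastAtMost_iff order_refl subsetD)
  have scd: "s \<in> {c..d}" using s by simp
  have GK: "G t \<subseteq> ?K" if "t \<in> {c..d}" for t using G_subset_snd_N[OF that] .
  have compG: "compact (G t)" if "t \<in> {c..d}" for t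
    using G(1)[OF that] GK[OF that] compact_snd_N by (meson bounded_subset compact_eq_bounded_closed)
  have lm: "G t \<in> lmeasurable" if "t \<in> {c..d}" for t using lmeasurable_compact[OF compG[OF that]] .
  have cg: "continuous_on ?K (\<lambda>x. g (t, x))" if "t \<in> {c..d}" for t
    by (rule continuous_on_compose2[OF continuous_on_subset[OF g S]]) (use that in \<open>auto intro!: continuous_intros\<close>)
  obtain C where C: "C > 0" "\<And>z. z \<in> {c..d} \<times> ?K \<Longrightarrow> \<bar>g z\<bar> \<le> C"
    using compact_imp_bounded[OF compact_continuous_image[OF continuous_on_subset[OF g S] compact_Times[OF compact_Icc compact_snd_N]]]
    unfolding bounded_pos by auto
  note iG = set_integrable_one_compact[OF compG] and iK = set_integrable_one_compact[OF compact_snd_N]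
  have igK: "set_integrable lebesgue ?K (\<lambda>x. g (t, x))" if "t \<in> {c..d}" for t
    using set_integrable_mult_continuous[OF iK compact_snd_N cg[OF that]] by simp
  have igG: "set_integrable lebesgue (G t) (\<lambda>x. g (r, x))" if "t \<in> {c..d}" "r \<in> {c..d}" for t r
    using set_integrable_mult_continuous[OF iG[OF that(1)] compG[OF that(1)] continuous_on_subset[OF cg[OF that(2)] GK[OF that(1)]]] by simp
  define d1 where "d1 k = (LINT x:?K|lebesgue. \<bar>g (w k, x) - g (s, x)\<bar>)" for k
  define d2 where "d2 k = measure lebesgue (G (w k) - G s)" for k
  define d3 where "d3 k = measure lebesgue (G s) - measure lebesgue (G (w k))" for k
  \<comment> \<open>The indicator of the symmetric difference of \<open>G (w k)\<close> and
    \<open>G s\<close> is twice that of \<open>G (w k) - G s\<close>, plus that of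
    \<open>G s\<close>, minus that of \<open>G (w k)\<close>. So its integral is
    \<open>2 * d2 k + d3 k\<close>, where \<open>d3\<close> is a mere difference of volumes.\<close>
  have bound: "\<bar>?R (w k) - ?R s\<bar> \<le> d1 k + C * (2 * d2 k + d3 k)" for k
  proof -
    let ?t = "w k"
    let ?a = "\<lambda>x. indicator (G ?t) x :: real" and ?b = "\<lambda>x. indicator (G s) x :: real"
    have ia: "integrable lebesgue ?a" "integrable lebesgue ?b"
      using lm[OF wcd'] lm[OF scd] by (auto simp: lmeasurable_iff_integrable)
    have lmd: "G ?t - G s \<in> lmeasurable" using lm[OF wcd'] lm[OF scd] by (rule fmeasurable.Diff)
    then have id: "integrable lebesgue (\<lambda>x. indicator (G ?t - G s) x :: real)" by (simp add: lmeasurable_iff_integrable)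
    have i1: "integrable lebesgue (\<lambda>x. ?a x * g (?t, x))" "integrable lebesgue (\<lambda>x. ?b x * g (s, x))"
      using igG[OF wcd' wcd'] igG[OF scd scd] by (auto simp: set_integrable_def)
    have i2: "integrable lebesgue (\<lambda>x. indicator ?K x * \<bar>g (?t, x) - g (s, x)\<bar>)"
      using set_integral_diff(1)[OF igK[OF wcd'] igK[OF scd]] set_integrable_abs unfolding set_integrable_def by fastforce
    have "\<bar>?R ?t - ?R s\<bar> = \<bar>LINT x|lebesgue. ?a x * g (?t, x) - ?b x * g (s, x)\<bar>"
      using i1 by (simp add: set_lebesgue_integral_def)
    also have "\<dots> \<le> (LINT x|lebesgue. \<bar>?a x * g (?t, x) - ?b x * g (s, x)\<bar>)" by (rule integral_abs_bound)
    also have "\<dots> \<le> (LINT x|lebesgue. indicator ?K x * \<bar>g (?t, x) - g (s, x)\<bar> + C * (2 * indicator (G ?t - G s) x + (?b x - ?a x)))"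
    proof (rule integral_mono)
      fix x
      have gx: "\<bar>g (s, x)\<bar> \<le> C" "\<bar>g (?t, x)\<bar> \<le> C" if "x \<in> ?K" using C(2) that wcd' scd by auto
      show "\<bar>?a x * g (?t, x) - ?b x * g (s, x)\<bar> \<le> indicator ?K x * \<bar>g (?t, x) - g (s, x)\<bar> + C * (2 * indicator (G ?t - G s) x + (?b x - ?a x))"
      proof (cases "x \<in> ?K")
        case True
        then show ?thesis
          using gx by (cases "x \<in> G ?t"; cases "x \<in> G s"; simp add: indicator_def; linarith)
      next
        case False
        then have "x \<notin> G ?t" "x \<notin> G s" using GK[OF wcd'[of k]] GK[OF scd] by blast+
        then show ?thesis by (simp add: indicator_def)
      qed
    qed (use i1 i2 ia id in auto)
    also have "\<dots> = d1 k + C * (2 * d2 k + d3 k)"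
      using i2 ia id lm[OF wcd'] lm[OF scd] by (simp add: d1_def d2_def d3_def set_lebesgue_integral_def)
    finally show ?thesis .
  qed
  have d1: "d1 \<longlonglongrightarrow> 0" unfolding d1_def
    by (rule slice_L1_tendsto[OF compact_Icc compact_snd_N continuous_on_subset[OF g S] wcd' ws scd])
  have d3: "d3 \<longlonglongrightarrow> 0"
  proof -
    have "(\<lambda>k. measure lebesgue (G (w k))) \<longlonglongrightarrow> measure lebesgue (G s)"
      by (rule continuous_on_tendsto_compose[OF vol ws s]) (use wcd in auto)
    from tendsto_diff[OF tendsto_const[of "measure lebesgue (G s)"] this] show ?thesis unfolding d3_def by simp
  qed
  have d2: "d2 \<longlonglongrightarrow> 0"
  proof -
    have "(\<lambda>k. LINT x|lebesgue. indicator (G (w k) - G s) x) \<longlonglongrightarrow> (LINT x|(lebesgue :: 'a measure). (0::real))"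
    proof (rule integral_dominated_convergence)
      show "integrable lebesgue (indicator ?K :: _ \<Rightarrow> real)" using lmeasurable_compact[OF compact_snd_N] by (simp add: lmeasurable_iff_integrable)
      show "(\<lambda>x. indicator (G (w k) - G s) x :: real) \<in> borel_measurable lebesgue" for k
        using lm[OF wcd'] lm[OF scd] by (intro borel_measurable_indicator sets.Diff) (auto dest: fmeasurableD)
      show "AE x in lebesgue. norm (indicator (G (w k) - G s) x :: real) \<le> indicator ?K x" for k
        using GK[OF wcd'] by (intro AE_I2) (auto simp: indicator_def)
      show "AE x in lebesgue. (\<lambda>k. indicator (G (w k) - G s) x :: real) \<longlonglongrightarrow> 0"
      proof (rule AE_I2)
        fix x
        show "(\<lambda>k. indicator (G (w k) - G s) x :: real) \<longlonglongrightarrow> 0"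
        proof (cases "x \<in> G s")
          case False
          then have "D (s, x) > 0" using mem_G_iff_D_eq_0[OF scd] D_nonneg[of "(s, x)"] by force
          moreover have "(\<lambda>k. D (w k, x)) \<longlonglongrightarrow> D (s, x)"
            by (rule continuous_on_tendsto_compose[OF continuous_on_D[of UNIV]]) (auto intro!: tendsto_intros ws)
          ultimately have "\<forall>\<^sub>F k in sequentially. D (w k, x) > 0" by (rule order_tendstoD(1)[rotated])
          then have "\<forall>\<^sub>F k in sequentially. 0 = (indicator (G (w k) - G s) x :: real)"
            by eventually_elim (use mem_G_iff_D_eq_0[OF wcd'] in \<open>auto simp: indicator_def\<close>)
          then show ?thesis by (rule Lim_transform_eventually[OF tendsto_const])
        qed simp
      qed
    qed simp
    then show ?thesis using lm[OF wcd'] lm[OF scd] by (simp add: d2_def[abs_def] fmeasurable.Diff)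
  qed
  have "(\<lambda>k. d1 k + C * (2 * d2 k + d3 k)) \<longlonglongrightarrow> 0 + C * (2 * 0 + 0)"
    by (intro tendsto_intros d1 d2 d3)
  then have "(\<lambda>k. ?R (w k) - ?R s) \<longlonglongrightarrow> 0"
    by (intro Lim_null_comparison[of "\<lambda>k. ?R (w k) - ?R s" "\<lambda>k. d1 k + C * (2 * d2 k + d3 k)"]) (use bound in auto)
  then have "(\<lambda>k. ?R (w k)) \<longlonglongrightarrow> ?R s" by (rule LIM_zero_cancel)
  moreover have "\<forall>\<^sub>F k in sequentially. ?R (w k) = (?R \<circ> u) k" using ev by eventually_elim simp
  ultimately show "(?R \<circ> u) \<longlonglongrightarrow> ?R s" by (rule Lim_transform_eventually)
qed

end

section \<open>Classical rates of change\<close>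

lemma Ck_on_1I:
  assumes "\<And>x. x \<in> S \<Longrightarrow> (f has_derivative f' x) (at x)" "\<And>h. continuous_on S (\<lambda>x. f' x h)"
  shows "Ck_on 1 S f"
proof -
  have "frechet_derivative f (at x) h = f' x h" if "x \<in> S" for x h
    using frechet_derivative_at[OF assms(1)[OF that]] by metis
  then have "continuous_on S (\<lambda>x. frechet_derivative f (at x) h)" for h
    using assms(2)[of h] by (simp cong: continuous_on_cong)
  then show ?thesis using assms(1) by (auto simp: differentiable_def)
qed

lemma Ck_on_1_mult:
  fixes f g :: "'a::euclidean_space \<Rightarrow> real"
  assumes f: "Ck_on 1 S f" and g: "Ck_on 1 S g"
  shows "Ck_on 1 S (\<lambda>x. f x * g x)"
proof (rule Ck_on_1I)
  show "((\<lambda>x. f x * g x) has_derivative (\<lambda>h. f x * frechet_derivative g (at x) h + frechet_derivative f (at x) h * g x)) (at x)"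
    if "x \<in> S" for x
    by (rule has_derivative_mult[OF Ck_on_1D(1)[OF f that] Ck_on_1D(1)[OF g that]])
qed (intro continuous_intros Ck_on_1D(2,3)[OF f] Ck_on_1D(2,3)[OF g])

lemma Ck_on_1_nth:
  fixes f :: "'a::euclidean_space \<Rightarrow> real^'n"
  assumes f: "Ck_on 1 S f"
  shows "Ck_on 1 S (\<lambda>x. f x $ i)"
proof (rule Ck_on_1I)
  show "((\<lambda>x. f x $ i) has_derivative (\<lambda>h. frechet_derivative f (at x) h $ i)) (at x)" if "x \<in> S" for x
    using bounded_linear.has_derivative[OF bounded_linear_vec_nth Ck_on_1D(1)[OF f that]] .
qed (intro continuous_intros Ck_on_1D(2)[OF f])

lemma partial_derivatives_of_slices:
  fixes f :: "real \<times> 'a::euclidean_space \<Rightarrow> real"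
  assumes "f differentiable (at (t, x))"
  shows "frechet_derivative (\<lambda>y. f (t, y)) (at x) h = frechet_derivative f (at (t, x)) (0, h)"
    and "deriv (\<lambda>s. f (s, x)) t = frechet_derivative f (at (t, x)) (1, 0)"
proof -
  have f: "(f has_derivative frechet_derivative f (at (t, x))) (at (t, x))"
    using assms by (simp add: frechet_derivative_works)
  have "((\<lambda>y. (t, y)) has_derivative (\<lambda>h. (0, h))) (at x)" by (auto intro!: derivative_eq_intros)
  from has_derivative_compose[OF this f]
  show "frechet_derivative (\<lambda>y. f (t, y)) (at x) h = frechet_derivative f (at (t, x)) (0, h)"
    using frechet_derivative_at by metis
  have "((\<lambda>s. (s, x)) has_derivative (\<lambda>h. (h, 0))) (at t)" by (auto intro!: derivative_eq_intros)
  from has_derivative_compose[OF this f]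
  have "((\<lambda>s. f (s, x)) has_derivative (\<lambda>h. frechet_derivative f (at (t, x)) (h, 0))) (at t)" .
  moreover have "(\<lambda>h. frechet_derivative f (at (t, x)) (h, 0)) = (*) (frechet_derivative f (at (t, x)) (1, 0))"
  proof
    fix h :: real
    show "frechet_derivative f (at (t, x)) (h, 0) = frechet_derivative f (at (t, x)) (1, 0) * h"
      using linear_cmul[OF has_derivative_linear[OF f], of h "(1, 0)"] by (simp add: mult.commute)
  qed
  ultimately show "deriv (\<lambda>s. f (s, x)) t = frechet_derivative f (at (t, x)) (1, 0)"
    by (intro DERIV_imp_deriv) (simp add: has_field_derivative_def)
qed

text \<open>The partial derivatives are those of functions on space-time, the form in which the weak
  equation is stated; on \<open>S\<close> they agree with the derivatives of the slices in time and
  in space.\<close>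

definition transport_rate ::
  "(real \<Rightarrow> real^'n \<Rightarrow> real^'n) \<Rightarrow> (real \<times> (real^'n) \<Rightarrow> real) \<Rightarrow> real \<times> (real^'n) \<Rightarrow> real" where
  "transport_rate v p z = frechet_derivative p (at z) (1, 0) +
     (\<Sum>i\<in>UNIV. frechet_derivative (\<lambda>z. p z * v (fst z) (snd z) $ i) (at z) (0, axis i 1))"

lemma transport_rate_C1:
  fixes v :: "real \<Rightarrow> real^'n \<Rightarrow> real^'n"
  assumes S: "open S" and v: "Ck_on 1 S (\<lambda>(t, x). v t x)" and p: "Ck_on 1 S p"
  shows "continuous_on S (transport_rate v p)"
    and "test_function S \<phi> \<Longrightarrow> (LINT z:S|lebesgue. p z * frechet_derivative \<phi> (at z) (1, v (fst z) (snd z))) =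
      - (LINT z:S|lebesgue. transport_rate v p z * \<phi> z)"
    and "z \<in> S \<Longrightarrow> transport_rate v p z = deriv (\<lambda>s. p (s, snd z)) (fst z) +
      divergence (\<lambda>y. p (fst z, y) *\<^sub>R v (fst z) y) (snd z)"
proof -
  have vi: "Ck_on 1 S (\<lambda>z. v (fst z) (snd z) $ i)" for i
    using Ck_on_1_nth[OF v, of i] by (simp add: split_beta)
  note pvi = Ck_on_1_mult[OF p vi]
  show "continuous_on S (transport_rate v p)"
    unfolding transport_rate_def by (intro continuous_intros Ck_on_1D(2)[OF p] Ck_on_1D(2)[OF pvi])
  show "(LINT z:S|lebesgue. p z * frechet_derivative \<phi> (at z) (1, v (fst z) (snd z))) =
      - (LINT z:S|lebesgue. transport_rate v p z * \<phi> z)" if "test_function S \<phi>"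
    unfolding transport_rate_def
    by (rule weak_transport_equation[OF has_weak_partial_C1[OF S p] has_weak_partial_C1[OF S pvi] that])
  show "transport_rate v p z = deriv (\<lambda>s. p (s, snd z)) (fst z) +
      divergence (\<lambda>y. p (fst z, y) *\<^sub>R v (fst z) y) (snd z)" if z: "z \<in> S"
  proof -
    have dp: "p differentiable at (fst z, snd z)" using Ck_on_1D(1)[OF p z] by (auto simp: differentiable_def)
    have dpv: "(\<lambda>z. p z * v (fst z) (snd z) $ i) differentiable at (fst z, snd z)" for i
      using Ck_on_1D(1)[OF pvi z, of i] unfolding differentiable_def by auto
    show ?thesis
      unfolding transport_rate_def divergence_def
      using partial_derivatives_of_slices(2)[OF dp] partial_derivatives_of_slices(1)[OF dpv] by simp
  qed
qed

text \<open>The images of the initial set under chosen trajectories are known to be the co-moving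
  volumes only at times in the window; this carries the window estimates from one family to the
  other.\<close>

lemma moving_window_cong:
  assumes "moving_window S v c d G \<epsilon> L M" and eq: "\<And>t. t \<in> {c..d} \<Longrightarrow> G' t = G t"
  shows "moving_window S v c d G' \<epsilon> L M"
proof -
  interpret moving_window S v c d G \<epsilon> L M by fact
  show ?thesis
  proof
    have "{(t, x). t \<in> {c..d} \<and> x \<in> G' t} = {(t, x). t \<in> {c..d} \<and> x \<in> G t}" using eq by auto
    then show "compact {(t, x). t \<in> {c..d} \<and> x \<in> G' t}" using tube by simp
    show "\<exists>h0>0. \<forall>t x h. t \<in> {c..d} \<and> t + h \<in> {c..d} \<and> infdist x (G' t) \<le> \<epsilon> \<and> \<bar>h\<bar> < h0 \<longrightarrow>
       \<bar>infdist (x + h *\<^sub>R v t x) (G' (t + h)) - infdist x (G' t)\<bar> \<le> \<bar>h\<bar> * (L * infdist x (G' t) + e)" if "e > 0" for e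
    proof -
      from along[OF that] obtain h0 where h0: "h0 > 0" "\<forall>t x h. t \<in> {c..d} \<and> t + h \<in> {c..d} \<and> infdist x (G t) \<le> \<epsilon> \<and> \<bar>h\<bar> < h0 \<longrightarrow>
       \<bar>infdist (x + h *\<^sub>R v t x) (G (t + h)) - infdist x (G t)\<bar> \<le> \<bar>h\<bar> * (L * infdist x (G t) + e)"
        by blast
      show ?thesis
      proof (intro exI[of _ h0] conjI h0(1) allI impI)
        fix t x h assume a: "t \<in> {c..d} \<and> t + h \<in> {c..d} \<and> infdist x (G' t) \<le> \<epsilon> \<and> \<bar>h\<bar> < h0"
        then have "G' t = G t" "G' (t + h) = G (t + h)" using eq by blast+
        then show "\<bar>infdist (x + h *\<^sub>R v t x) (G' (t + h)) - infdist x (G' t)\<bar> \<le> \<bar>h\<bar> * (L * infdist x (G' t) + e)"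
          using h0(2)[rule_format, of t h x] a by simp
      qed
    qed
  qed (use cont_v cd G \<epsilon> L M nbhd lip eq in auto)
qed

lemma (in flow_window) ex_moving_window:
  assumes "c < d"
  shows "\<exists>\<epsilon> L M. moving_window S v c d G \<epsilon> L M"
proof -
  obtain \<epsilon> L where e: "\<epsilon> > 0" "L \<ge> 0" "\<And>t x. t \<in> {c..d} \<Longrightarrow> infdist x (G t) \<le> \<epsilon> \<Longrightarrow> (t, x) \<in> S"
    "\<And>e. e > 0 \<Longrightarrow> \<exists>h0>0. \<forall>t x h. t \<in> {c..d} \<and> t + h \<in> {c..d} \<and> infdist x (G t) \<le> \<epsilon> \<and> \<bar>h\<bar> < h0 \<longrightarrow>
       \<bar>infdist (x + h *\<^sub>R v t x) (G (t + h)) - infdist x (G t)\<bar> \<le> \<bar>h\<bar> * (L * infdist x (G t) + e)"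
    by (rule distance_along_field) blast
  obtain M where M: "M \<ge> 0"
    "\<And>x s t. s \<in> {c..d} \<Longrightarrow> t \<in> {c..d} \<Longrightarrow> infdist x (G t) \<le> infdist x (G s) + M * \<bar>t - s\<bar>"
    by (rule infdist_G_lipschitz) blast
  have "moving_window S v c d G \<epsilon> L M"
    by (unfold_locales; (rule Ck_on_1D(3)[OF v] assms compact_tube[unfolded tube_def] compact_imp_closed[OF compact_G]
        G_nonempty e M; assumption))
  then show ?thesis by blast
qed

text \<open>The intervals with rational endpoints whose closures lie in \<open>I\<close> cover it,
  and there are only countably many, so the exceptional sets together form a null set.\<close>

lemma AE_open_set_from_intervals:
  assumes I: "open I" and P: "\<And>p q::real. p \<le> q \<Longrightarrow> {p..q} \<subseteq> I \<Longrightarrow> AE t in lebesgue. t \<in> {p<..<q} \<longrightarrow> P t"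
  shows "AE t in lebesgue. t \<in> I \<longrightarrow> P t"
proof -
  have "AE t in lebesgue. \<forall>p q :: rat. (real_of_rat p \<le> real_of_rat q \<and> {real_of_rat p..real_of_rat q} \<subseteq> I) \<longrightarrow>
      t \<in> {real_of_rat p<..<real_of_rat q} \<longrightarrow> P t"
    unfolding AE_all_countable
  proof (intro allI)
    fix p q :: rat
    show "AE t in lebesgue. (real_of_rat p \<le> real_of_rat q \<and> {real_of_rat p..real_of_rat q} \<subseteq> I) \<longrightarrow>
      t \<in> {real_of_rat p<..<real_of_rat q} \<longrightarrow> P t"
    proof (cases "real_of_rat p \<le> real_of_rat q \<and> {real_of_rat p..real_of_rat q} \<subseteq> I")
      case True
      from P[OF conjunct1[OF True] conjunct2[OF True]] show ?thesis by eventually_elim blast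
    qed (rule AE_I2, blast)
  qed
  then show ?thesis
  proof eventually_elim
    case (elim t)
    show ?case
    proof
      assume "t \<in> I"
      then obtain e where e: "e > 0" "ball t e \<subseteq> I" using I by (meson openE)
      obtain p where p: "t - e < real_of_rat p" "real_of_rat p < t" using of_rat_dense[of "t - e" t] e by auto
      obtain q where q: "t < real_of_rat q" "real_of_rat q < t + e" using of_rat_dense[of t "t + e"] e by auto
      have "{real_of_rat p..real_of_rat q} \<subseteq> ball t e" using p q by (auto simp: dist_real_def abs_less_iff)
      then show "P t" using elim p q e by (meson greaterThanLessThan_iff less_imp_le order_trans subset_trans)
    qed
  qed
qed


lemma set_integral_mono_subset:
  fixes f :: "'a::euclidean_space \<Rightarrow> real"
  assumes "set_integrable lebesgue A f" "set_integrable lebesgue B f" "A \<subseteq> B" "\<And>x. x \<in> B \<Longrightarrow> f x \<ge> 0"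
  shows "(LINT x:A|lebesgue. f x) \<le> (LINT x:B|lebesgue. f x)"
  unfolding set_lebesgue_integral_def
  by (rule integral_mono[OF assms(1)[unfolded set_integrable_def] assms(2)[unfolded set_integrable_def]])
    (use assms(3,4) in \<open>auto simp: indicator_def\<close>)

lemma continuous_into_L1_compact:
  assumes rep: "continuous_into_L1 I \<Omega> \<psi>" and A: "A \<subseteq> I" and K: "compact K" "K \<subseteq> \<Omega>"
  shows "t \<in> A \<Longrightarrow> set_integrable lebesgue K (\<psi> t)"
    and "s \<in> A \<Longrightarrow> ((\<lambda>t. LINT x:K|lebesgue. \<bar>\<psi> t x - \<psi> s x\<bar>) \<longlongrightarrow> 0) (at s within A)"
proof -
  have Ks: "K \<in> sets lebesgue" using K by (simp add: compact_imp_closed)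
  have iO: "set_integrable lebesgue \<Omega> (\<psi> t)" if "t \<in> A" for t
    using rep A that by (auto simp: continuous_into_L1_def)
  then have iK: "set_integrable lebesgue K (\<psi> t)" if "t \<in> A" for t
    using set_integrable_subset[OF _ Ks K(2)] that by blast
  then show "t \<in> A \<Longrightarrow> set_integrable lebesgue K (\<psi> t)" .
  assume s: "s \<in> A"
  have "((\<lambda>t. LINT x:\<Omega>|lebesgue. \<bar>\<psi> t x - \<psi> s x\<bar>) \<longlongrightarrow> 0) (at s within A)"
    using rep A s unfolding continuous_into_L1_def by (meson subsetD tendsto_within_subset)
  moreover have "norm (LINT x:K|lebesgue. \<bar>\<psi> t x - \<psi> s x\<bar>) \<le> (LINT x:\<Omega>|lebesgue. \<bar>\<psi> t x - \<psi> s x\<bar>)"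
    if t: "t \<in> A" for t
  proof -
    have "(LINT x:K|lebesgue. \<bar>\<psi> t x - \<psi> s x\<bar>) \<le> (LINT x:\<Omega>|lebesgue. \<bar>\<psi> t x - \<psi> s x\<bar>)"
      by (rule set_integral_mono_subset[OF _ _ K(2)])
        (auto intro!: set_integrable_abs set_integral_diff iK iO t s)
    moreover have "0 \<le> (LINT x:K|lebesgue. \<bar>\<psi> t x - \<psi> s x\<bar>)"
      unfolding set_lebesgue_integral_def by (rule Bochner_Integration.integral_nonneg) simp
    ultimately show ?thesis by simp
  qed
  ultimately show "((\<lambda>t. LINT x:K|lebesgue. \<bar>\<psi> t x - \<psi> s x\<bar>) \<longlongrightarrow> 0) (at s within A)"
    by (intro Lim_null_comparison[of "\<lambda>t. LINT x:K|lebesgue. \<bar>\<psi> t x - \<psi> s x\<bar>" "\<lambda>t. LINT x:\<Omega>|lebesgue. \<bar>\<psi> t x - \<psi> s x\<bar>"])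
      (auto simp: eventually_at_filter)
qed

section \<open>Regularity of primitives and the C^1 case\<close>

lemma integral_increments_continuous_on:
  fixes F R :: "real \<Rightarrow> real"
  assumes int: "\<And>\<sigma> \<tau>. c < \<sigma> \<Longrightarrow> \<sigma> \<le> \<tau> \<Longrightarrow> \<tau> < d \<Longrightarrow> set_integrable lebesgue {\<sigma>..\<tau>} R"
    and F: "\<And>\<sigma> \<tau>. c < \<sigma> \<Longrightarrow> \<sigma> \<le> \<tau> \<Longrightarrow> \<tau> < d \<Longrightarrow> F \<tau> - F \<sigma> = (LINT t:{\<sigma>..\<tau>}|lebesgue. R t)"
  shows "continuous_on {c<..<d} F"
proof (rule continuous_at_imp_continuous_on, rule ballI)
  fix s assume s: "s \<in> {c<..<d}"
  define p q where "p = (c + s) / 2" and "q = (s + d) / 2"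
  have pq: "c < p" "p < s" "s < q" "q < d" using s by (auto simp: p_def q_def)
  have eq: "F p + integral {p..t} R = F t" if "t \<in> {p..q}" for t
    using F[of p t] set_lebesgue_integral_eq_integral(2)[OF int[of p t]] that pq by simp
  have "R integrable_on {p..q}"
    by (rule set_lebesgue_integral_eq_integral(1)[OF int]) (use pq in auto)
  then have "continuous_on {p..q} (\<lambda>t. F p + integral {p..t} R)"
    by (intro continuous_intros indefinite_integral_continuous_1)
  then have "continuous_on {p..q} F" by (rule continuous_on_eq) (rule eq)
  then show "isCont F s" by (rule continuous_on_interior) (use pq in simp)
qed

lemma integral_increments_has_derivative:
  fixes F R :: "real \<Rightarrow> real"
  assumes int: "\<And>\<sigma> \<tau>. c < \<sigma> \<Longrightarrow> \<sigma> \<le> \<tau> \<Longrightarrow> \<tau> < d \<Longrightarrow> set_integrable lebesgue {\<sigma>..\<tau>} R"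
    and F: "\<And>\<sigma> \<tau>. c < \<sigma> \<Longrightarrow> \<sigma> \<le> \<tau> \<Longrightarrow> \<tau> < d \<Longrightarrow> F \<tau> - F \<sigma> = (LINT t:{\<sigma>..\<tau>}|lebesgue. R t)"
    and R: "\<And>s. s \<in> {c<..<d} \<Longrightarrow> isCont R s" and s: "s \<in> {c<..<d}"
  shows "(F has_real_derivative R s) (at s)"
proof -
  define p q where "p = (c + s) / 2" and "q = (s + d) / 2"
  have pq: "c < p" "p < s" "s < q" "q < d" using s by (auto simp: p_def q_def)
  have eq: "F p + integral {p..t} R = F t" if "t \<in> {p..q}" for t
    using F[of p t] set_lebesgue_integral_eq_integral(2)[OF int[of p t]] that pq by simp
  have "continuous_on {p..q} R"
    by (rule continuous_at_imp_continuous_on) (use R pq in auto)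
  then have "((\<lambda>t. integral {p..t} R) has_real_derivative R s) (at s within {p..q})"
    by (rule integral_has_real_derivative) (use pq in auto)
  then have "((\<lambda>t. integral {p..t} R) has_real_derivative R s) (at s)"
    using pq by (simp add: at_within_Icc_at)
  then have "((\<lambda>t. F p + integral {p..t} R) has_real_derivative R s) (at s)"
    by (auto intro!: derivative_eq_intros)
  then show ?thesis
    by (rule has_field_derivative_transform_within_open[where S="{p<..<q}"]) (use pq eq in auto)
qed

text \<open>\<open>g1\<close> plays the role of the divergence of \<open>v\<close>, the rate that
  belongs to the constant function 1. It makes the volume of \<open>G t\<close> a primitive; the
  rate of \<open>p\<close> is then continuous and the fundamental theorem of calculus applies at
  every time.\<close>

lemma (in moving_window) C1_transport_derivative:
  fixes p g :: "real \<times> 'a \<Rightarrow> real"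
  assumes S: "{c..d} \<times> snd ` N \<subseteq> S" and p: "continuous_on S p" and g: "continuous_on S g"
    and g1: "continuous_on S g1"
    and weak: "\<And>\<phi>. test_function S \<phi> \<Longrightarrow>
      (LINT z:S|lebesgue. p z * frechet_derivative \<phi> (at z) (1, v (fst z) (snd z))) = - (LINT z:S|lebesgue. g z * \<phi> z)"
    and weak1: "\<And>\<phi>. test_function S \<phi> \<Longrightarrow>
      (LINT z:S|lebesgue. 1 * frechet_derivative \<phi> (at z) (1, v (fst z) (snd z))) = - (LINT z:S|lebesgue. g1 z * \<phi> z)"
    and s: "s \<in> {c<..<d}"
  shows "((\<lambda>t. LINT x:G t|lebesgue. p (t, x)) has_real_derivative (LINT x:G s|lebesgue. g (s, x))) (at s)"
proof -
  have slice: "set_integrable lebesgue (snd ` N) (\<lambda>x. q (t, x))" if "continuous_on S q" "t \<in> {c..d}" for q :: "real \<times> 'a \<Rightarrow> real" and t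
  proof -
    note one = set_integrable_one_compact[OF compact_snd_N]
    have "continuous_on (snd ` N) (\<lambda>x. q (t, x))"
      by (rule continuous_on_compose2[OF continuous_on_subset[OF that(1) S]]) (use that(2) in \<open>auto intro!: continuous_intros\<close>)
    from set_integrable_mult_continuous[OF one compact_snd_N this] show ?thesis by simp
  qed
  have formula: "(LINT x:G \<tau>|lebesgue. q (\<tau>, x)) - (LINT x:G \<sigma>|lebesgue. q (\<sigma>, x)) =
      (LINT t:{\<sigma>..\<tau>}|lebesgue. (LINT x:G t|lebesgue. h (t, x)))"
    if "continuous_on S q" "continuous_on S h" "c < \<sigma>" "\<sigma> \<le> \<tau>" "\<tau> < d"
      "\<And>\<phi>. test_function S \<phi> \<Longrightarrow>
      (LINT z:S|lebesgue. q z * frechet_derivative \<phi> (at z) (1, v (fst z) (snd z))) = - (LINT z:S|lebesgue. h z * \<phi> z)"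
    for q h :: "real \<times> 'a \<Rightarrow> real" and \<sigma> \<tau>
    by (rule transport_formula[OF locally_integrable_on_continuous[OF that(1)] locally_integrable_on_continuous[OF that(2)]
          that(6) slice[OF that(1)] slice_L1_continuous[OF S that(1)] that(3,4,5)])
  note int = set_integrals_over_G(2)[OF locally_integrable_on_continuous]
  have "continuous_on {c<..<d} (\<lambda>t. LINT x:G t|lebesgue. (1::real))"
    by (rule integral_increments_continuous_on[where R="\<lambda>t. LINT x:G t|lebesgue. g1 (t, x)"])
      (use int[OF g1] formula[OF continuous_on_const g1 _ _ _ weak1] in auto)
  then have vol: "continuous_on {c<..<d} (\<lambda>t. measure lebesgue (G t))"
    by (simp add: set_lebesgue_integral_def)
  show ?thesis
    by (rule integral_increments_has_derivative[where c=c and d=d and R="\<lambda>t. LINT x:G t|lebesgue. g (t, x)"])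
      (use int[OF g] formula[OF p g _ _ _ weak] integral_over_G_continuous[OF S g vol] s in auto)
qed

theorem theorem1p1:
  fixes a b :: ereal
    and J J\<^sub>0 :: "real set"
    and \<Omega> G\<^sub>0 :: "(real^'n) set"
    and v :: "real \<Rightarrow> real^'n \<Rightarrow> real^'n"
    and t\<^sub>0 r :: real
    and G :: "real \<Rightarrow> (real^'n) set"
    and \<psi> \<rho> :: "real \<Rightarrow> real^'n \<Rightarrow> real"
  assumes J: "J = einterval a b"
    and \<Omega>: "open \<Omega>"
    and v: "Ck_on 1 (J \<times> \<Omega>) (\<lambda>(t, x). v t x)"
    and t\<^sub>0: "t\<^sub>0 \<in> J"
    and G\<^sub>0: "G\<^sub>0 \<subseteq> \<Omega>" "compact_lipschitz_domain G\<^sub>0"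
    and r: "r > 0"
    and J\<^sub>0: "J\<^sub>0 = {t\<^sub>0 - r<..<t\<^sub>0 + r} \<inter> J"
    and exist: "comoving_volumes_exist v \<Omega> t\<^sub>0 G\<^sub>0 J\<^sub>0"
    and G: "\<And>t. G t = comoving_volume v J \<Omega> t\<^sub>0 G\<^sub>0 t"
    and \<psi>: "W11 (J\<^sub>0 \<times> \<Omega>) (\<lambda>(t, x). \<psi> t x)"
    and rep: "continuous_into_L1 J\<^sub>0 \<Omega> \<psi>"
    and \<rho>: "\<And>t x. \<rho> t x = weak_dt (J\<^sub>0 \<times> \<Omega>) \<psi> t x
                       + weak_div (J\<^sub>0 \<times> \<Omega>) (\<lambda>s y. \<psi> s y *\<^sub>R v s y) t x"
  shows
    "(\<forall>t\<in>J\<^sub>0. set_integrable lebesgue (G t) (\<psi> t)) \<and>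
     (AE t in lebesgue. t \<in> J\<^sub>0 \<longrightarrow> set_integrable lebesgue (G t) (\<rho> t)) \<and>
     (\<forall>\<sigma> \<tau>. \<sigma> \<le> \<tau> \<and> {\<sigma>..\<tau>} \<subseteq> J\<^sub>0 \<longrightarrow>
        set_integrable lebesgue {\<sigma>..\<tau>} (\<lambda>t. LINT x:G t|lebesgue. \<rho> t x) \<and>
        (LINT x:G \<tau>|lebesgue. \<psi> \<tau> x) =
        (LINT x:G \<sigma>|lebesgue. \<psi> \<sigma> x) +
        (LINT t:{\<sigma>..\<tau>}|lebesgue. LINT x:G t|lebesgue. \<rho> t x)) \<and>
     (AE t in lebesgue. t \<in> J\<^sub>0 \<longrightarrow>
        ((\<lambda>s. LINT x:G s|lebesgue. \<psi> s x) has_real_derivative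
         (LINT x:G t|lebesgue. \<rho> t x)) (at t)) \<and>
     (Ck_on 1 (J\<^sub>0 \<times> \<Omega>) (\<lambda>(t, x). \<psi> t x) \<longrightarrow>
        (\<forall>t\<in>J\<^sub>0.
           set_integrable lebesgue (G t)
             (\<lambda>x. deriv (\<lambda>s. \<psi> s x) t + divergence (\<lambda>y. \<psi> t y *\<^sub>R v t y) x) \<and>
           ((\<lambda>s. LINT x:G s|lebesgue. \<psi> s x) has_real_derivative
            (LINT x:G t|lebesgue.
               deriv (\<lambda>s. \<psi> s x) t + divergence (\<lambda>y. \<psi> t y *\<^sub>R v t y) x)) (at t)))"
proof (cases "G\<^sub>0 = {}")
  \<comment> \<open>The empty set satisfies the definition of a compact Lipschitz domain but has no
    meaningful distance function; all integrals over it are zero.\<close>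
  case True
  then have "G t = {}" for t by (simp add: G comoving_volume_def)
  then show ?thesis by (simp add: set_integrable_def set_lebesgue_integral_def)
next
  case False
  define S where "S = J\<^sub>0 \<times> \<Omega>"
  have openJ: "open J" unfolding J by (rule open_einterval)
  have intJ: "is_interval J" unfolding J is_interval_1 einterval_def
    by clarify (meson ereal_less_eq(3) le_less_trans less_le_trans mem_Collect_eq)
  have J0: "open J\<^sub>0" "J\<^sub>0 \<subseteq> J" "t\<^sub>0 \<in> J\<^sub>0" using openJ r t\<^sub>0 unfolding J\<^sub>0 by auto
  have intJ0: "is_interval J\<^sub>0" unfolding J\<^sub>0 by (intro is_interval_Int intJ) (auto simp: is_interval_1)
  have openS: "open S" unfolding S_def by (intro open_Times J0 \<Omega>)
  have vS: "Ck_on 1 S (\<lambda>(t, x). v t x)" by (rule Ck_on_subset[OF v]) (use J0 in \<open>auto simp: S_def\<close>)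
  obtain X where X: "\<And>q. q \<in> G\<^sub>0 \<Longrightarrow> ode_solution v \<Omega> J\<^sub>0 t\<^sub>0 q (X q)"
    using exist unfolding comoving_volumes_exist_def by metis
  have GX: "G t = (\<lambda>q. X q t) ` G\<^sub>0" if "t \<in> J\<^sub>0" for t
    unfolding G comoving_volume_def
    by (rule image_cong[OF refl flow_map_eq[OF openJ \<Omega> v J0(1) intJ0 J0(2) X that]])
  \<comment> \<open>The window contains \<open>t\<^sub>0\<close> because the trajectories are
    parametrised by their positions at that time.\<close>
  have window: "\<exists>\<epsilon> L M. moving_window S v c d G \<epsilon> L M"
    if cd: "c < d" "{c..d} \<subseteq> J\<^sub>0" "t\<^sub>0 \<in> {c..d}" for c d
  proof -
    interpret fw: flow_window S v c d t\<^sub>0 G\<^sub>0 X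
    proof
      show "compact G\<^sub>0" using G\<^sub>0 by (simp add: compact_lipschitz_domain_def)
      show "integral_curve S v c d (X q)" if "q \<in> G\<^sub>0" for q
        unfolding integral_curve_def
      proof
        fix t assume "t \<in> {c..d}"
        then have t: "t \<in> J\<^sub>0" using cd(2) by blast
        then have "X q t \<in> \<Omega>" "(X q has_vector_derivative v t (X q t)) (at t within J\<^sub>0)"
          using X[OF that] by (auto simp: ode_solution_def)
        then show "(t, X q t) \<in> S \<and> (X q has_vector_derivative v t (X q t)) (at t within {c..d})"
          using t has_vector_derivative_within_subset[OF _ cd(2)] by (simp add: S_def)
      qed
      show "X q t\<^sub>0 = q" if "q \<in> G\<^sub>0" for q using X[OF that] by (simp add: ode_solution_def)
    qed (use openS vS cd False in auto)
    obtain \<epsilon> L M where "moving_window S v c d fw.G \<epsilon> L M" using fw.ex_moving_window[OF cd(1)] by blast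
    then have "moving_window S v c d G \<epsilon> L M"
      by (rule moving_window_cong) (use GX cd in \<open>auto simp: fw.G_def\<close>)
    then show ?thesis by blast
  qed
  \<comment> \<open>The end times have to be interior to the window, which leaves room for the ramps
    of the time cutoff. As \<open>J\<^sub>0\<close> is an open interval, a window can reach beyond
    them and beyond \<open>t\<^sub>0\<close>.\<close>
  have between: "\<exists>c d. c < d \<and> {c..d} \<subseteq> J\<^sub>0 \<and> t\<^sub>0 \<in> {c..d} \<and> c < p \<and> q < d"
    if pq: "p \<in> J\<^sub>0" "q \<in> J\<^sub>0" for p q
  proof -
    have "min p t\<^sub>0 \<in> J\<^sub>0" "max q t\<^sub>0 \<in> J\<^sub>0" using pq J0 by (auto simp: min_def max_def)
    then obtain e e' where e: "e > 0" "cball (min p t\<^sub>0) e \<subseteq> J\<^sub>0" "e' > 0" "cball (max q t\<^sub>0) e' \<subseteq> J\<^sub>0"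
      using J0(1) open_contains_cball by metis
    let ?c = "min p t\<^sub>0 - e" and ?d = "max q t\<^sub>0 + e'"
    have "?c \<in> J\<^sub>0" "?d \<in> J\<^sub>0" using e by (auto simp: dist_real_def)
    then have "{?c..?d} \<subseteq> J\<^sub>0" using intJ0 unfolding is_interval_1 by fastforce
    then show ?thesis using e by (intro exI[of _ ?c] exI[of _ ?d]) auto
  qed
  define p where "p = (\<lambda>z. \<psi> (fst z) (snd z))"
  have p_eq: "(\<lambda>(t, x). \<psi> t x) = p" by (auto simp: p_def)
  have snd_sub: "snd ` moving_window.N c d G \<epsilon> \<subseteq> \<Omega>" if "moving_window S v c d G \<epsilon> L M" for c d \<epsilon> L M
    using moving_window.snd_N_subset[OF that, of J\<^sub>0 \<Omega>] by (simp add: S_def)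
  have compG: "compact (G t) \<and> G t \<subseteq> \<Omega>" if t: "t \<in> J\<^sub>0" for t
  proof -
    obtain c d where win: "c < d" "{c..d} \<subseteq> J\<^sub>0" "t\<^sub>0 \<in> {c..d}" "c < t" "t < d" using between[OF t t] by blast
    obtain \<epsilon> L M where mw: "moving_window S v c d G \<epsilon> L M" using window[OF win(1-3)] by blast
    interpret moving_window S v c d G \<epsilon> L M by (rule mw)
    have "t \<in> {c..d}" using win by simp
    note sub = G_subset_snd_N[OF this]
    have "compact (G t)" using G(1)[OF \<open>t \<in> {c..d}\<close>] sub compact_snd_N by (meson bounded_subset compact_eq_bounded_closed)
    then show ?thesis using sub snd_sub[OF mw] by blast
  qed
  define g0 where "g0 = weak_partial S (1, 0) p"
  define gi where "gi i = weak_partial S (0, axis i 1) (\<lambda>z. p z * v (fst z) (snd z) $ i)" for i :: 'n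
  have basis: "(1, 0) \<in> (Basis :: (real \<times> (real^'n)) set)" "(0, axis i 1) \<in> (Basis :: (real \<times> (real^'n)) set)" for i
    by (auto simp: Basis_prod_def axis_in_Basis_iff)
  have hw0: "has_weak_partial S (1, 0) p g0"
    using \<psi> basis(1) unfolding W11_def p_eq S_def[symmetric] g0_def by (blast intro: weak_partial_works)
  \<comment> \<open>\<open>weak_partial\<close> is an arbitrary choice and means something only once
    a weak derivative is known to exist; for \<psi> times a component of \<open>v\<close> the
    product rule provides it.\<close>
  have hwi: "has_weak_partial S (0, axis i 1) (\<lambda>z. p z * v (fst z) (snd z) $ i) (gi i)" for i
  proof -
    obtain g where "has_weak_partial S (0, axis i 1) p g"
      using \<psi> basis(2) unfolding W11_def p_eq S_def[symmetric] by blast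
    moreover have "Ck_on 1 S (\<lambda>z. v (fst z) (snd z) $ i)"
      using Ck_on_1_nth[OF vS, of i] by (simp add: split_beta)
    ultimately show ?thesis unfolding gi_def by (intro weak_partial_works[OF has_weak_partial_mult_C1[OF openS]])
  qed
  define R where "R z = \<rho> (fst z) (snd z)" for z
  have R_eq: "R = (\<lambda>z. g0 z + (\<Sum>i\<in>UNIV. gi i z))"
    by (simp add: fun_eq_iff R_def \<rho> weak_dt_def weak_div_def p_eq S_def g0_def gi_def split_beta' p_def)
  have lp: "locally_integrable_on S p" using hw0 by (simp add: has_weak_partial_def)
  have lR: "locally_integrable_on S R"
    unfolding R_eq using hw0 hwi
    by (intro locally_integrable_on_add locally_integrable_on_sum) (auto simp: has_weak_partial_def)
  have weakR: "(LINT z:S|lebesgue. p z * frechet_derivative \<phi> (at z) (1, v (fst z) (snd z))) = - (LINT z:S|lebesgue. R z * \<phi> z)"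
    if "test_function S \<phi>" for \<phi>
    unfolding R_eq by (rule weak_transport_equation[OF hw0 hwi that])
  have main: "(AE t in lebesgue. t \<in> {\<sigma>..\<tau>} \<longrightarrow> set_integrable lebesgue (G t) (\<rho> t)) \<and>
     set_integrable lebesgue {\<sigma>..\<tau>} (\<lambda>t. LINT x:G t|lebesgue. \<rho> t x) \<and>
     (LINT x:G \<tau>|lebesgue. \<psi> \<tau> x) - (LINT x:G \<sigma>|lebesgue. \<psi> \<sigma> x) =
       (LINT t:{\<sigma>..\<tau>}|lebesgue. (LINT x:G t|lebesgue. \<rho> t x))"
    if st: "\<sigma> \<le> \<tau>" "{\<sigma>..\<tau>} \<subseteq> J\<^sub>0" for \<sigma> \<tau>
  proof -
    have "\<sigma> \<in> J\<^sub>0" "\<tau> \<in> J\<^sub>0" using st by auto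
    then obtain c d where win: "c < d" "{c..d} \<subseteq> J\<^sub>0" "t\<^sub>0 \<in> {c..d}" "c < \<sigma>" "\<tau> < d" using between by blast
    obtain \<epsilon> L M where mw: "moving_window S v c d G \<epsilon> L M" using window[OF win(1-3)] by blast
    interpret moving_window S v c d G \<epsilon> L M by (rule mw)
    note L1 = continuous_into_L1_compact[OF rep win(2) compact_snd_N snd_sub[OF mw]]
    have "(LINT x:G \<tau>|lebesgue. p (\<tau>, x)) - (LINT x:G \<sigma>|lebesgue. p (\<sigma>, x)) =
       (LINT t:{\<sigma>..\<tau>}|lebesgue. (LINT x:G t|lebesgue. R (t, x)))"
      by (rule transport_formula[OF lp lR weakR _ _ win(4) st(1) win(5)]) (use L1 in \<open>simp_all add: p_def\<close>)
    then show ?thesis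
      using set_integrals_over_G(1,2)[OF lR win(4) st(1) win(5)] by (simp add: R_def p_def)
  qed
  have AE1: "AE t in lebesgue. t \<in> J\<^sub>0 \<longrightarrow> set_integrable lebesgue (G t) (\<rho> t)"
  proof (rule AE_open_set_from_intervals[OF J0(1)])
    fix p q :: real assume "p \<le> q" "{p..q} \<subseteq> J\<^sub>0"
    from conjunct1[OF main[OF this]] show "AE t in lebesgue. t \<in> {p<..<q} \<longrightarrow> set_integrable lebesgue (G t) (\<rho> t)"
      by eventually_elim auto
  qed
  have AE2: "AE t in lebesgue. t \<in> J\<^sub>0 \<longrightarrow> ((\<lambda>s. LINT x:G s|lebesgue. \<psi> s x) has_real_derivative
         (LINT x:G t|lebesgue. \<rho> t x)) (at t)"
  proof (rule AE_open_set_from_intervals[OF J0(1)])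
    fix p q :: real assume pq: "p \<le> q" "{p..q} \<subseteq> J\<^sub>0"
    show "AE t in lebesgue. t \<in> {p<..<q} \<longrightarrow> ((\<lambda>s. LINT x:G s|lebesgue. \<psi> s x) has_real_derivative
         (LINT x:G t|lebesgue. \<rho> t x)) (at t)"
    proof (rule indefinite_integral_has_derivative_AE)
      show "set_integrable lebesgue {p..q} (\<lambda>t. LINT x:G t|lebesgue. \<rho> t x)" using main[OF pq] by blast
      fix s t assume st: "p \<le> s" "s \<le> t" "t \<le> q"
      then have "{s..t} \<subseteq> J\<^sub>0" using pq by force
      then show "(LINT x:G t|lebesgue. \<psi> t x) - (LINT x:G s|lebesgue. \<psi> s x) = (LINT x:{s..t}|lebesgue. (LINT y:G x|lebesgue. \<rho> x y))"
        using main[OF st(2)] by blast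
    qed
  qed
  \<comment> \<open>For every single \<open>t\<close> the classical rate has to be used: \<rho> is
    determined only up to a null set of space-time, which may contain a whole time slice.\<close>
  have C1: "set_integrable lebesgue (G t) (\<lambda>x. deriv (\<lambda>s. \<psi> s x) t + divergence (\<lambda>y. \<psi> t y *\<^sub>R v t y) x) \<and>
      ((\<lambda>s. LINT x:G s|lebesgue. \<psi> s x) has_real_derivative
       (LINT x:G t|lebesgue. deriv (\<lambda>s. \<psi> s x) t + divergence (\<lambda>y. \<psi> t y *\<^sub>R v t y) x)) (at t)"
    if C: "Ck_on 1 S p" and t: "t \<in> J\<^sub>0" for t
  proof -
    obtain c d where win: "c < d" "{c..d} \<subseteq> J\<^sub>0" "t\<^sub>0 \<in> {c..d}" "c < t" "t < d" using between[OF t t] by blast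
    obtain \<epsilon> L M where mw: "moving_window S v c d G \<epsilon> L M" using window[OF win(1-3)] by blast
    interpret moving_window S v c d G \<epsilon> L M by (rule mw)
    have sub: "{c..d} \<times> snd ` N \<subseteq> S" unfolding S_def using win(2) snd_sub[OF mw] by (rule Sigma_mono)
    have one: "Ck_on 1 S (\<lambda>_. 1::real)" by (rule Ck_on_subset[OF Ck_on_const]) simp
    note T = transport_rate_C1[OF openS vS C] and T1 = transport_rate_C1[OF openS vS one]
    have rate: "transport_rate v p (t, x) = deriv (\<lambda>s. \<psi> s x) t + divergence (\<lambda>y. \<psi> t y *\<^sub>R v t y) x"
      if "x \<in> G t" for x
    proof -
      have "(t, x) \<in> S" using compG[OF t] t that by (auto simp: S_def)
      from T(3)[OF this] show ?thesis by (simp add: p_def)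
    qed
    have "((\<lambda>t. LINT x:G t|lebesgue. p (t, x)) has_real_derivative (LINT x:G t|lebesgue. transport_rate v p (t, x))) (at t)"
      by (rule C1_transport_derivative[OF sub Ck_on_1D(3)[OF C] T(1) T1(1) T(2) T1(2)]) (use win in simp_all)
    moreover have "(LINT x:G t|lebesgue. transport_rate v p (t, x)) =
       (LINT x:G t|lebesgue. deriv (\<lambda>s. \<psi> s x) t + divergence (\<lambda>y. \<psi> t y *\<^sub>R v t y) x)"
      by (rule set_integral_eq_on_subset) (use rate in auto)
    moreover have "set_integrable lebesgue (G t) (\<lambda>x. deriv (\<lambda>s. \<psi> s x) t + divergence (\<lambda>y. \<psi> t y *\<^sub>R v t y) x)"
    proof -
      note one = set_integrable_one_compact[OF conjunct1[OF compG[OF t]]]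
      have "continuous_on (G t) (\<lambda>x. transport_rate v p (t, x))"
        by (rule continuous_on_compose2[OF T(1)]) (use compG[OF t] t in \<open>auto intro!: continuous_intros simp: S_def\<close>)
      from set_integrable_mult_continuous[OF one conjunct1[OF compG[OF t]] this]
      have "set_integrable lebesgue (G t) (\<lambda>x. transport_rate v p (t, x))" by simp
      moreover have "set_integrable lebesgue (G t) (\<lambda>x. transport_rate v p (t, x)) =
          set_integrable lebesgue (G t) (\<lambda>x. deriv (\<lambda>s. \<psi> s x) t + divergence (\<lambda>y. \<psi> t y *\<^sub>R v t y) x)"
        by (rule set_integrable_cong) (simp_all add: rate)
      ultimately show ?thesis by simp
    qed
    ultimately show ?thesis by (simp add: p_def)
  qed
  have slices: "set_integrable lebesgue (G t) (\<psi> t)" if "t \<in> J\<^sub>0" for t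
    using continuous_into_L1_compact(1)[OF rep order_refl] compG[OF that] that by blast
  show ?thesis
    using slices AE1 AE2 main C1 unfolding p_eq S_def[symmetric] by (auto simp: algebra_simps)
qed

end
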